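(* Let $Q_\pm(x,y)=\frac12(x^2\pm y^2)$ and $S_\pm=\{u=Q_\pm(x,y)\}\subset\mathbb{R}^3$, and let $$S^3_0\mathbb{R}^{2*}:=\frac{S^3\mathbb{R}^{2*}}{\mathbb{R}^{2*}\odot\mathbb{R}Q_\pm}.$$ Then, for any $\widetilde{\mathsf{CO}}(2)$-invariant (resp., $\widetilde{\mathsf{CO}}(1,1)$-invariant) subset $\overline{\Sigma}\subset S^3_0\mathbb{R}^{2*}$ (with the sign $+$, resp. $-$), the condition that the difference $[S]^3_p-[S_\pm]^3_p$ modulo $\mathbb{R}^{2*}\odot\mathbb{R}Q_\pm$ be $\overline{\Sigma}$-valued defines the $\mathrm{Aff}(3)$-invariant (system of) third-order PDE(s) $\mathcal{E}_\Sigma=\mathrm{Aff}(3)\cdot\Sigma\subset J^3_\pm$, where $\Sigma$ is the set of all $3$-jets $[S]^3_{p}$ at $p=(0,0,0)$ having the same $2$-jet as $S_\pm$ at $p$ and satisfying this condition.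
   Context: $J^\ell$ is the space of $\ell$-jets $[S]^\ell_p$ of surfaces $S$ of $\mathbb{R}^3=\{(x,y,u)\}$, with coordinates $x,y,u,u_x,u_y,u_{xx},\dots$ on jets of graphs; $J^3_+$ and $J^3_-$ are the subsets of jets with $\det(\mathrm{Hess}(u))=u_{xx}u_{yy}-u_{xy}^2>0$, resp. $<0$. $\mathrm{Aff}(3)$, the group of affine transformations of $\mathbb{R}^3$, acts on jets by $g\cdot[S]^\ell_p=[g(S)]^\ell_{g(p)}$, and a subset of $J^3$ is invariant if preserved by this action; $G\cdot A=\{g\cdot a\mid g\in G,\,a\in A\}$. Let $p=(0,0,0)$. The fibre of $J^3\to J^2$ over $[S_\pm]^2_p$ is an affine space modelled on the space $S^3\mathbb{R}^{2*}$ of cubic forms on $\mathbb{R}^2$ (differences of third-order Taylor terms): the difference $[S]^3_p-[S_\pm]^3_p$ of two jets in this fibre is the cubic form which in the basis $x^3,3x^2y,3xy^2,y^3$ has coordinates the differences of the coordinates $u_{xxx},u_{xxy},u_{xyy},u_{yyy}$. $\mathbb{R}^{2*}\odot\mathbb{R}Q_\pm$ is the $2$-dimensional subspace of cubic forms equal to a linear form times $Q_\pm$. $\widetilde{\mathsf{CO}}(2)=\mathsf{O}(2)\times\mathbb{R}^\times$ and $\widetilde{\mathsf{CO}}(1,1)=\mathsf{O}(1,1)\times\mathbb{R}^\times$, where $\mathsf{O}(2)$, $\mathsf{O}(1,1)$ are the orthogonal groups of $Q_+$, $Q_-$ and $\mathbb{R}^\times$ acts by dilations of $\mathbb{R}^2$;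 they act naturally on cubic forms by substitution, and hence on $S^3_0\mathbb{R}^{2*}$. A third-order PDE or system of PDEs is understood as a subset of $J^3$. *)

theory Defs
  imports "HOL-Analysis.Analysis"
begin

type_synonym plane = "real \<times> real"
type_synonym space = "real \<times> real \<times> real"

section \<open>Smooth maps and surfaces\<close>

primrec iter_deriv ::
  "'a::real_normed_vector list \<Rightarrow> ('a \<Rightarrow> 'b::real_normed_vector) \<Rightarrow> 'a \<Rightarrow> 'b" where
  "iter_deriv [] f = f"
| "iter_deriv (v # vs) f = iter_deriv vs (\<lambda>x. frechet_derivative f (at x) v)"

definition smooth_on ::
  "'a::real_normed_vector set \<Rightarrow> ('a \<Rightarrow> 'b::real_normed_vector) \<Rightarrow> bool" where
  "smooth_on U f \<longleftrightarrow> (\<forall>vs. \<forall>x\<in>U. iter_deriv vs f differentiable (at x))"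

definition local_param :: "space set \<Rightarrow> space \<Rightarrow> (plane \<Rightarrow> space) \<Rightarrow> bool" where
  "local_param S p \<phi> \<longleftrightarrow> \<phi> 0 = p \<and>
     (\<exists>U V \<psi>. open U \<and> 0 \<in> U \<and> open V \<and> smooth_on U \<phi> \<and>
        (\<forall>t\<in>U. inj (frechet_derivative \<phi> (at t))) \<and> homeomorphism U (S \<inter> V) \<phi> \<psi>)"

definition surface :: "space set \<Rightarrow> bool" where
  "surface S \<longleftrightarrow> (\<forall>p\<in>S. \<exists>\<phi>. local_param S p \<phi>)"

definition graph_over :: "plane set \<Rightarrow> (plane \<Rightarrow> real) \<Rightarrow> space set" where
  "graph_over U f = {(x, y, f (x, y)) |x y. (x, y) \<in> U}"

section \<open>Jets of surfaces\<close>

definition contact :: "nat \<Rightarrow> space \<Rightarrow> space set \<Rightarrow> space set \<Rightarrow> bool" where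
  "contact l p S T \<longleftrightarrow> (\<exists>\<phi> \<psi>. local_param S p \<phi> \<and> local_param T p \<psi> \<and>
     (\<forall>vs. length vs \<le> l \<longrightarrow> iter_deriv vs \<phi> 0 = iter_deriv vs \<psi> 0))"

text \<open>The \<open>l\<close>-jet of \<open>S\<close> at \<open>p\<close> is the base point together with the class of all surfaces
  through \<open>p\<close> that have contact of order \<open>l\<close> with \<open>S\<close> at \<open>p\<close>.\<close>

type_synonym jet = "space \<times> space set set"

definition jet :: "nat \<Rightarrow> space \<Rightarrow> space set \<Rightarrow> jet" where
  "jet l p S = (p, {T. surface T \<and> p \<in> T \<and> contact l p S T})"

definition jets :: "nat \<Rightarrow> jet set" where
  "jets l = {jet l p S |p S. surface S \<and> p \<in> S}"

definition Aff3 :: "(space \<Rightarrow> space) set" where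
  "Aff3 = {g. \<exists>A b. linear A \<and> bij A \<and> g = (\<lambda>v. A v + b)}"

definition act :: "(space \<Rightarrow> space) \<Rightarrow> jet \<Rightarrow> jet" where
  "act g \<theta> = (g (fst \<theta>), (\<lambda>S. g ` S) ` snd \<theta>)"

definition aff_orbit :: "jet set \<Rightarrow> jet set" where
  "aff_orbit A = {act g \<theta> |g \<theta>. g \<in> Aff3 \<and> \<theta> \<in> A}"

definition aff_invariant :: "jet set \<Rightarrow> bool" where
  "aff_invariant A \<longleftrightarrow> (\<forall>g\<in>Aff3. \<forall>\<theta>\<in>A. act g \<theta> \<in> A)"

section \<open>Coordinates on 3-jets of graphs\<close>

definition graph_rep :: "jet \<Rightarrow> (plane \<Rightarrow> real) \<Rightarrow> plane \<Rightarrow> bool" where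
  "graph_rep \<theta> f z \<longleftrightarrow> (\<exists>U. open U \<and> z \<in> U \<and> smooth_on U f \<and>
     \<theta> = jet 3 (fst z, snd z, f z) (graph_over U f))"

definition is_graph_jet :: "jet \<Rightarrow> bool" where
  "is_graph_jet \<theta> \<longleftrightarrow> (\<exists>f z. graph_rep \<theta> f z)"

definition ex :: plane where "ex = (1, 0)"
definition ey :: plane where "ey = (0, 1)"

text \<open>For instance \<open>u_coord [ex, ex, ey]\<close> is the coordinate \<open>u_xxy\<close>. It is meaningful only on
  jets of graphs.\<close>

definition u_coord :: "plane list \<Rightarrow> jet \<Rightarrow> real" where
  "u_coord vs \<theta> = (THE c. \<exists>f z. graph_rep \<theta> f z \<and> c = iter_deriv vs f z)"

definition det_hess :: "jet \<Rightarrow> real" where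
  "det_hess \<theta> = u_coord [ex, ex] \<theta> * u_coord [ey, ey] \<theta> - (u_coord [ex, ey] \<theta>)\<^sup>2"

definition rot :: "space \<Rightarrow> space" where
  "rot = (\<lambda>(x, y, u). (y, u, x))"

text \<open>\<open>J3 1\<close> and \<open>J3 (-1)\<close> are the sets of jets with positive, resp. negative, Hessian
  determinant. A jet with a tangent plane parallel to the \<open>u\<close>-axis is not the jet of a graph
  \<open>u = f(x, y)\<close>, so the Hessian is taken in one of the three charts in which \<open>x\<close>, \<open>y\<close> or \<open>u\<close>
  is the dependent variable; they cover all jets, and the sign does not depend on the chart.\<close>

definition J3 :: "real \<Rightarrow> jet set" where
  "J3 s = {\<theta> \<in> jets 3. \<exists>k<3. is_graph_jet (act (rot ^^ k) \<theta>) \<and>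
     s * det_hess (act (rot ^^ k) \<theta>) > 0}"

section \<open>The quadrics and cubic forms\<close>

text \<open>Here \<open>s\<close> is the sign, \<open>1\<close> or \<open>-1\<close>.\<close>

definition Q :: "real \<Rightarrow> plane \<Rightarrow> real" where
  "Q s = (\<lambda>(x, y). (x\<^sup>2 + s * y\<^sup>2) / 2)"

definition quadric :: "real \<Rightarrow> space set" where
  "quadric s = graph_over UNIV (Q s)"

text \<open>Coordinates of cubic forms refer to the basis \<open>x^3, 3x^2y, 3xy^2, y^3\<close>.\<close>

definition cubic :: "real \<Rightarrow> real \<Rightarrow> real \<Rightarrow> real \<Rightarrow> plane \<Rightarrow> real" where
  "cubic a b c d = (\<lambda>(x, y). a * x^3 + b * (3 * x\<^sup>2 * y) + c * (3 * x * y\<^sup>2) + d * y^3)"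

definition cubic_forms :: "(plane \<Rightarrow> real) set" where
  "cubic_forms = {cubic a b c d |a b c d. True}"

definition linear_times_Q :: "real \<Rightarrow> (plane \<Rightarrow> real) set" where
  "linear_times_Q s = {\<lambda>v. m v * Q s v |m. linear m}"

definition cubic_mod :: "real \<Rightarrow> ((plane \<Rightarrow> real) \<times> (plane \<Rightarrow> real)) set" where
  "cubic_mod s = {(f, h). f \<in> cubic_forms \<and> h \<in> cubic_forms \<and>
     (\<lambda>v. f v - h v) \<in> linear_times_Q s}"

definition S30 :: "real \<Rightarrow> (plane \<Rightarrow> real) set set" where
  "S30 s = cubic_forms // cubic_mod s"

definition OQ :: "real \<Rightarrow> (plane \<Rightarrow> plane) set" where
  "OQ s = {R. linear R \<and> (\<forall>v. Q s (R v) = Q s v)}"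

definition CO :: "real \<Rightarrow> (plane \<Rightarrow> plane) set" where
  "CO s = {\<lambda>v. r *\<^sub>R R v |r R. r \<noteq> 0 \<and> R \<in> OQ s}"

definition CO_invariant :: "real \<Rightarrow> (plane \<Rightarrow> real) set set \<Rightarrow> bool" where
  "CO_invariant s B \<longleftrightarrow> (\<forall>A\<in>CO s. \<forall>c\<in>B. (\<lambda>f. f \<circ> inv A) ` c \<in> B)"

section \<open>The condition on 3-jets over the 2-jet of the quadric\<close>

definition jet_diff :: "jet \<Rightarrow> jet \<Rightarrow> plane \<Rightarrow> real" where
  "jet_diff \<theta> \<theta>' = cubic
     (u_coord [ex, ex, ex] \<theta> - u_coord [ex, ex, ex] \<theta>')
     (u_coord [ex, ex, ey] \<theta> - u_coord [ex, ex, ey] \<theta>')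
     (u_coord [ex, ey, ey] \<theta> - u_coord [ex, ey, ey] \<theta>')
     (u_coord [ey, ey, ey] \<theta> - u_coord [ey, ey, ey] \<theta>')"

definition fibre :: "real \<Rightarrow> jet set" where
  "fibre s = {jet 3 0 S |S. surface S \<and> 0 \<in> S \<and> jet 2 0 S = jet 2 0 (quadric s)}"

definition Sigma_set :: "real \<Rightarrow> (plane \<Rightarrow> real) set set \<Rightarrow> jet set" where
  "Sigma_set s B =
     {\<theta> \<in> fibre s. cubic_mod s `` {jet_diff \<theta> (jet 3 0 (quadric s))} \<in> B}"

definition PDE :: "real \<Rightarrow> (plane \<Rightarrow> real) set set \<Rightarrow> jet set" where
  "PDE s B = aff_orbit (Sigma_set s B)"

text \<open>The swap preserves the saddle \<open>quadric (-1)\<close>, but \<open>(x, y) \<mapsto> (y, x)\<close> negates \<open>Q (-1)\<close>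
  and therefore is not in \<open>CO (-1)\<close>: the stabiliser in \<open>Aff3\<close> of the 2-jet of the saddle
  induces on the plane a group that contains \<open>CO (-1)\<close> with index two.\<close>

definition swap :: "space \<Rightarrow> space" where
  "swap = (\<lambda>(x, y, u). (y, x, - u))"

section \<open>The action on jets is induced by the action on surfaces\<close>

lemma smooth_on_deriv:
  assumes "smooth_on U f"
  shows "smooth_on U (\<lambda>x. frechet_derivative f (at x) v)"
  unfolding smooth_on_def
proof (intro allI ballI)
  fix vs x assume "x \<in> U"
  with assms have "iter_deriv (v # vs) f differentiable (at x)"
    unfolding smooth_on_def by blast
  then show "iter_deriv vs (\<lambda>x. frechet_derivative f (at x) v) differentiable (at x)"
    by simp
qed

lemma affine_has_derivative:
  fixes f :: "'a::euclidean_space \<Rightarrow> 'b::euclidean_space" and A :: "'b \<Rightarrow> 'c::euclidean_space"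
  assumes "open U" "x \<in> U" "linear A" "f differentiable (at x)"
    and "\<And>x. x \<in> U \<Longrightarrow> h x = A (f x) + b"
  shows "(h has_derivative (\<lambda>v. A (frechet_derivative f (at x) v))) (at x)"
proof -
  have "(f has_derivative frechet_derivative f (at x)) (at x)"
    using assms(4) frechet_derivative_works by blast
  then have "((\<lambda>x. A (f x)) has_derivative (\<lambda>v. A (frechet_derivative f (at x) v))) (at x)"
    using assms(3) bounded_linear.has_derivative linear_conv_bounded_linear by blast
  then have "((\<lambda>x. A (f x) + b) has_derivative (\<lambda>v. A (frechet_derivative f (at x) v))) (at x)"
    using has_derivative_add_const by blast
  then show ?thesis
    by (rule has_derivative_transform_within_open[OF _ assms(1,2)]) (simp add: assms(5))
qed

lemma iter_deriv_affine:
  fixes f :: "'a::euclidean_space \<Rightarrow> 'b::euclidean_space" and A :: "'b \<Rightarrow> 'c::euclidean_space"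
  assumes "open U" "linear A"
  shows "smooth_on U f \<Longrightarrow> (\<And>x. x \<in> U \<Longrightarrow> h x = A (f x) + b) \<Longrightarrow> x \<in> U \<Longrightarrow>
         iter_deriv vs h x = A (iter_deriv vs f x) + (if vs = [] then b else 0)"
proof (induction vs arbitrary: f h b x)
  case Nil
  then show ?case by simp
next
  case (Cons v vs)
  have *: "frechet_derivative h (at y) v = A (frechet_derivative f (at y) v) + 0"
    if "y \<in> U" for y
  proof -
    have "iter_deriv [] f differentiable (at y)"
      using Cons.prems(1) that unfolding smooth_on_def by blast
    then have "(h has_derivative (\<lambda>v. A (frechet_derivative f (at y) v))) (at y)"
      using affine_has_derivative[OF assms(1) that assms(2), of f h b] Cons.prems(2) by simp
    then show ?thesis
      by (metis frechet_derivative_at add.right_neutral)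
  qed
  show ?case
    using Cons.IH[OF smooth_on_deriv[OF Cons.prems(1), of v] *] Cons.prems(3) by simp
qed

lemma smooth_on_affine:
  fixes f :: "'a::euclidean_space \<Rightarrow> 'b::euclidean_space" and A :: "'b \<Rightarrow> 'c::euclidean_space"
  assumes "open U" "linear A" "smooth_on U f"
  shows "smooth_on U (\<lambda>x. A (f x) + b)"
  unfolding smooth_on_def
proof (intro allI ballI)
  fix vs x assume x: "x \<in> U"
  have "iter_deriv vs f differentiable (at x)"
    using assms(3) x unfolding smooth_on_def by blast
  from affine_has_derivative[OF assms(1) x assms(2) this]
    iter_deriv_affine[OF assms(1,2,3), of "\<lambda>x. A (f x) + b" b _ vs]
  show "iter_deriv vs (\<lambda>x. A (f x) + b) differentiable (at x)"
    unfolding differentiable_def by blast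
qed

lemma Aff3_homeo:
  assumes "g \<in> Aff3"
  shows "bij g" "continuous_on X g" "inv g \<in> Aff3"
proof -
  from assms obtain A b where A: "linear A" "bij A" and g: "g = (\<lambda>v. A v + b)"
    unfolding Aff3_def by blast
  have "bij ((\<lambda>v. v + b) \<circ> A)"
    using A(2) bij_plus_right bij_comp by blast
  then show bg: "bij g" by (simp add: g comp_def)
  show "continuous_on X g"
    unfolding g using A(1) by (intro continuous_intros linear_continuous_on)
      (simp add: linear_conv_bounded_linear)
  have lin: "linear (inv A)"
    using A by (simp add: bij_betw_def linear_inverse_left inj_linear_imp_inv_linear)
  have "inv g v = inv A v + (- inv A b)" for v
  proof -
    have "g (inv A v + (- inv A b)) = A (inv A v) - A (inv A b) + b"
      unfolding g using A(1) by (simp add: linear_diff)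
    also have "\<dots> = v" using A(2) by (simp add: bij_is_surj surj_f_inv_f)
    finally show ?thesis using bg by (metis bij_inv_eq_iff)
  qed
  then have "inv g = (\<lambda>v. inv A v + (- inv A b))" by blast
  with lin show "inv g \<in> Aff3"
    unfolding Aff3_def using A(2) bij_imp_bij_inv by blast
qed

lemma local_param_act:
  assumes "g \<in> Aff3" "local_param S p \<phi>"
  shows "local_param (g ` S) (g p) (g \<circ> \<phi>)"
proof -
  from assms obtain A b where A: "linear A" "bij A" and g: "g = (\<lambda>v. A v + b)"
    unfolding Aff3_def by blast
  from assms(2) obtain U V \<psi> where h: "\<phi> 0 = p" "open U" "0 \<in> U" "open V" "smooth_on U \<phi>"
    and inj: "\<forall>t\<in>U. inj (frechet_derivative \<phi> (at t))" and hom: "homeomorphism U (S \<inter> V) \<phi> \<psi>"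
    unfolding local_param_def by blast
  have gc: "g \<circ> \<phi> = (\<lambda>x. A (\<phi> x) + b)" by (auto simp: g)
  have 1: "open (g ` V)"
  proof -
    have "g ` V = inv g -` V"
      using Aff3_homeo(1)[OF assms(1)] by (simp add: bij_vimage_eq_inv_image bij_imp_bij_inv inv_inv_eq)
    then show ?thesis
      using h(4) Aff3_homeo(2)[OF Aff3_homeo(3)[OF assms(1)], of UNIV]
      by (simp add: continuous_on_open_vimage)
  qed
  have 2: "smooth_on U (g \<circ> \<phi>)"
    unfolding gc using smooth_on_affine[OF h(2) A(1) h(5)] .
  have 3: "inj (frechet_derivative (g \<circ> \<phi>) (at t))" if t: "t \<in> U" for t
  proof -
    have "iter_deriv [] \<phi> differentiable (at t)" using h(5) t unfolding smooth_on_def by blast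
    then have "((g \<circ> \<phi>) has_derivative (\<lambda>v. A (frechet_derivative \<phi> (at t) v))) (at t)"
      using affine_has_derivative[OF h(2) t A(1), of \<phi> "g \<circ> \<phi>" b] by (simp add: gc)
    then have "frechet_derivative (g \<circ> \<phi>) (at t) = A \<circ> frechet_derivative \<phi> (at t)"
      by (auto simp: comp_def dest!: frechet_derivative_at)
    then show ?thesis
      using inj t A(2) by (simp add: inj_compose bij_is_inj)
  qed
  have 4: "homeomorphism U (g ` S \<inter> g ` V) (g \<circ> \<phi>) (\<psi> \<circ> inv g)"
  proof -
    have "homeomorphism (S \<inter> V) (g ` (S \<inter> V)) g (inv g)"
      using Aff3_homeo[OF assms(1)] Aff3_homeo(2)[OF Aff3_homeo(3)[OF assms(1)]]
      unfolding homeomorphism_def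
      by (auto simp: bij_is_inj bij_is_surj surj_f_inv_f image_comp comp_def)
    moreover have "g ` (S \<inter> V) = g ` S \<inter> g ` V"
      using Aff3_homeo(1)[OF assms(1)] by (simp add: bij_is_inj image_Int)
    ultimately show ?thesis using homeomorphism_compose[OF hom] by metis
  qed
  show ?thesis
    unfolding local_param_def using h(1,2,3) 1 2 3 4 by (metis comp_apply)
qed

lemma surface_act:
  assumes "g \<in> Aff3" "surface S"
  shows "surface (g ` S)"
  using assms local_param_act unfolding surface_def by (metis imageE)

lemma contact_act:
  assumes "g \<in> Aff3" "contact l p S T"
  shows "contact l (g p) (g ` S) (g ` T)"
proof -
  from assms obtain A b where A: "linear A" "bij A" and g: "g = (\<lambda>v. A v + b)"
    unfolding Aff3_def by blast
  from assms(2) obtain \<phi> \<psi> where h: "local_param S p \<phi>" "local_param T p \<psi>"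
    "\<And>vs. length vs \<le> l \<Longrightarrow> iter_deriv vs \<phi> 0 = iter_deriv vs \<psi> 0"
    unfolding contact_def by blast
  have *: "iter_deriv vs (g \<circ> \<eta>) 0 = A (iter_deriv vs \<eta> 0) + (if vs = [] then b else 0)"
    if "local_param X p \<eta>" for X \<eta> vs
  proof -
    from that obtain U where "open U" "0 \<in> U" "smooth_on U \<eta>"
      unfolding local_param_def by blast
    then show ?thesis
      using iter_deriv_affine[OF _ A(1), of U \<eta> "g \<circ> \<eta>" b 0 vs] by (simp add: g)
  qed
  show ?thesis
    unfolding contact_def
    using local_param_act[OF assms(1) h(1)] local_param_act[OF assms(1) h(2)]
      *[OF h(1)] *[OF h(2)] h(3) by metis
qed

lemma act_jet:
  assumes g: "g \<in> Aff3"
  shows "act g (jet l p S) = jet l (g p) (g ` S)"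
proof -
  have b: "bij g" and gi: "inv g \<in> Aff3" using Aff3_homeo[OF g] by auto
  have ii: "inv g ` g ` X = X" "g ` inv g ` X = X" "inv g (g x) = x" for X x
    using b by (auto simp: image_comp bij_is_inj bij_is_surj surj_f_inv_f)
  have "T \<in> (\<lambda>S. g ` S) ` {T. surface T \<and> p \<in> T \<and> contact l p S T}"
    if "surface T" "g p \<in> T" "contact l (g p) (g ` S) T" for T
  proof
    show "T = g ` inv g ` T" by (simp add: ii)
    show "inv g ` T \<in> {T. surface T \<and> p \<in> T \<and> contact l p S T}"
      using surface_act[OF gi that(1)] contact_act[OF gi that(3)] that(2)
        imageI[OF that(2), of "inv g"] by (simp add: ii)
  qed
  then show ?thesis
    unfolding act_def jet_def using surface_act[OF g] contact_act[OF g, of l p S]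
    by (auto simp del: split_paired_All)
qed

end

theory Submission
  imports Defs
begin

text \<open>A jet in the fibre over the 2-jet of the quadric is the jet of a graph \<open>u = Q + C/6 + o(3)\<close>, and
  \<open>C\<close> is its difference to the jet of the quadric. If an affine map \<open>g\<close> carries such a graph to a surface
  that has third-order contact with a graph \<open>u = h\<close>, then substituting the first graph into \<open>u - h\<close>
  gives a function that vanishes to third order, and comparing its homogeneous parts along rays
  relates the Taylor coefficients. In degree two, the Hessian form of \<open>h\<close> pulls back to a nonzero
  multiple of \<open>Q\<close>, which fixes the sign of its determinant in every chart. If the second jet
  lies in the same fibre, then \<open>g\<close> is linear, its planar part \<open>M\<close> satisfies \<open>Q \<circ> M = \<kappa> * Q\<close>, and in degree
  three \<open>\<kappa> * C = C' \<circ> M\<close> modulo multiples of \<open>Q\<close>. So for \<open>\<kappa> > 0\<close> the two cubics are related by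
  an element of \<open>CO\<close>; the case \<open>\<kappa> < 0\<close> occurs for the saddle only and is reduced to the first by the swap.

  Order of contact is expressed by vanishing to finite order rather than by derivatives, so that
  Lipschitz reparametrisations suffice. Smooth inverses are needed only to write a surface locally
  as a graph.\<close>

section \<open>Smooth maps\<close>

text \<open>The vertical direction explains the quotient. If w is the planar part of the image of
  \<open>e3\<close>, the graph of f is moved over the points M x + f(x) w; this second-order
  displacement of the argument contributes 6 Q(v) times the polar form of (M v, w) to the
  third-order comparison, and as w varies this is every linear form times Q. The factor \<kappa> in
  the remaining relation is absorbed by homogeneity. Division of M by the square root of \<kappa>
  gives an isometry of Q, whereas the cubics match after division by the cube root; the dilations in
  \<open>CO\<close> reconcile the two normalisations. A negative \<kappa> is impossible for the
  definite form because Q then takes no negative value. A further obstacle is that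
  \<open>contact\<close> only asks for one suitable pair of parametrisations, so that neither
  transitivity nor independence of the parametrisation is evident. Equality of jets is therefore
  exploited through membership of a surface in its own class, and arbitrary parametrisations are
  converted to graph coordinates.\<close>

definition Ck_on :: "nat \<Rightarrow> 'a::real_normed_vector set \<Rightarrow> ('a \<Rightarrow> 'b::real_normed_vector) \<Rightarrow> bool"
  where "Ck_on k U f \<longleftrightarrow>
    (\<forall>vs. length vs \<le> k \<longrightarrow> (\<forall>x\<in>U. iter_deriv vs f differentiable (at x)))"

text \<open>Products, inverses and composites are treated order by order: their first derivatives
  are built by the same operations from functions that are still of the lower order. The count is
  shifted, \<open>Ck_on 0\<close> meaning differentiable.\<close>

lemma smooth_on_iff_Ck: "smooth_on U f \<longleftrightarrow> (\<forall>k. Ck_on k U f)"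
  unfolding smooth_on_def Ck_on_def by blast

lemma Ck_on_0: "Ck_on 0 U f \<longleftrightarrow> (\<forall>x\<in>U. f differentiable (at x))"
  unfolding Ck_on_def by simp

lemma Ck_on_Suc:
  "Ck_on (Suc k) U f \<longleftrightarrow> (\<forall>x\<in>U. f differentiable (at x)) \<and>
     (\<forall>v. Ck_on k U (\<lambda>x. frechet_derivative f (at x) v))"
proof
  assume *: "Ck_on (Suc k) U f"
  have "iter_deriv [] f differentiable (at x)" if "x \<in> U" for x
    using * that unfolding Ck_on_def by (metis le0 list.size(3))
  moreover have "iter_deriv (v # vs) f differentiable (at x)" if "x \<in> U" "length vs \<le> k" for x v vs
    using * that unfolding Ck_on_def by (metis Suc_le_mono length_Cons)
  ultimately show "(\<forall>x\<in>U. f differentiable (at x)) \<and>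
     (\<forall>v. Ck_on k U (\<lambda>x. frechet_derivative f (at x) v))"
    unfolding Ck_on_def by simp
next
  assume *: "(\<forall>x\<in>U. f differentiable (at x)) \<and>
     (\<forall>v. Ck_on k U (\<lambda>x. frechet_derivative f (at x) v))"
  show "Ck_on (Suc k) U f"
    unfolding Ck_on_def
  proof (intro allI impI ballI)
    fix vs :: "'a list" and x assume "length vs \<le> Suc k" "x \<in> U"
    with * show "iter_deriv vs f differentiable (at x)"
      unfolding Ck_on_def by (cases vs) auto
  qed
qed

lemma Ck_on_differentiable: "Ck_on k U f \<Longrightarrow> x \<in> U \<Longrightarrow> f differentiable (at x)"
  by (cases k) (auto simp: Ck_on_0 Ck_on_Suc)

lemma Ck_on_deriv: "Ck_on (Suc k) U f \<Longrightarrow> Ck_on k U (\<lambda>x. frechet_derivative f (at x) v)"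
  by (simp add: Ck_on_Suc)

lemma Ck_on_antimono: "Ck_on k U f \<Longrightarrow> j \<le> k \<Longrightarrow> Ck_on j U f"
  unfolding Ck_on_def by auto

lemma smooth_on_subset: "smooth_on U f \<Longrightarrow> V \<subseteq> U \<Longrightarrow> smooth_on V f"
  unfolding smooth_on_def by blast

lemma smooth_on_differentiable: "smooth_on U f \<Longrightarrow> x \<in> U \<Longrightarrow> f differentiable (at x)"
  using Ck_on_differentiable smooth_on_iff_Ck by blast

lemma smooth_on_has_derivative:
  "smooth_on U f \<Longrightarrow> x \<in> U \<Longrightarrow> (f has_derivative frechet_derivative f (at x)) (at x)"
  using smooth_on_differentiable frechet_derivative_works by blast

lemma smooth_on_iter_deriv: "smooth_on U f \<Longrightarrow> smooth_on U (iter_deriv vs f)"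
  by (induction vs arbitrary: f) (auto intro: smooth_on_deriv)

lemma iter_deriv_append: "iter_deriv (vs @ ws) f = iter_deriv ws (iter_deriv vs f)"
  by (induction vs arbitrary: f) auto

lemma continuous_on_smooth: "smooth_on U f \<Longrightarrow> continuous_on U f"
  using smooth_on_differentiable differentiable_imp_continuous_within
  by (metis continuous_at_imp_continuous_on)

lemma frechet_derivative_cong_open:
  assumes "open U" "x \<in> U" "\<And>y. y \<in> U \<Longrightarrow> f y = g y"
  shows "frechet_derivative f (at x) = frechet_derivative g (at x)"
    and "f differentiable (at x) \<longleftrightarrow> g differentiable (at x)"
proof -
  \<comment> \<open>Both notions depend only on the set of all derivatives at the point, so the
    equivalence also covers points where there is none and the chosen value is arbitrary.\<close>
  have "(f has_derivative D) (at x) \<longleftrightarrow> (g has_derivative D) (at x)" for D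
    using assms has_derivative_transform_within_open[OF _ assms(1,2)] by (metis (no_types))
  then show "frechet_derivative f (at x) = frechet_derivative g (at x)"
    and "f differentiable (at x) \<longleftrightarrow> g differentiable (at x)"
    unfolding frechet_derivative_def differentiable_def by auto
qed

lemma iter_deriv_cong_open:
  assumes "open U" "\<And>y. y \<in> U \<Longrightarrow> f y = g y" "x \<in> U"
  shows "iter_deriv vs f x = iter_deriv vs g x"
  using assms(2,3)
proof (induction vs arbitrary: f g x)
  case (Cons v vs)
  show ?case
    unfolding iter_deriv.simps
    by (rule Cons.IH) (use Cons.prems frechet_derivative_cong_open(1)[OF assms(1)] in \<open>metis+\<close>)
qed simp

lemma Ck_on_cong_open:
  assumes "open U" "Ck_on k U f" "\<And>y. y \<in> U \<Longrightarrow> f y = g y"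
  shows "Ck_on k U g"
  unfolding Ck_on_def
proof (intro allI impI ballI)
  fix vs :: "'a list" and x assume "length vs \<le> k" "x \<in> U"
  then have "iter_deriv vs f differentiable (at x)"
    using assms(2) unfolding Ck_on_def by blast
  moreover have "iter_deriv vs f y = iter_deriv vs g y" if "y \<in> U" for y
    using assms(3) that by (intro iter_deriv_cong_open[OF assms(1)])
  ultimately show "iter_deriv vs g differentiable (at x)"
    using frechet_derivative_cong_open(2)[OF assms(1) \<open>x \<in> U\<close>] by blast
qed

text \<open>Lets inductions on the order work with an explicit derivative formula in place of the
  chosen \<open>frechet_derivative\<close>.\<close>

lemma Ck_on_SucI:
  assumes "open U" "\<And>x. x \<in> U \<Longrightarrow> (f has_derivative D x) (at x)"
    and "\<And>v. Ck_on k U (\<lambda>x. D x v)"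
  shows "Ck_on (Suc k) U f"
proof -
  have "frechet_derivative f (at x) = D x" if "x \<in> U" for x
    using assms(2)[OF that] by (simp add: frechet_derivative_at[symmetric])
  then show ?thesis
    unfolding Ck_on_Suc using assms(2) Ck_on_cong_open[OF assms(1) assms(3)]
    by (auto simp: differentiable_def)
qed

section \<open>Closure of finite-order smoothness under algebra and composition\<close>

lemma Ck_on_const: "Ck_on k U (\<lambda>x. c)"
proof (induction k arbitrary: c)
  case (Suc k)
  show ?case
    unfolding Ck_on_Suc using Suc by simp
qed (simp add: Ck_on_0)

lemma Ck_on_bounded_linear:
  assumes "bounded_linear f"
  shows "Ck_on k U f"
proof (cases k)
  case 0
  then show ?thesis using assms bounded_linear_imp_differentiable Ck_on_0 by blast
next
  case (Suc j)
  have "frechet_derivative f (at x) = f" for x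
    using bounded_linear_imp_has_derivative[OF assms, of "at x"] frechet_derivative_at by metis
  then show ?thesis
    unfolding Suc Ck_on_Suc using assms bounded_linear_imp_differentiable Ck_on_const by auto
qed

lemma Ck_on_add:
  assumes "open U" "Ck_on k U f" "Ck_on k U g"
  shows "Ck_on k U (\<lambda>x. f x + g x)"
  using assms(2,3)
proof (induction k arbitrary: f g)
  case 0
  then show ?case by (simp add: Ck_on_0)
next
  case (Suc k)
  show ?case
    by (rule Ck_on_SucI[OF assms(1)], rule has_derivative_add)
      (use Suc Ck_on_differentiable Ck_on_deriv frechet_derivative_works in blast)+
qed

lemma Ck_on_scaleR:
  fixes f :: "'a::real_normed_vector \<Rightarrow> real" and g :: "'a \<Rightarrow> 'b::real_normed_vector"
  assumes "open U" "Ck_on k U f" "Ck_on k U g"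
  shows "Ck_on k U (\<lambda>x. f x *\<^sub>R g x)"
  using assms(2,3)
proof (induction k arbitrary: f g)
  case 0
  then show ?case by (simp add: Ck_on_0)
next
  case (Suc k)
  \<comment> \<open>The product rule pairs the derivative of one factor with the other factor
    itself, which is therefore lowered to order \<open>k\<close>.\<close>
  have le: "Ck_on k U f" "Ck_on k U g"
    using Suc.prems by (auto elim: Ck_on_antimono)
  show ?case
    by (rule Ck_on_SucI[OF assms(1)], rule has_derivative_scaleR)
      (use Suc le Ck_on_differentiable frechet_derivative_works in blast,
       use Suc le Ck_on_differentiable frechet_derivative_works in blast,
       intro Ck_on_add assms(1) Suc.IH le Ck_on_deriv Suc.prems)
qed

lemma Ck_on_mult:
  fixes f g :: "'a::real_normed_vector \<Rightarrow> real"
  assumes "open U" "Ck_on k U f" "Ck_on k U g"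
  shows "Ck_on k U (\<lambda>x. f x * g x)"
  using Ck_on_scaleR[OF assms] by simp

lemma Ck_on_uminus:
  assumes "open U" "Ck_on k U f"
  shows "Ck_on k U (\<lambda>x. - f x)"
  using Ck_on_scaleR[OF assms(1) Ck_on_const assms(2), of "-1"] by simp

lemma Ck_on_diff:
  assumes "open U" "Ck_on k U f" "Ck_on k U g"
  shows "Ck_on k U (\<lambda>x. f x - g x)"
  using Ck_on_add[OF assms(1,2) Ck_on_uminus[OF assms(1,3)]] by simp

lemma Ck_on_inverse:
  fixes f :: "'a::real_normed_vector \<Rightarrow> real"
  assumes "open U" "Ck_on k U f" "\<And>x. x \<in> U \<Longrightarrow> f x \<noteq> 0"
  shows "Ck_on k U (\<lambda>x. inverse (f x))"
  using assms(2)
proof (induction k)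
  case 0
  then show ?case using assms(3) by (simp add: Ck_on_0)
next
  case (Suc k)
  have "Ck_on k U f"
    using Suc.prems by (auto elim: Ck_on_antimono)
  note IH = Suc.IH[OF this]
  show ?case
  proof (rule Ck_on_SucI[OF assms(1)])
    fix x assume "x \<in> U"
    then show "((\<lambda>x. inverse (f x)) has_derivative
        (\<lambda>h. - (inverse (f x) * frechet_derivative f (at x) h * inverse (f x)))) (at x)"
      using Suc.prems Ck_on_differentiable frechet_derivative_works assms(3)
      by (intro Deriv.has_derivative_inverse) blast+
  qed (intro Ck_on_uminus Ck_on_mult IH assms(1) Ck_on_deriv Suc.prems)
qed

lemma Ck_on_sum:
  assumes "open U" "finite I" "\<And>i. i \<in> I \<Longrightarrow> Ck_on k U (f i)"
  shows "Ck_on k U (\<lambda>x. \<Sum>i\<in>I. f i x)"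
  using assms(2,3) by (induction I) (auto intro: Ck_on_const Ck_on_add[OF assms(1)])

lemma Ck_on_linear_compose:
  fixes f :: "'a::euclidean_space \<Rightarrow> 'b::euclidean_space" and A :: "'b \<Rightarrow> 'c::euclidean_space"
  assumes "open U" "linear A" "Ck_on k U f"
  shows "Ck_on k U (\<lambda>x. A (f x))"
  using assms(3)
proof (induction k arbitrary: f)
  case 0
  then show ?case
    using affine_has_derivative[OF assms(1) _ assms(2), of _ f _ 0]
    unfolding Ck_on_0 differentiable_def by (metis (no_types, lifting) add.right_neutral)
next
  case (Suc k)
  show ?case
  proof (rule Ck_on_SucI[OF assms(1)])
    fix x assume "x \<in> U"
    then show "((\<lambda>x. A (f x)) has_derivative (\<lambda>v. A (frechet_derivative f (at x) v))) (at x)"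
      using affine_has_derivative[OF assms(1) _ assms(2) Ck_on_differentiable[OF Suc.prems],
          where h = "\<lambda>x. A (f x)" and b = 0] by simp
  qed (intro Suc.IH Ck_on_deriv Suc.prems)
qed

lemma frechet_derivative_Basis_sum:
  fixes f :: "'a::euclidean_space \<Rightarrow> 'b::real_normed_vector"
  assumes "f differentiable (at x)"
  shows "frechet_derivative f (at x) v = (\<Sum>b\<in>Basis. (v \<bullet> b) *\<^sub>R frechet_derivative f (at x) b)"
proof -
  have "linear (frechet_derivative f (at x))"
    using assms by (simp add: linear_frechet_derivative)
  then have "frechet_derivative f (at x) (\<Sum>b\<in>Basis. (v \<bullet> b) *\<^sub>R b) =
      (\<Sum>b\<in>Basis. (v \<bullet> b) *\<^sub>R frechet_derivative f (at x) b)"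
    by (simp add: linear_sum linear_scale)
  then show ?thesis by (simp add: euclidean_representation)
qed

text \<open>In the chain rule the direction in which \<open>f\<close> is differentiated varies with
  the point. Expanding it in the basis leaves derivatives of \<open>f\<close> in fixed directions,
  to which the induction hypothesis applies, with coefficients that are components of the derivative
  of \<open>g\<close>.\<close>

lemma Ck_on_compose:
  fixes f :: "'b::euclidean_space \<Rightarrow> 'c::real_normed_vector"
    and g :: "'a::euclidean_space \<Rightarrow> 'b"
  assumes "open U" "\<And>x. x \<in> U \<Longrightarrow> g x \<in> V" "Ck_on k U g" "Ck_on k V f"
  shows "Ck_on k U (\<lambda>x. f (g x))"
  using assms(3,4)
proof (induction k arbitrary: f)
  case 0
  have "(f \<circ> g) differentiable (at x)" if "x \<in> U" for x
    using 0 assms(2) that by (intro differentiable_chain_at) (auto simp: Ck_on_0)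
  then show ?case
    unfolding Ck_on_0 comp_def by blast
next
  case (Suc k)
  have g: "Ck_on k U g"
    using Suc.prems by (auto elim: Ck_on_antimono)
  show ?case
  proof (rule Ck_on_SucI[OF assms(1)])
    fix x assume x: "x \<in> U"
    have f: "f differentiable (at (g x))"
      using assms(2) x Suc.prems(2) Ck_on_differentiable by blast
    have g': "(g has_derivative frechet_derivative g (at x)) (at x)"
      using Ck_on_differentiable[OF Suc.prems(1) x] frechet_derivative_works by blast
    have f': "(f has_derivative frechet_derivative f (at (g x))) (at (g x))"
      using f frechet_derivative_works by blast
    show "((\<lambda>x. f (g x)) has_derivative
       (\<lambda>v. \<Sum>b\<in>Basis. (frechet_derivative g (at x) v \<bullet> b) *\<^sub>R frechet_derivative f (at (g x)) b)) (at x)"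
      using diff_chain_at[OF g' f'] unfolding comp_def frechet_derivative_Basis_sum[OF f, symmetric] .
  next
    fix v
    have "Ck_on k U (\<lambda>x. frechet_derivative g (at x) v \<bullet> b)" for b
      using Ck_on_linear_compose[OF assms(1) bounded_linear.linear[OF bounded_linear_inner_left]
          Ck_on_deriv[OF Suc.prems(1)]] .
    moreover have "Ck_on k U (\<lambda>x. frechet_derivative f (at (g x)) b)" for b
      using Suc.IH[OF g Ck_on_deriv[OF Suc.prems(2)]] .
    ultimately show "Ck_on k U (\<lambda>x. \<Sum>b\<in>Basis. (frechet_derivative g (at x) v \<bullet> b) *\<^sub>R
        frechet_derivative f (at (g x)) b)"
      by (intro Ck_on_sum Ck_on_scaleR assms(1) finite_Basis)
  qed
qed

lemma smooth_on_compose: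
  fixes f :: "'b::euclidean_space \<Rightarrow> 'c::real_normed_vector"
    and g :: "'a::euclidean_space \<Rightarrow> 'b"
  assumes "open U" "\<And>x. x \<in> U \<Longrightarrow> g x \<in> V" "smooth_on U g" "smooth_on V f"
  shows "smooth_on U (\<lambda>x. f (g x))"
  unfolding smooth_on_iff_Ck
proof
  show "Ck_on k U (\<lambda>x. f (g x))" for k
    using assms by (intro Ck_on_compose[of U g V k f]) (simp_all add: smooth_on_iff_Ck)
qed

lemma smooth_on_bounded_linear: "bounded_linear f \<Longrightarrow> smooth_on U f"
  by (simp add: smooth_on_iff_Ck Ck_on_bounded_linear)

lemma smooth_on_linear_compose:
  fixes f :: "'a::euclidean_space \<Rightarrow> 'b::euclidean_space" and A :: "'b \<Rightarrow> 'c::euclidean_space"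
  assumes "open U" "linear A" "smooth_on U f"
  shows "smooth_on U (\<lambda>x. A (f x))"
  unfolding smooth_on_iff_Ck
proof
  show "Ck_on k U (\<lambda>x. A (f x))" for k
    using assms(3) by (intro Ck_on_linear_compose[OF assms(1,2), of k f]) (simp add: smooth_on_iff_Ck)
qed

lemma smooth_on_add: "open U \<Longrightarrow> smooth_on U f \<Longrightarrow> smooth_on U g \<Longrightarrow> smooth_on U (\<lambda>x. f x + g x)"
  unfolding smooth_on_iff_Ck by (blast intro: Ck_on_add)

lemma smooth_on_diff: "open U \<Longrightarrow> smooth_on U f \<Longrightarrow> smooth_on U g \<Longrightarrow> smooth_on U (\<lambda>x. f x - g x)"
  unfolding smooth_on_iff_Ck by (blast intro: Ck_on_diff)

lemma iter_deriv_diff: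
  fixes f g :: "'a::real_normed_vector \<Rightarrow> 'b::real_normed_vector"
  assumes "open U" "smooth_on U f" "smooth_on U g" "x \<in> U"
  shows "iter_deriv vs (\<lambda>x. f x - g x) x = iter_deriv vs f x - iter_deriv vs g x"
  using assms(2-4)
proof (induction vs arbitrary: f g x)
  case (Cons v vs)
  have "frechet_derivative (\<lambda>x. f x - g x) (at y) v =
      frechet_derivative f (at y) v - frechet_derivative g (at y) v" if "y \<in> U" for y
    using fun_cong[OF frechet_derivative_at[OF has_derivative_diff[OF
        smooth_on_has_derivative[OF Cons.prems(1) that]
        smooth_on_has_derivative[OF Cons.prems(2) that]]], of v] by (rule sym)
  then have "iter_deriv vs (\<lambda>y. frechet_derivative (\<lambda>x. f x - g x) (at y) v) x =
     iter_deriv vs (\<lambda>y. frechet_derivative f (at y) v - frechet_derivative g (at y) v) x"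
    by (intro iter_deriv_cong_open[OF assms(1)] Cons.prems(3))
  then show ?case
    using Cons.IH[OF smooth_on_deriv[OF Cons.prems(1)] smooth_on_deriv[OF Cons.prems(2)]
        Cons.prems(3)] by simp
qed simp

lemma smooth_on_Pair:
  fixes f :: "'a::euclidean_space \<Rightarrow> 'b::euclidean_space" and g :: "'a \<Rightarrow> 'c::euclidean_space"
  assumes "open U" "smooth_on U f" "smooth_on U g"
  shows "smooth_on U (\<lambda>x. (f x, g x))"
proof -
  have "linear (\<lambda>y::'b. (y, 0::'c))" "linear (\<lambda>y::'c. (0::'b, y))"
    by (auto intro!: linearI)
  from smooth_on_add[OF assms(1) smooth_on_linear_compose[OF assms(1) this(1) assms(2)]
      smooth_on_linear_compose[OF assms(1) this(2) assms(3)]]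
  show ?thesis by simp
qed

section \<open>Translations of the argument\<close>

lemma shift_has_derivative_iff:
  fixes f :: "'a::real_normed_vector \<Rightarrow> 'b::real_normed_vector"
  shows "((\<lambda>x. f (z + x)) has_derivative D) (at x) \<longleftrightarrow> (f has_derivative D) (at (z + x))"
proof -
  have *: "((\<lambda>x. h (c + x)) has_derivative D) (at y)"
    if "(h has_derivative D) (at (c + y))" for h :: "'a \<Rightarrow> 'b" and c y
  proof -
    have "((\<lambda>x. c + x) has_derivative (\<lambda>x. x)) (at y)"
      by (auto intro!: derivative_eq_intros)
    from diff_chain_at[OF this that] show ?thesis by (simp add: comp_def)
  qed
  \<comment> \<open>The converse is the same implication for the translated function, shifted back
    by \<open>- z\<close>. An equivalence is wanted so that the chosen derivatives agree at every
    point.\<close>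
  show ?thesis
    using *[of f z x] *[of "\<lambda>x. f (z + x)" "- z" "z + x"] by auto
qed

lemma iter_deriv_shift: "iter_deriv vs (\<lambda>x. f (z + x)) x = iter_deriv vs f (z + x)"
proof (induction vs arbitrary: f x)
  case (Cons v vs)
  have "frechet_derivative (\<lambda>x. f (z + x)) (at x) = frechet_derivative f (at (z + x))" for x
    unfolding frechet_derivative_def shift_has_derivative_iff ..
  then show ?case using Cons[of "\<lambda>x. frechet_derivative f (at x) v"] by simp
qed simp

lemma iter_deriv_shift_fun: "iter_deriv vs (\<lambda>x. f (z + x)) = (\<lambda>x. iter_deriv vs f (z + x))"
  by (rule ext) (rule iter_deriv_shift)

lemma smooth_on_shift:
  assumes "smooth_on U f"
  shows "smooth_on {x. z + x \<in> U} (\<lambda>x. f (z + x))"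
  unfolding smooth_on_def
proof (intro allI ballI)
  fix vs x assume "x \<in> {x. z + x \<in> U}"
  then have "iter_deriv vs f differentiable (at (z + x))"
    using assms unfolding smooth_on_def by blast
  then have "(\<lambda>x. iter_deriv vs f (z + x)) differentiable (at x)"
    unfolding differentiable_def shift_has_derivative_iff .
  then show "iter_deriv vs (\<lambda>x. f (z + x)) differentiable (at x)"
    by (subst iter_deriv_shift_fun)
qed

lemma open_shift:
  fixes U :: "'a::real_normed_vector set"
  assumes "open U"
  shows "open {x. z + x \<in> U}"
proof -
  have "{x. z + x \<in> U} = (\<lambda>x. z + x) -` U" by auto
  then show ?thesis
    using assms by (auto intro!: open_vimage continuous_intros)
qed

section \<open>The smooth inverse function theorem in the plane\<close>

lemma Basis_plane: "Basis = {ex, ey}"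
  by (auto simp: Basis_prod_def ex_def ey_def)

lemma linear_plane:
  assumes "linear (A :: plane \<Rightarrow> 'a::real_vector)"
  shows "A v = fst v *\<^sub>R A ex + snd v *\<^sub>R A ey"
proof -
  have "v = fst v *\<^sub>R ex + snd v *\<^sub>R ey"
    by (simp add: ex_def ey_def prod_eq_iff)
  then show ?thesis
    using assms linear_add linear_scale by metis
qed

definition plane_det :: "(plane \<Rightarrow> plane) \<Rightarrow> real" where
  "plane_det A = fst (A ex) * snd (A ey) - snd (A ex) * fst (A ey)"

lemma plane_det_nonzero:
  assumes "linear A" "inj A"
  shows "plane_det A \<noteq> 0"
proof
  assume *: "plane_det A = 0"
  \<comment> \<open>Up to sign, \<open>u\<close> and \<open>w\<close> are the columns of the
    adjugate matrix: \<open>A\<close> sends them to the determinant times a basis vector, again up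
    to sign.\<close>
  define u where "u = (snd (A ey), - snd (A ex))"
  define w where "w = (fst (A ey), - fst (A ex))"
  have "A u = 0" "A w = 0"
    unfolding linear_plane[OF assms(1), of u] linear_plane[OF assms(1), of w]
    using * by (simp_all add: prod_eq_iff plane_det_def u_def w_def algebra_simps)
  then have "u = 0" "w = 0"
    using assms linear_injective_0 by blast+
  then have "A ex = 0"
    by (simp add: u_def w_def prod_eq_iff)
  then have "ex = 0"
    using assms linear_injective_0 by blast
  then show False by (simp add: ex_def prod_eq_iff)
qed

text \<open>Cramer's rule. It makes visible that the inverse depends smoothly on the entries of the
  matrix.\<close>

lemma inv_plane_linear:
  assumes "linear A" "bij A"
  shows "inv A w = inverse (plane_det A) *\<^sub>R
    ((fst w * snd (A ey) - snd w * fst (A ey)) *\<^sub>R ex +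
     (snd w * fst (A ex) - fst w * snd (A ex)) *\<^sub>R ey)" (is "_ = ?v")
proof -
  have J: "plane_det A \<noteq> 0"
    using assms plane_det_nonzero bij_is_inj by blast
  have "A ?v = inverse (plane_det A) *\<^sub>R
      ((fst w * snd (A ey) - snd w * fst (A ey)) *\<^sub>R A ex +
       (snd w * fst (A ex) - fst w * snd (A ex)) *\<^sub>R A ey)"
    using assms(1) by (simp add: linear_add linear_scale)
  also have "\<dots> = inverse (plane_det A) *\<^sub>R (plane_det A *\<^sub>R w)"
    by (simp add: prod_eq_iff plane_det_def algebra_simps)
  also have "\<dots> = w" using J by simp
  finally show ?thesis
    using assms(2) by (metis bij_inv_eq_iff)
qed

text \<open>Bootstrapping: by Cramer's rule the derivative of \<sigma> is a rational expression in
  the first partial derivatives of \<open>a\<close> at \<sigma>, so \<sigma> being of order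
  \<open>k\<close> makes its derivative of order \<open>k\<close> as well.\<close>

lemma smooth_on_inverse:
  fixes a \<sigma> :: "plane \<Rightarrow> plane"
  assumes "open W" "smooth_on U a" "\<And>y. y \<in> W \<Longrightarrow> \<sigma> y \<in> U"
    and bij: "\<And>y. y \<in> W \<Longrightarrow> bij (frechet_derivative a (at (\<sigma> y)))"
    and der: "\<And>y. y \<in> W \<Longrightarrow> (\<sigma> has_derivative inv (frechet_derivative a (at (\<sigma> y)))) (at y)"
  shows "smooth_on W \<sigma>"
proof -
  define D where "D x = frechet_derivative a (at x)" for x
  have lin: "linear (D (\<sigma> y))" if "y \<in> W" for y
    unfolding D_def using assms(2,3) that smooth_on_differentiable linear_frechet_derivative by blast
  have "Ck_on k W \<sigma>" for k
  proof (induction k)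
    case 0
    show ?case using der unfolding Ck_on_0 differentiable_def by blast
  next
    case (Suc k)
    have D: "Ck_on k U (\<lambda>x. D x v)" for v
      unfolding D_def using smooth_on_deriv[OF assms(2)] smooth_on_iff_Ck by blast
    have f: "Ck_on k W (\<lambda>y. fst (D (\<sigma> y) v))" for v
      using Ck_on_linear_compose[OF assms(1) _ Ck_on_compose[OF assms(1,3) Suc D]] linear_fst
      by blast
    have s: "Ck_on k W (\<lambda>y. snd (D (\<sigma> y) v))" for v
      using Ck_on_linear_compose[OF assms(1) _ Ck_on_compose[OF assms(1,3) Suc D]] linear_snd
      by blast
    have J: "Ck_on k W (\<lambda>y. plane_det (D (\<sigma> y)))"
      unfolding plane_det_def using f s by (intro Ck_on_diff Ck_on_mult assms(1))
    have J0: "plane_det (D (\<sigma> y)) \<noteq> 0" if "y \<in> W" for y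
      using plane_det_nonzero lin that bij bij_is_inj D_def by metis
    show ?case
    proof (rule Ck_on_SucI[OF assms(1)])
      show "(\<sigma> has_derivative (\<lambda>w. inverse (plane_det (D (\<sigma> y))) *\<^sub>R
         ((fst w * snd (D (\<sigma> y) ey) - snd w * fst (D (\<sigma> y) ey)) *\<^sub>R ex +
          (snd w * fst (D (\<sigma> y) ex) - fst w * snd (D (\<sigma> y) ex)) *\<^sub>R ey))) (at y)"
        if "y \<in> W" for y
      proof -
        have "inv (D (\<sigma> y)) = (\<lambda>w. inverse (plane_det (D (\<sigma> y))) *\<^sub>R
         ((fst w * snd (D (\<sigma> y) ey) - snd w * fst (D (\<sigma> y) ey)) *\<^sub>R ex +
          (snd w * fst (D (\<sigma> y) ex) - fst w * snd (D (\<sigma> y) ex)) *\<^sub>R ey))"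
          using inv_plane_linear[OF lin[OF that]] bij[OF that] unfolding D_def by (intro ext) blast
        then show ?thesis using der[OF that] unfolding D_def by metis
      qed
      show "Ck_on k W (\<lambda>y. inverse (plane_det (D (\<sigma> y))) *\<^sub>R
         ((fst w * snd (D (\<sigma> y) ey) - snd w * fst (D (\<sigma> y) ey)) *\<^sub>R ex +
          (snd w * fst (D (\<sigma> y) ex) - fst w * snd (D (\<sigma> y) ex)) *\<^sub>R ey))" for w
        using f s J J0
        by (intro Ck_on_scaleR Ck_on_add Ck_on_diff Ck_on_mult Ck_on_inverse Ck_on_const assms(1))
    qed
  qed
  then show ?thesis by (simp add: smooth_on_iff_Ck)
qed

lemma smooth_inverse_function:
  fixes a :: "plane \<Rightarrow> plane"
  assumes "open U" "x0 \<in> U" "smooth_on U a" "inj (frechet_derivative a (at x0))"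
  obtains U' W \<sigma> where "open U'" "U' \<subseteq> U" "x0 \<in> U'" "open W" "homeomorphism U' W a \<sigma>"
    "smooth_on W \<sigma>"
proof -
  define D where "D x = Blinfun (frechet_derivative a (at x))" for x
  have bl: "bounded_linear (frechet_derivative a (at x))" if "x \<in> U" for x
    using smooth_on_has_derivative[OF assms(3) that] has_derivative_bounded_linear by blast
  have D: "blinfun_apply (D x) = frechet_derivative a (at x)" if "x \<in> U" for x
    unfolding D_def using bl[OF that] by (simp add: bounded_linear_Blinfun_apply)
  \<comment> \<open>The inverse function theorem wants the derivative to be continuous in operator
    norm; in finite dimension this follows from continuity in each direction.\<close>
  have cont: "continuous_on U D"
  proof (rule continuous_on_blinfun_componentwise)
    fix i :: plane
    have "continuous_on U (\<lambda>x. frechet_derivative a (at x) i)"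
      using continuous_on_smooth[OF smooth_on_deriv[OF assms(3)]] .
    then show "continuous_on U (\<lambda>x. blinfun_apply (D x) i)"
      using D by (simp cong: continuous_on_cong)
  qed
  \<comment> \<open>Invertibility of the derivative at \<open>x0\<close> enters the theorem as a
    left inverse, which injectivity provides.\<close>
  have lin: "linear (frechet_derivative a (at x0))"
    using bl[OF assms(2)] bounded_linear.linear by blast
  obtain g where g: "linear g" "g \<circ> frechet_derivative a (at x0) = id"
    using linear_injective_left_inverse[OF lin assms(4)] by blast
  have "Blinfun g o\<^sub>L D x0 = id_blinfun"
  proof (rule blinfun_eqI)
    fix v
    have "g (frechet_derivative a (at x0) v) = v" using fun_cong[OF g(2), of v] by simp
    then show "blinfun_apply (Blinfun g o\<^sub>L D x0) v = blinfun_apply id_blinfun v"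
      using g(1) assms(2) by (simp add: D bounded_linear_Blinfun_apply linear_conv_bounded_linear)
  qed
  from inverse_function_theorem[OF assms(1) _ cont assms(2) this] smooth_on_has_derivative[OF assms(3)]
  obtain U' W \<sigma> D' where *: "open U'" "U' \<subseteq> U" "x0 \<in> U'" "open W" "homeomorphism U' W a \<sigma>"
    "\<And>y. y \<in> W \<Longrightarrow> (\<sigma> has_derivative D' y) (at y)"
    "\<And>y. y \<in> W \<Longrightarrow> D' y = inv (blinfun_apply (D (\<sigma> y)))"
    "\<And>y. y \<in> W \<Longrightarrow> bij (blinfun_apply (D (\<sigma> y)))"
    by (metis D)
  have \<sigma>: "\<sigma> y \<in> U" if "y \<in> W" for y
    using *(2,5) that unfolding homeomorphism_def by blast
  have "smooth_on W \<sigma>"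
    by (rule smooth_on_inverse[OF *(4) assms(3) \<sigma>]) (use * D \<sigma> in \<open>auto simp del: split_paired_All\<close>)
  then show ?thesis using that * by blast
qed

section \<open>Vanishing to finite order\<close>

text \<open>This is F(x) = o(|x|^l) at the origin. The filter \<open>nhds 0\<close> includes the
  origin itself, so that F(0) = 0 for every \<open>l\<close>, also for \<open>l = 0\<close> because
  0^0 = 1.\<close>

definition osmall :: "nat \<Rightarrow> ('a::real_normed_vector \<Rightarrow> 'b::real_normed_vector) \<Rightarrow> bool" where
  "osmall l F \<longleftrightarrow> (\<forall>e>0. \<forall>\<^sub>F x in nhds 0. norm (F x) \<le> e * norm x ^ l)"

lemma osmallD: "osmall l F \<Longrightarrow> e > 0 \<Longrightarrow> \<forall>\<^sub>F x in nhds 0. norm (F x) \<le> e * norm x ^ l"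
  unfolding osmall_def by blast

lemma osmall_mono:
  assumes "osmall l F" "\<forall>\<^sub>F x in nhds 0. norm (G x) \<le> K * norm (F x)"
  shows "osmall l G"
  unfolding osmall_def
proof (intro allI impI)
  fix e :: real assume e: "e > 0"
  \<comment> \<open>\<open>K\<close> may be nonpositive; the enlarged constant can be divided
    by.\<close>
  define K' where "K' = max K 1"
  have K': "K' > 0" "K \<le> K'" by (auto simp: K'_def)
  have "\<forall>\<^sub>F x in nhds 0. norm (F x) \<le> e / K' * norm x ^ l"
    using e K' by (intro osmallD[OF assms(1)]) auto
  with assms(2) show "\<forall>\<^sub>F x in nhds 0. norm (G x) \<le> e * norm x ^ l"
  proof eventually_elim
    case (elim x)
    have "norm (G x) \<le> K' * norm (F x)"
      using elim(1) K' by (meson mult_right_mono norm_ge_zero order_trans)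
    also have "\<dots> \<le> K' * (e / K' * norm x ^ l)"
      using elim(2) K' by (intro mult_left_mono) auto
    finally show ?case using K' by simp
  qed
qed

lemma eventually_norm_lt: "0 < d \<Longrightarrow> \<forall>\<^sub>F x::'a::real_normed_vector in nhds 0. norm x < d"
  unfolding eventually_nhds_metric by auto

lemma osmall_antimono:
  fixes F :: "'a::real_normed_vector \<Rightarrow> 'b::real_normed_vector"
  assumes "osmall l F" "j \<le> l"
  shows "osmall j F"
  unfolding osmall_def
proof (intro allI impI)
  fix e :: real assume e: "e > 0"
  have "\<forall>\<^sub>F x::'a in nhds 0. norm x < 1" by (rule eventually_norm_lt) simp
  with osmallD[OF assms(1) e] show "\<forall>\<^sub>F x in nhds 0. norm (F x) \<le> e * norm x ^ j"
  proof eventually_elim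
    case (elim x)
    have "norm x ^ l \<le> norm x ^ j"
      using elim(2) assms(2) by (intro power_decreasing) auto
    then have "e * norm x ^ l \<le> e * norm x ^ j" using e by simp
    then show ?case using elim(1) by linarith
  qed
qed

lemma filterlim_nhds_0_linear_bound:
  fixes g :: "'a::real_normed_vector \<Rightarrow> 'b::real_normed_vector"
  assumes "\<forall>\<^sub>F x in nhds 0. norm (g x) \<le> K * norm x"
  shows "filterlim g (nhds 0) (nhds 0)"
proof -
  have "((\<lambda>x::'a. K * norm x) \<longlongrightarrow> K * norm (0::'a)) (nhds 0)"
    by (intro tendsto_intros filterlim_ident)
  then show ?thesis
    using Lim_null_comparison[OF assms] by simp
qed

lemma osmall_compose:
  assumes "osmall l F" "\<forall>\<^sub>F x in nhds 0. norm (g x) \<le> K * norm x"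
  shows "osmall l (\<lambda>x. F (g x))"
  unfolding osmall_def
proof (intro allI impI)
  fix e :: real assume e: "e > 0"
  define K' where "K' = max K 1"
  have K': "K' > 0" "K \<le> K'" by (auto simp: K'_def)
  have "\<forall>\<^sub>F y in nhds 0. norm (F y) \<le> e / K' ^ l * norm y ^ l"
    using e K' by (intro osmallD[OF assms(1)]) auto
  then have "\<forall>\<^sub>F x in nhds 0. norm (F (g x)) \<le> e / K' ^ l * norm (g x) ^ l"
    using filterlim_nhds_0_linear_bound[OF assms(2)] by (rule eventually_compose_filterlim)
  with assms(2) show "\<forall>\<^sub>F x in nhds 0. norm (F (g x)) \<le> e * norm x ^ l"
  proof eventually_elim
    case (elim x)
    have "norm (g x) \<le> K' * norm x"
      using elim(1) K' by (meson mult_right_mono norm_ge_zero order_trans)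
    then have "norm (g x) ^ l \<le> (K' * norm x) ^ l"
      by (intro power_mono) auto
    then have "e / K' ^ l * norm (g x) ^ l \<le> e / K' ^ l * (K' * norm x) ^ l"
      using e K' by (intro mult_left_mono) auto
    also have "\<dots> = e * norm x ^ l" using K' by (simp add: power_mult_distrib)
    finally show ?case using elim(2) by linarith
  qed
qed

text \<open>Induction on the order: the partial derivatives are o(|x|^l), and the mean value
  inequality on the ball of radius |x| gains one factor |x|. The tolerance \<open>e / N\<close> for
  each partial pays for the sum over the \<open>N\<close> basis directions.\<close>

lemma osmall_derivs_vanish:
  fixes F :: "'a::euclidean_space \<Rightarrow> 'b::real_normed_vector"
  assumes "open U" "0 \<in> U" "smooth_on U F"
    and "\<And>vs. length vs \<le> l \<Longrightarrow> set vs \<subseteq> Basis \<Longrightarrow> iter_deriv vs F 0 = 0"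
  shows "osmall l F"
  using assms(3,4)
proof (induction l arbitrary: F)
  case 0
  have "F 0 = 0" using "0.prems"(2)[of "[]"] by simp
  moreover have "isCont F 0"
    using "0.prems"(1) assms(2) smooth_on_differentiable differentiable_imp_continuous_within by blast
  ultimately have "(F \<longlongrightarrow> 0) (nhds 0)"
    using tendsto_nhds_iff[of F 0] unfolding isCont_def by simp
  then show ?case
    unfolding osmall_def tendsto_iff
    by (intro allI impI) (auto simp: dist_norm elim!: allE elim: eventually_mono)
next
  case (Suc l)
  have IH: "osmall l (\<lambda>x. frechet_derivative F (at x) b)" if "b \<in> Basis" for b
  proof (rule Suc.IH[OF smooth_on_deriv[OF Suc.prems(1)]])
    fix vs :: "'a list" assume "length vs \<le> l" "set vs \<subseteq> Basis"
    then show "iter_deriv vs (\<lambda>x. frechet_derivative F (at x) b) 0 = 0"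
      using Suc.prems(2)[of "b # vs"] that by simp
  qed
  define N where "N = real DIM('a)"
  have N: "N > 0" by (simp add: N_def)
  show ?case
    unfolding osmall_def
  proof (intro allI impI)
    fix e :: real assume e: "e > 0"
    have "\<forall>\<^sub>F x in nhds 0. \<forall>b\<in>Basis. norm (frechet_derivative F (at x) b) \<le> e / N * norm x ^ l"
      using osmallD[OF IH divide_pos_pos[OF e N]]
      by (intro eventually_ball_finite finite_Basis ballI)
    moreover have "\<forall>\<^sub>F x in nhds 0. x \<in> U"
      using assms(1,2) by (rule eventually_nhds_in_open)
    ultimately have "\<forall>\<^sub>F x in nhds 0. x \<in> U \<and> (\<forall>b\<in>Basis. norm (frechet_derivative F (at x) b) \<le> e / N * norm x ^ l)"
      by eventually_elim simp
    then obtain d where d: "d > 0" "\<And>x. norm x < d \<Longrightarrow> x \<in> U"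
      "\<And>x b. norm x < d \<Longrightarrow> b \<in> Basis \<Longrightarrow> norm (frechet_derivative F (at x) b) \<le> e / N * norm x ^ l"
      unfolding eventually_nhds_metric by (auto simp: dist_norm)
    have "norm (F x) \<le> e * norm x ^ Suc l" if x: "norm x < d" for x
    proof -
      have "norm (F x - F 0) \<le> (e * norm x ^ l) * norm (x - 0)"
      proof (rule differentiable_bound[of "cball 0 (norm x)" F "\<lambda>y. frechet_derivative F (at y)"])
        fix y assume y: "y \<in> cball (0::'a) (norm x)"
        then have yd: "norm y < d" "norm y \<le> norm x" using x by auto
        have dy: "(F has_derivative frechet_derivative F (at y)) (at y)"
          using smooth_on_has_derivative[OF Suc.prems(1)] d(2) yd by blast
        then show "(F has_derivative frechet_derivative F (at y)) (at y within cball 0 (norm x))"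
          by (rule has_derivative_at_withinI)
        show "onorm (frechet_derivative F (at y)) \<le> e * norm x ^ l"
        proof (rule onorm_le)
          fix v
          have "norm (frechet_derivative F (at y) v) =
              norm (\<Sum>b\<in>Basis. (v \<bullet> b) *\<^sub>R frechet_derivative F (at y) b)"
            by (subst frechet_derivative_Basis_sum) (use dy differentiable_def in blast, simp)
          also have "\<dots> \<le> (\<Sum>b\<in>Basis. norm ((v \<bullet> b) *\<^sub>R frechet_derivative F (at y) b))"
            by (rule norm_sum)
          also have "\<dots> \<le> (\<Sum>b\<in>(Basis::'a set). norm v * (e / N * norm x ^ l))"
          proof (rule sum_mono)
            fix b :: 'a assume b: "b \<in> Basis"
            have "norm (frechet_derivative F (at y) b) \<le> e / N * norm y ^ l"
              using d(3)[OF yd(1) b] .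
            also have "\<dots> \<le> e / N * norm x ^ l"
              using yd e N by (intro mult_left_mono power_mono) auto
            finally show "norm ((v \<bullet> b) *\<^sub>R frechet_derivative F (at y) b) \<le> norm v * (e / N * norm x ^ l)"
              unfolding norm_scaleR using Basis_le_norm[OF b, of v]
              by (intro mult_mono) auto
          qed
          also have "\<dots> = e * norm x ^ l * norm v"
            using N by (simp add: N_def)
          finally show "norm (frechet_derivative F (at y) v) \<le> e * norm x ^ l * norm v" .
        qed
      qed auto
      then show ?thesis
        using Suc.prems(2)[of "[]"] by (simp add: mult_ac)
    qed
    then show "\<forall>\<^sub>F x in nhds 0. norm (F x) \<le> e * norm x ^ Suc l"
      unfolding eventually_nhds_metric using d(1) by (auto simp: dist_norm)
  qed
qed

text \<open>Iterated finite differences recover iterated derivatives. Unlike the latter they depend on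
  the values of the function only and are visibly symmetric in the increments.\<close>

primrec fdiff :: "'a::real_vector list \<Rightarrow> ('a \<Rightarrow> real) \<Rightarrow> 'a \<Rightarrow> real" where
  "fdiff [] F x = F x"
| "fdiff (v # vs) F x = fdiff vs (\<lambda>y. F (y + v) - F y) x"

lemma fdiff_commute: "fdiff [v, w] F = fdiff [w, v] F"
  by (auto simp: algebra_simps)

text \<open>Every increment doubles the number of values of \<open>F\<close> that enter, and all of
  them are taken within the stated radius.\<close>

lemma fdiff_bound:
  fixes F :: "'a::real_normed_vector \<Rightarrow> real"
  assumes "\<And>y. norm y \<le> norm x + (\<Sum>v\<leftarrow>vs. norm v) \<Longrightarrow> \<bar>F y\<bar> \<le> M"
  shows "\<bar>fdiff vs F x\<bar> \<le> 2 ^ length vs * M"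
  using assms
proof (induction vs arbitrary: F M)
  case (Cons v vs)
  have "\<bar>F (y + v) - F y\<bar> \<le> 2 * M" if "norm y \<le> norm x + (\<Sum>v\<leftarrow>vs. norm v)" for y
  proof -
    have "\<bar>F (y + v)\<bar> \<le> M"
      using that norm_triangle_ineq[of y v] by (intro Cons.prems) simp
    moreover have "\<bar>F y\<bar> \<le> M"
      using that norm_ge_zero[of v] by (intro Cons.prems) (simp del: norm_ge_zero)
    ultimately show ?thesis by linarith
  qed
  then have "\<bar>fdiff vs (\<lambda>y. F (y + v) - F y) x\<bar> \<le> 2 ^ length vs * (2 * M)"
    by (rule Cons.IH)
  then show ?case by simp
qed simp

text \<open>The induction hypothesis is applied to the first difference of \<open>F\<close> on a
  ball shrunk by the length of the increment, so that the shifted copy stays defined; the mean value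
  theorem then resolves this difference. The first increment is thus differentiated last, whence
  \<open>rev\<close>.\<close>

lemma fdiff_mean_value:
  fixes F :: "'a::euclidean_space \<Rightarrow> real"
  assumes "smooth_on (ball 0 R) F" "norm x + (\<Sum>v\<leftarrow>vs. norm v) < R"
  shows "\<exists>\<xi>. norm \<xi> \<le> norm x + (\<Sum>v\<leftarrow>vs. norm v) \<and> fdiff vs F x = iter_deriv (rev vs) F \<xi>"
  using assms
proof (induction vs arbitrary: F R)
  case (Cons v vs)
  define B where "B = ball (0::'a) (R - norm v)"
  have B: "y \<in> ball 0 R" "v + y \<in> ball 0 R" if "y \<in> B" for y
    using that norm_triangle_ineq[of y v] norm_ge_zero[of v]
    unfolding B_def by (auto simp: add.commute simp del: norm_ge_zero)
  have sF: "smooth_on B F"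
    using Cons.prems(1) B(1) smooth_on_subset by blast
  have sFv: "smooth_on B (\<lambda>y. F (v + y))"
    using smooth_on_subset[OF smooth_on_shift[OF Cons.prems(1), of v], of B] B(2) by blast
  have oB: "open B" by (simp add: B_def)
  have sm: "smooth_on (ball 0 (R - norm v)) (\<lambda>y. F (v + y) - F y)"
    using smooth_on_diff[OF oB sFv sF] B_def by simp
  have less: "norm x + (\<Sum>v\<leftarrow>vs. norm v) < R - norm v"
    using Cons.prems(2) by simp
  from Cons.IH[OF sm less]
  obtain \<xi> where \<xi>: "norm \<xi> \<le> norm x + (\<Sum>v\<leftarrow>vs. norm v)"
    "fdiff vs (\<lambda>y. F (v + y) - F y) x = iter_deriv (rev vs) (\<lambda>y. F (v + y) - F y) \<xi>"
    by blast
  define h where "h = iter_deriv (rev vs) F"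
  have "\<xi> \<in> B" using \<xi>(1) less by (simp add: B_def)
  then have eq: "fdiff (v # vs) F x = h (v + \<xi>) - h \<xi>"
    using \<xi>(2) iter_deriv_diff[OF oB sFv sF, of \<xi> "rev vs"] iter_deriv_shift[of "rev vs" F v \<xi>]
    by (simp add: h_def add.commute)
  have near: "norm (\<xi> + t *\<^sub>R v) \<le> norm x + norm v + (\<Sum>v\<leftarrow>vs. norm v)" if "0 \<le> t" "t \<le> 1" for t
  proof -
    have "norm (t *\<^sub>R v) \<le> 1 * norm v"
      using that by (simp add: mult_left_le_one_le)
    then show ?thesis using \<xi>(1) norm_triangle_ineq[of \<xi> "t *\<^sub>R v"] by linarith
  qed
  have der: "((\<lambda>t. h (\<xi> + t *\<^sub>R v)) has_derivative
      (\<lambda>s. frechet_derivative h (at (\<xi> + t *\<^sub>R v)) (s *\<^sub>R v))) (at t within {0..1})"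
    if "0 \<le> t" "t \<le> 1" for t
  proof -
    have "((\<lambda>t. \<xi> + t *\<^sub>R v) has_derivative (\<lambda>s. s *\<^sub>R v)) (at t within {0..1})"
      by (auto intro!: derivative_eq_intros)
    moreover have "(h has_derivative frechet_derivative h (at (\<xi> + t *\<^sub>R v))) (at (\<xi> + t *\<^sub>R v))"
      using near[OF that] Cons.prems
      by (intro smooth_on_has_derivative[of "ball 0 R"]) (auto simp: h_def intro: smooth_on_iter_deriv)
    ultimately show ?thesis
      using has_derivative_compose by blast
  qed
  obtain t where t: "0 < t" "t < 1"
    "h (\<xi> + 1 *\<^sub>R v) - h (\<xi> + 0 *\<^sub>R v) = frechet_derivative h (at (\<xi> + t *\<^sub>R v)) ((1 - 0) *\<^sub>R v)"
    using mvt_simple[of 0 1 "\<lambda>t. h (\<xi> + t *\<^sub>R v)", OF _ der] by auto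
  have "fdiff (v # vs) F x = iter_deriv (rev (v # vs)) F (\<xi> + t *\<^sub>R v)"
    using eq t(3) by (simp add: h_def iter_deriv_append add.commute)
  moreover have "norm (\<xi> + t *\<^sub>R v) \<le> norm x + (\<Sum>v\<leftarrow>v # vs. norm v)"
    using near[of t] t by simp
  ultimately show ?case by blast
qed auto

lemma iter_deriv_scale:
  fixes F :: "'a::euclidean_space \<Rightarrow> 'b::euclidean_space"
  assumes "open U" "smooth_on U F" "x \<in> U"
  shows "iter_deriv (map ((*\<^sub>R) r) vs) F x = r ^ length vs *\<^sub>R iter_deriv vs F x"
  using assms(2,3)
proof (induction vs arbitrary: F x)
  case (Cons v vs)
  define G where "G y = frechet_derivative F (at y) v" for y
  have G: "smooth_on U G" unfolding G_def using smooth_on_deriv[OF Cons.prems(1)] .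
  have "frechet_derivative F (at y) (r *\<^sub>R v) = r *\<^sub>R G y + 0" if "y \<in> U" for y
    using smooth_on_differentiable[OF Cons.prems(1) that] linear_frechet_derivative linear_scale
    unfolding G_def by fastforce
  from iter_deriv_affine[OF assms(1) linear_scaleR G this Cons.prems(2)]
  have *: "iter_deriv ws (\<lambda>y. frechet_derivative F (at y) (r *\<^sub>R v)) x = r *\<^sub>R iter_deriv ws G x" for ws
    by simp
  have G_eq: "(\<lambda>x. frechet_derivative F (at x) v) = G" by (simp add: G_def fun_eq_iff)
  show ?case
    using Cons.IH[OF G Cons.prems(2)] by (simp add: * G_eq)
qed simp

text \<open>The mean value point for increments scaled by \<open>r\<close> has norm at most
  \<open>r * N\<close>, so the difference quotient is a value of the iterated derivative at a point
  that tends to the origin.\<close>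

lemma fdiff_tendsto:
  fixes F :: "'a::euclidean_space \<Rightarrow> real"
  assumes "open U" "0 \<in> U" "smooth_on U F"
  shows "((\<lambda>r. fdiff (map ((*\<^sub>R) r) vs) F 0 / r ^ length vs) \<longlongrightarrow> iter_deriv (rev vs) F 0) (at_right 0)"
proof -
  obtain R where R: "R > 0" "ball 0 R \<subseteq> U"
    using assms(1,2) open_contains_ball by blast
  \<comment> \<open>The summand 1 keeps \<open>N\<close> positive for an empty list or zero
    increments, as division by \<open>N\<close> follows.\<close>
  define N where "N = (\<Sum>v\<leftarrow>vs. norm v) + 1"
  have "(\<Sum>v\<leftarrow>vs. norm v) \<ge> 0" by (rule sum_list_nonneg) auto
  then have N: "N > 0" "(\<Sum>v\<leftarrow>vs. norm v) \<le> N" by (auto simp: N_def)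
  have sF: "smooth_on (ball 0 R) F"
    using smooth_on_subset assms(3) R(2) by blast
  define h where "h = iter_deriv (rev vs) F"
  have ex: "\<exists>\<xi>. norm \<xi> \<le> r * N \<and> fdiff (map ((*\<^sub>R) r) vs) F 0 / r ^ length vs = h \<xi>"
    if r: "0 < r" "r < R / N" for r
  proof -
    have sum: "(\<Sum>v\<leftarrow>map ((*\<^sub>R) r) vs. norm v) = r * (\<Sum>v\<leftarrow>vs. norm v)"
      using r by (simp add: comp_def sum_list_const_mult)
    have le: "r * (\<Sum>v\<leftarrow>vs. norm v) \<le> r * N"
      using r N by (intro mult_left_mono) auto
    have "r * N < R" using r N by (simp add: field_simps)
    with le sum have "norm (0::'a) + (\<Sum>v\<leftarrow>map ((*\<^sub>R) r) vs. norm v) < R" by simp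
    from fdiff_mean_value[OF sF this] obtain \<xi> where
      \<xi>: "norm \<xi> \<le> r * (\<Sum>v\<leftarrow>vs. norm v)"
      "fdiff (map ((*\<^sub>R) r) vs) F 0 = iter_deriv (rev (map ((*\<^sub>R) r) vs)) F \<xi>"
      unfolding sum by auto
    have "norm \<xi> \<le> r * N" using \<xi>(1) le by linarith
    moreover from this have "\<xi> \<in> ball 0 R" using \<open>r * N < R\<close> by simp
    then have "fdiff (map ((*\<^sub>R) r) vs) F 0 = r ^ length vs * h \<xi>"
      using \<xi>(2) iter_deriv_scale[OF open_ball sF, of \<xi> r "rev vs"] by (simp add: h_def rev_map)
    ultimately show ?thesis using r by auto
  qed
  define \<xi> where "\<xi> r = (SOME \<xi>. norm \<xi> \<le> r * N \<and> fdiff (map ((*\<^sub>R) r) vs) F 0 / r ^ length vs = h \<xi>)" for r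
  have \<xi>: "norm (\<xi> r) \<le> r * N" "fdiff (map ((*\<^sub>R) r) vs) F 0 / r ^ length vs = h (\<xi> r)"
    if "0 < r" "r < R / N" for r
    using someI_ex[OF ex[OF that]] unfolding \<xi>_def by blast+
  have ev: "\<forall>\<^sub>F r in at_right (0::real). 0 < r \<and> r < R / N"
    using divide_pos_pos[OF R(1) N(1)] eventually_at_right_real[of 0 "R / N"] by simp
  have "((\<lambda>r. r * N) \<longlongrightarrow> 0 * N) (at_right 0)"
    by (intro tendsto_intros)
  then have lim: "((\<lambda>r. r * N) \<longlongrightarrow> 0) (at_right 0)" by simp
  have "\<forall>\<^sub>F r in at_right 0. norm (\<xi> r) \<le> r * N"
    using ev by eventually_elim (simp add: \<xi>(1))
  from Lim_null_comparison[OF this lim] have \<xi>0: "(\<xi> \<longlongrightarrow> 0) (at_right 0)" .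
  have "isCont h 0"
    using smooth_on_iter_deriv[OF assms(3)] assms(2) smooth_on_differentiable
      differentiable_imp_continuous_within unfolding h_def by blast
  from isCont_tendsto_compose[OF this \<xi>0]
  have "((\<lambda>r. h (\<xi> r)) \<longlongrightarrow> h 0) (at_right 0)" .
  moreover have "\<forall>\<^sub>F r in at_right 0. h (\<xi> r) = fdiff (map ((*\<^sub>R) r) vs) F 0 / r ^ length vs"
    using ev by eventually_elim (simp add: \<xi>(2))
  ultimately show ?thesis
    unfolding h_def by (rule Lim_transform_eventually)
qed

text \<open>Converse of \<open>osmall_derivs_vanish\<close>: a k-fold difference at scale
  \<open>r\<close> is a bounded number of values of \<open>F\<close> near the origin, hence o(r^k),
  while its quotient by r^k tends to the derivative.\<close>

lemma iter_deriv_eq_0_if_osmall: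
  fixes F :: "'a::euclidean_space \<Rightarrow> real"
  assumes "open U" "0 \<in> U" "smooth_on U F" "osmall l F" "length vs \<le> l"
  shows "iter_deriv vs F 0 = 0"
proof -
  define ws where "ws = rev vs"
  define k where "k = length ws"
  define N where "N = (\<Sum>v\<leftarrow>ws. norm v) + 1"
  have "(\<Sum>v\<leftarrow>ws. norm v) \<ge> 0" by (rule sum_list_nonneg) auto
  then have N: "N > 0" "(\<Sum>v\<leftarrow>ws. norm v) \<le> N" by (auto simp: N_def)
  have os: "osmall k F"
    using assms(4,5) osmall_antimono by (simp add: k_def ws_def)
  have "((\<lambda>r. fdiff (map ((*\<^sub>R) r) ws) F 0 / r ^ length ws) \<longlongrightarrow> 0) (at_right 0)"
    unfolding tendsto_iff
  proof (intro allI impI)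
    fix e :: real assume e: "e > 0"
    \<comment> \<open>2^k counts the values in the difference, N^k comes from the radius
      \<open>r * N\<close>, and the extra 2 makes the final inequality strict.\<close>
    define e' where "e' = e / (2 * 2 ^ k * N ^ k)"
    have e': "e' > 0" using e N by (simp add: e'_def)
    from osmallD[OF os e'] obtain d where d: "d > 0"
      "\<And>x. norm x < d \<Longrightarrow> \<bar>F x\<bar> \<le> e' * norm x ^ k"
      unfolding eventually_nhds_metric by (auto simp: dist_norm)
    have "\<forall>\<^sub>F r in at_right (0::real). 0 < r \<and> r < d / N"
      using divide_pos_pos[OF d(1) N(1)] eventually_at_right_real[of 0 "d / N"] by simp
    then show "\<forall>\<^sub>F r in at_right 0. dist (fdiff (map ((*\<^sub>R) r) ws) F 0 / r ^ length ws) 0 < e"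
    proof eventually_elim
      case (elim r)
      have sum: "(\<Sum>v\<leftarrow>map ((*\<^sub>R) r) ws. norm v) = r * (\<Sum>v\<leftarrow>ws. norm v)"
        using elim by (simp add: comp_def sum_list_const_mult)
      have le: "r * (\<Sum>v\<leftarrow>ws. norm v) \<le> r * N"
        using elim N by (intro mult_left_mono) auto
      have "r * N < d" using elim N by (simp add: field_simps)
      have "\<bar>F y\<bar> \<le> e' * (r * N) ^ k" if "norm y \<le> norm (0::'a) + (\<Sum>v\<leftarrow>map ((*\<^sub>R) r) ws. norm v)" for y
      proof -
        have y: "norm y \<le> r * N" using that le sum by simp
        then have "\<bar>F y\<bar> \<le> e' * norm y ^ k" using d(2) \<open>r * N < d\<close> by simp
        also have "\<dots> \<le> e' * (r * N) ^ k"
          using y e' by (intro mult_left_mono power_mono) auto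
        finally show ?thesis .
      qed
      from fdiff_bound[of 0 "map ((*\<^sub>R) r) ws" F, OF this]
      have "\<bar>fdiff (map ((*\<^sub>R) r) ws) F 0\<bar> \<le> 2 ^ k * (e' * (r * N) ^ k)"
        by (simp add: k_def)
      also have "\<dots> = e / 2 * r ^ k"
        using N by (simp add: e'_def power_mult_distrib)
      also have "\<dots> < e * r ^ k"
        using e elim by simp
      finally show ?case using elim by (simp add: k_def abs_divide power_abs pos_divide_less_eq)
    qed
  qed
  from tendsto_unique[OF _ this fdiff_tendsto[OF assms(1-3)]]
  show ?thesis by (simp add: ws_def)
qed

text \<open>Both mixed derivatives are limits of the same symmetric second difference
  quotient.\<close>

lemma iter_deriv_commute_0:
  fixes F :: "'a::euclidean_space \<Rightarrow> real"
  assumes "open U" "0 \<in> U" "smooth_on U F"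
  shows "iter_deriv [v, w] F 0 = iter_deriv [w, v] F 0"
  using tendsto_unique[OF _ fdiff_tendsto[OF assms, of "[v, w]"]]
    fdiff_tendsto[OF assms, of "[w, v]"] fdiff_commute[of _ _ F]
  by (simp del: fdiff.simps)

lemma iter_deriv_commute:
  fixes F :: "'a::euclidean_space \<Rightarrow> real"
  assumes "open U" "smooth_on U F" "x \<in> U"
  shows "iter_deriv (v # w # vs) F x = iter_deriv (w # v # vs) F x"
proof -
  have "iter_deriv [v, w] F y = iter_deriv [w, v] F y" if "y \<in> U" for y
  proof -
    have "0 \<in> {x. y + x \<in> U}" using that by simp
    from iter_deriv_commute_0[OF open_shift[OF assms(1)] this smooth_on_shift[OF assms(2)], of v w]
    show ?thesis unfolding iter_deriv_shift add_0_right .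
  qed
  from iter_deriv_cong_open[OF assms(1) this assms(3)]
  show ?thesis
    using iter_deriv_append[of "[v, w]" vs F] iter_deriv_append[of "[w, v]" vs F] by simp
qed

section \<open>Taylor polynomials of degree three\<close>

definition tpoly :: "real \<Rightarrow> real \<Rightarrow> real \<Rightarrow> real \<Rightarrow> real \<Rightarrow> real \<Rightarrow> real \<Rightarrow> real \<Rightarrow> real \<Rightarrow> real \<Rightarrow> plane \<Rightarrow> real"
  where "tpoly c c1 c2 c11 c12 c22 c111 c112 c122 c222 = (\<lambda>(x, y).
    c + (c1 * x + c2 * y) + (c11 * x\<^sup>2 + 2 * c12 * x * y + c22 * y\<^sup>2) / 2 +
    (c111 * x^3 + 3 * c112 * x\<^sup>2 * y + 3 * c122 * x * y\<^sup>2 + c222 * y^3) / 6)"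

text \<open>Differentiation stays inside the family and merely contracts the coefficients with the
  direction. Iterated derivatives can therefore be computed by rewriting, and smoothness follows by
  induction with arbitrary coefficients.\<close>

lemma tpoly_has_derivative:
  "(tpoly c c1 c2 c11 c12 c22 c111 c112 c122 c222 has_derivative
    (\<lambda>v. tpoly (fst v * c1 + snd v * c2) (fst v * c11 + snd v * c12) (fst v * c12 + snd v * c22)
      (fst v * c111 + snd v * c112) (fst v * c112 + snd v * c122) (fst v * c122 + snd v * c222)
      0 0 0 0 p)) (at p)"
  unfolding tpoly_def case_prod_unfold
  by (rule derivative_eq_intros refl | simp)+
    (auto simp: fun_eq_iff field_simps power2_eq_square power3_eq_cube)

lemma frechet_derivative_tpoly:
  "frechet_derivative (tpoly c c1 c2 c11 c12 c22 c111 c112 c122 c222) (at p) v =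
    tpoly (fst v * c1 + snd v * c2) (fst v * c11 + snd v * c12) (fst v * c12 + snd v * c22)
      (fst v * c111 + snd v * c112) (fst v * c112 + snd v * c122) (fst v * c122 + snd v * c222)
      0 0 0 0 p"
  by (rule fun_cong[OF frechet_derivative_at[OF tpoly_has_derivative, symmetric]])

lemma tpoly_differentiable:
  "tpoly c c1 c2 c11 c12 c22 c111 c112 c122 c222 differentiable (at p)"
  using tpoly_has_derivative unfolding differentiable_def by blast

lemma tpoly_0: "tpoly c c1 c2 c11 c12 c22 c111 c112 c122 c222 0 = c"
  by (simp add: tpoly_def zero_prod_def)

lemma smooth_on_tpoly: "smooth_on U (tpoly c c1 c2 c11 c12 c22 c111 c112 c122 c222)"
proof -
  have "Ck_on k UNIV (tpoly c c1 c2 c11 c12 c22 c111 c112 c122 c222)" for k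
    by (induction k arbitrary: c c1 c2 c11 c12 c22 c111 c112 c122 c222)
      (simp_all only: Ck_on_0 Ck_on_Suc frechet_derivative_tpoly tpoly_differentiable simp_thms ball_simps)
  then show ?thesis
    using smooth_on_iff_Ck smooth_on_subset by blast
qed

definition taylor3 :: "(plane \<Rightarrow> real) \<Rightarrow> plane \<Rightarrow> plane \<Rightarrow> real" where
  "taylor3 f z = tpoly (f z) (iter_deriv [ex] f z) (iter_deriv [ey] f z)
    (iter_deriv [ex, ex] f z) (iter_deriv [ex, ey] f z) (iter_deriv [ey, ey] f z)
    (iter_deriv [ex, ex, ex] f z) (iter_deriv [ex, ex, ey] f z)
    (iter_deriv [ex, ey, ey] f z) (iter_deriv [ey, ey, ey] f z)"

lemma list_le3_cases:
  assumes "length vs \<le> 3" "set vs \<subseteq> {a, b}"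
  shows "vs \<in> {[], [a], [b], [a, a], [a, b], [b, a], [b, b], [a, a, a], [a, a, b], [a, b, a],
    [b, a, a], [a, b, b], [b, a, b], [b, b, a], [b, b, b]}"
proof -
  consider "vs = []" | x where "vs = [x]" | x y where "vs = [x, y]" | x y z where "vs = [x, y, z]"
    using assms(1) by (cases vs; cases "tl vs"; cases "tl (tl vs)") auto
  then show ?thesis using assms(2) by cases auto
qed

lemma osmall_taylor3:
  assumes "open U" "z \<in> U" "smooth_on U f"
  shows "osmall 3 (\<lambda>x. f (z + x) - taylor3 f z x)"
proof (rule osmall_derivs_vanish)
  show o: "open {x. z + x \<in> U}" using open_shift[OF assms(1)] .
  show 0: "0 \<in> {x. z + x \<in> U}" using assms(2) by simp
  have s: "smooth_on {x. z + x \<in> U} (\<lambda>x. f (z + x))"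
    using smooth_on_shift[OF assms(3)] .
  have t: "smooth_on {x. z + x \<in> U} (taylor3 f z)"
    unfolding taylor3_def by (rule smooth_on_tpoly)
  show "smooth_on {x. z + x \<in> U} (\<lambda>x. f (z + x) - taylor3 f z x)"
    using smooth_on_diff[OF o s t] .
  fix vs :: "plane list" assume vs: "length vs \<le> 3" "set vs \<subseteq> Basis"
  \<comment> \<open>\<open>taylor3\<close> records each mixed derivative in one order only; these
    exchanges bring all other orders of \<open>ex\<close> and \<open>ey\<close> to that one.\<close>
  have c2: "iter_deriv (ey # ex # vs) f z = iter_deriv (ex # ey # vs) f z" for vs
    using iter_deriv_commute[OF assms(1,3,2)] .
  have c3: "iter_deriv [v, ey, ex] f z = iter_deriv [v, ex, ey] f z" for v
    using iter_deriv_commute[OF assms(1) smooth_on_deriv[OF assms(3)] assms(2), of ey ex "[]" v] by simp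
  have "iter_deriv vs f z = iter_deriv vs (taylor3 f z) 0"
    using list_le3_cases[OF vs[unfolded Basis_plane]] c2[of "[]"] c2[of "[ex]"] c2[of "[ey]"] c3[of ex] c3[of ey]
    unfolding taylor3_def insert_iff empty_iff
    by (elim disjE) (simp_all add: frechet_derivative_tpoly ex_def ey_def tpoly_0)
  then show "iter_deriv vs (\<lambda>x. f (z + x) - taylor3 f z x) 0 = 0"
    using iter_deriv_diff[OF o s t 0] by (simp add: iter_deriv_shift)
qed

section \<open>Surfaces as graphs\<close>

definition proj :: "space \<Rightarrow> plane" where
  "proj q = (fst q, fst (snd q))"

definition height :: "space \<Rightarrow> real" where
  "height q = snd (snd q)"

definition graph_map :: "(plane \<Rightarrow> real) \<Rightarrow> plane \<Rightarrow> space" where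
  "graph_map f z = (fst z, snd z, f z)"

lemma proj_graph_map [simp]: "proj (graph_map f z) = z"
  and height_graph_map [simp]: "height (graph_map f z) = f z"
  by (simp_all add: proj_def height_def graph_map_def)

lemma space_eq_iff: "p = q \<longleftrightarrow> proj p = proj q \<and> height p = height q"
  by (auto simp: proj_def height_def prod_eq_iff)

lemma linear_proj: "linear proj"
  by (auto intro!: linearI simp: proj_def)

lemma linear_height: "linear height"
  by (auto intro!: linearI simp: height_def)

lemma norm_proj_le: "norm (proj q) \<le> norm q"
proof -
  obtain x y u where "q = (x, y, u)" by (cases q) auto
  then show ?thesis by (simp add: proj_def norm_Pair)
qed

lemma norm_height_le: "\<bar>height q\<bar> \<le> norm q"
proof -
  obtain x y u where "q = (x, y, u)" by (cases q) auto
  then show ?thesis by (simp add: height_def norm_Pair real_le_rsqrt)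
qed

lemma graph_over_eq_image: "graph_over U f = graph_map f ` U"
  unfolding graph_over_def graph_map_def by force

lemma graph_over_iff: "q \<in> graph_over U f \<longleftrightarrow> proj q \<in> U \<and> height q = f (proj q)"
proof -
  obtain x y u where "q = (x, y, u)" by (cases q) auto
  then show ?thesis by (auto simp: graph_over_def proj_def height_def)
qed

lemma graph_over_eq_graph_map: "q \<in> graph_over U f \<Longrightarrow> q = graph_map f (proj q)"
  by (simp add: graph_over_iff space_eq_iff)

lemma smooth_on_graph_map:
  assumes "open U" "smooth_on U f"
  shows "smooth_on U (graph_map f)"
proof -
  have "smooth_on U (fst :: plane \<Rightarrow> real)" "smooth_on U (snd :: plane \<Rightarrow> real)"
    by (intro smooth_on_bounded_linear bounded_linear_fst bounded_linear_snd)+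
  then have "smooth_on U (\<lambda>z. (fst z, snd z, f z))"
    using assms by (intro smooth_on_Pair)
  then show ?thesis by (simp add: graph_map_def[abs_def])
qed

lemma local_param_graph:
  assumes "open U" "smooth_on U f" "z \<in> U"
  shows "local_param (graph_over U f) (graph_map f z) (\<lambda>t. graph_map f (z + t))"
proof -
  define U' where "U' = {t. z + t \<in> U}"
  have oU: "open U'" using open_shift[OF assms(1)] by (simp add: U'_def)
  have sm: "smooth_on U' (\<lambda>t. graph_map f (z + t))"
    unfolding U'_def using smooth_on_shift[OF smooth_on_graph_map[OF assms(1,2)]] .
  have inj: "inj (frechet_derivative (\<lambda>t. graph_map f (z + t)) (at t))" if "t \<in> U'" for t
  proof -
    let ?D = "frechet_derivative (\<lambda>t. graph_map f (z + t)) (at t)"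
    have "((\<lambda>t. z + t) has_derivative (\<lambda>v. proj (?D v))) (at t)"
      using affine_has_derivative[OF oU that linear_proj smooth_on_differentiable[OF sm that],
          where h = "\<lambda>t. z + t" and b = 0] by simp
    moreover have "((\<lambda>t. z + t) has_derivative (\<lambda>v. v)) (at t)"
      by (auto intro!: derivative_eq_intros)
    ultimately have "(\<lambda>v. proj (?D v)) = (\<lambda>v. v)"
      by (rule has_derivative_unique)
    from fun_cong[OF this] show ?thesis
      by (intro inj_on_inverseI[of _ proj])
  qed
  have "homeomorphism U' (graph_over U f \<inter> UNIV) (\<lambda>t. graph_map f (z + t)) (\<lambda>q. proj q - z)"
  proof (rule homeomorphismI)
    show "continuous_on U' (\<lambda>t. graph_map f (z + t))"
      using continuous_on_smooth[OF sm] .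
    show "continuous_on (graph_over U f \<inter> UNIV) (\<lambda>q. proj q - z)"
      unfolding proj_def by (intro continuous_intros)
  qed (auto simp: U'_def graph_over_eq_image)
  then show ?thesis
    unfolding local_param_def using oU sm inj assms(3)
    by (intro conjI exI[of _ U'] exI[of _ UNIV] exI[of _ "\<lambda>q. proj q - z"]) (simp_all add: U'_def)
qed

lemma surface_graph_over:
  assumes "open U" "smooth_on U f"
  shows "surface (graph_over U f)"
  unfolding surface_def
proof
  fix p assume p: "p \<in> graph_over U f"
  then have "proj p \<in> U" by (simp add: graph_over_iff)
  from local_param_graph[OF assms this] show "\<exists>\<phi>. local_param (graph_over U f) p \<phi>"
    unfolding graph_over_eq_graph_map[OF p, symmetric]
    by (rule exI[of "local_param (graph_over U f) p"])
qed

text \<open>The chart is restricted to the preimage of \<open>V\<close>, where \<open>S\<close> and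
  \<open>T\<close> are indistinguishable. Contact and jets thereby become local notions.\<close>

lemma local_param_local:
  assumes "local_param S p \<phi>" "open V" "p \<in> V" "S \<inter> V = T \<inter> V"
  shows "local_param T p \<phi>"
proof -
  obtain U V0 \<psi> where h: "\<phi> 0 = p" "open U" "0 \<in> U" "open V0" "smooth_on U \<phi>"
    "\<forall>t\<in>U. inj (frechet_derivative \<phi> (at t))" "homeomorphism U (S \<inter> V0) \<phi> \<psi>"
    using assms(1) unfolding local_param_def by blast
  define U1 where "U1 = U \<inter> \<phi> -` V"
  have o: "open U1"
    unfolding U1_def using continuous_open_preimage[OF continuous_on_smooth[OF h(5)] h(2) assms(2)] .
  have im: "\<phi> ` U = S \<inter> V0" using h(7) by (simp add: homeomorphism_def)
  have "\<phi> ` U1 = \<phi> ` U \<inter> V" by (auto simp: U1_def)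
  also have "\<dots> = (S \<inter> V) \<inter> V0" by (auto simp: im)
  also have "\<dots> = T \<inter> (V0 \<inter> V)" by (auto simp: assms(4))
  finally have eq: "\<phi> ` U1 = T \<inter> (V0 \<inter> V)" .
  have sub: "U1 \<subseteq> U" "\<phi> ` U1 \<subseteq> S \<inter> V0" by (auto simp: U1_def im[symmetric])
  have "homeomorphism U1 (T \<inter> (V0 \<inter> V)) \<phi> \<psi>"
    using homeomorphism_of_subsets[OF h(7) sub(1) _ eq] sub(2) eq by simp
  moreover have "smooth_on U1 \<phi>" using smooth_on_subset[OF h(5)] by (simp add: U1_def)
  moreover have "open (V0 \<inter> V)" "0 \<in> U1" "\<forall>t\<in>U1. inj (frechet_derivative \<phi> (at t))"
    using h assms(2,3) by (auto simp: U1_def)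
  ultimately show ?thesis
    unfolding local_param_def using h(1) o
    by (intro conjI exI[of _ U1] exI[of _ "V0 \<inter> V"] exI[of _ \<psi>])
qed

lemma local_param_mem: "local_param S p \<phi> \<Longrightarrow> p \<in> S"
  unfolding local_param_def homeomorphism_def by blast

lemma contact_local:
  assumes "contact l p S T" "open V" "p \<in> V" "S \<inter> V = S' \<inter> V"
  shows "contact l p S' T"
proof -
  obtain \<phi> \<psi> where "local_param S p \<phi>" "local_param T p \<psi>"
    "\<forall>vs. length vs \<le> l \<longrightarrow> iter_deriv vs \<phi> 0 = iter_deriv vs \<psi> 0"
    using assms(1) unfolding contact_def by blast
  then show ?thesis
    unfolding contact_def using local_param_local[OF _ assms(2-4), of \<phi>] by blast
qed

lemma jet_local:
  assumes "open V" "p \<in> V" "S \<inter> V = S' \<inter> V"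
  shows "jet l p S = jet l p S'"
  unfolding jet_def using contact_local[OF _ assms] contact_local[OF _ assms(1,2) assms(3)[symmetric]]
  by blast

lemma contact_refl: "surface S \<Longrightarrow> p \<in> S \<Longrightarrow> contact l p S S"
  unfolding contact_def surface_def by blast

text \<open>\<open>T\<close> lies in its own class by reflexivity, and equality of the classes
  places it in that of \<open>S\<close>.\<close>

lemma contact_if_jet_eq:
  assumes "jet l p S = jet l p T" "surface T" "p \<in> T"
  shows "contact l p S T"
proof -
  have "T \<in> snd (jet l p T)"
    using assms(2,3) contact_refl unfolding jet_def by simp
  then show ?thesis
    unfolding assms(1)[symmetric] by (simp add: jet_def)
qed

text \<open>If the tangent plane projects injectively, the planar part of the chart has a smooth
  local inverse \<sigma>, and the height of the chart at \<sigma> is the graph function.\<close>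

lemma local_graph:
  assumes "local_param S p \<phi>" "inj (\<lambda>v. proj (frechet_derivative \<phi> (at 0) v))"
  obtains W V f where "open W" "proj p \<in> W" "smooth_on W f" "open V" "p \<in> V"
    "S \<inter> V = graph_over W f" "p = graph_map f (proj p)"
proof -
  obtain U V0 \<psi> where h: "\<phi> 0 = p" "open U" "0 \<in> U" "open V0" "smooth_on U \<phi>"
    "homeomorphism U (S \<inter> V0) \<phi> \<psi>"
    using assms(1) unfolding local_param_def by blast
  define a where "a t = proj (\<phi> t)" for t
  have sa: "smooth_on U a"
    unfolding a_def using smooth_on_linear_compose[OF h(2) linear_proj h(5)] .
  have "(a has_derivative (\<lambda>v. proj (frechet_derivative \<phi> (at 0) v))) (at 0)"
    using affine_has_derivative[OF h(2,3) linear_proj smooth_on_differentiable[OF h(5,3)], of a 0]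
    by (simp add: a_def)
  then have "inj (frechet_derivative a (at 0))"
    using assms(2) frechet_derivative_at by metis
  from smooth_inverse_function[OF h(2,3) sa this]
  obtain U' W \<sigma> where i: "open U'" "U' \<subseteq> U" "0 \<in> U'" "open W" "homeomorphism U' W a \<sigma>" "smooth_on W \<sigma>" .
  define f where "f w = height (\<phi> (\<sigma> w))" for w
  have \<sigma>: "\<sigma> w \<in> U'" "a (\<sigma> w) = w" if "w \<in> W" for w
    using i(5) that unfolding homeomorphism_def by auto
  have a: "a t \<in> W" "\<sigma> (a t) = t" if "t \<in> U'" for t
    using i(5) that unfolding homeomorphism_def by auto
  have sf: "smooth_on W f"
    unfolding f_def
    using smooth_on_linear_compose[OF i(4) linear_height smooth_on_compose[OF i(4) _ i(6) h(5)]] \<sigma> i(2)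
    by blast
  have \<phi>_eq: "\<phi> t = graph_map f (a t)" if "t \<in> U'" for t
    using a(2)[OF that] by (simp add: space_eq_iff a_def f_def)
  have im: "\<phi> ` U' = graph_over W f"
  proof -
    have "a ` U' = W" using i(5) by (simp add: homeomorphism_def)
    then show ?thesis using \<phi>_eq by (auto simp: graph_over_eq_image image_iff)
  qed
  \<comment> \<open>The patch is relatively open in \<open>S\<close> because the chart is a
    homeomorphism. Cutting it out by an open set \<open>V1\<close> excludes other points of
    \<open>S\<close> that lie over \<open>W\<close>.\<close>
  have "openin (top_of_set (S \<inter> V0)) (\<phi> ` U')"
    using homeomorphism_imp_open_map[OF h(6)] i(1,2) by (simp add: open_subset)
  then obtain V1 where V1: "open V1" "\<phi> ` U' = S \<inter> V0 \<inter> V1"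
    unfolding openin_open by blast
  have p: "p \<in> \<phi> ` U'" using h(1) i(3) by blast
  show ?thesis
  proof
    show "open W" "smooth_on W f" by fact+
    show "open (V0 \<inter> V1)" using h(4) V1(1) by blast
    show "S \<inter> (V0 \<inter> V1) = graph_over W f" using V1 im by blast
    show "p \<in> V0 \<inter> V1" using p V1(2) by blast
    show "proj p \<in> W" using a(1)[OF i(3)] by (simp add: a_def h(1))
    show "p = graph_map f (proj p)" using \<phi>_eq[OF i(3)] by (simp add: a_def h(1))
  qed
qed

section \<open>Lipschitz estimates and reparametrisation by graph coordinates\<close>

lemma smooth_lipschitz:
  fixes f :: "'a::euclidean_space \<Rightarrow> 'b::real_normed_vector"
  assumes "open U" "smooth_on U f" "z \<in> U"
  obtains d K where "d > 0" "K > 0" "\<forall>x\<in>ball z d. \<forall>y\<in>ball z d. norm (f x - f y) \<le> K * norm (x - y)"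
proof -
  obtain d where d: "d > 0" "cball z d \<subseteq> U"
    using assms(1,3) open_contains_cball by blast
  have "\<exists>M. \<forall>x\<in>cball z d. norm (frechet_derivative f (at x) b) \<le> M" for b
  proof -
    have "continuous_on (cball z d) (\<lambda>x. frechet_derivative f (at x) b)"
      using continuous_on_subset[OF continuous_on_smooth[OF smooth_on_deriv[OF assms(2)]] d(2)] .
    then have "bounded ((\<lambda>x. frechet_derivative f (at x) b) ` cball z d)"
      using compact_continuous_image compact_cball compact_imp_bounded by blast
    then show ?thesis by (auto simp: bounded_iff)
  qed
  then obtain M where M: "\<And>b x. x \<in> cball z d \<Longrightarrow> norm (frechet_derivative f (at x) b) \<le> M b"
    by metis
  define K where "K = max 1 (\<Sum>b\<in>Basis. M b)"
  have "norm (f x - f y) \<le> K * norm (x - y)" if xy: "x \<in> ball z d" "y \<in> ball z d" for x y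
  proof (rule differentiable_bound[of "ball z d" f "\<lambda>x. frechet_derivative f (at x)"])
    fix w assume w: "w \<in> ball z d"
    then have wU: "w \<in> U" "w \<in> cball z d" using d by auto
    show "(f has_derivative frechet_derivative f (at w)) (at w within ball z d)"
      using smooth_on_has_derivative[OF assms(2) wU(1)] by (rule has_derivative_at_withinI)
    show "onorm (frechet_derivative f (at w)) \<le> K"
    proof (rule onorm_le)
      fix v
      have "norm (frechet_derivative f (at w) v) =
          norm (\<Sum>b\<in>Basis. (v \<bullet> b) *\<^sub>R frechet_derivative f (at w) b)"
        by (subst frechet_derivative_Basis_sum[OF smooth_on_differentiable[OF assms(2) wU(1)]]) simp
      also have "\<dots> \<le> (\<Sum>b\<in>Basis. norm ((v \<bullet> b) *\<^sub>R frechet_derivative f (at w) b))"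
        by (rule norm_sum)
      also have "\<dots> \<le> (\<Sum>b\<in>Basis. norm v * M b)"
        unfolding norm_scaleR using M[OF wU(2)] Basis_le_norm
        by (intro sum_mono mult_mono) auto
      also have "\<dots> = (\<Sum>b\<in>Basis. M b) * norm v"
        by (simp add: sum_distrib_left mult.commute)
      also have "\<dots> \<le> K * norm v"
        by (intro mult_right_mono) (auto simp: K_def)
      finally show "norm (frechet_derivative f (at w) v) \<le> K * norm v" .
    qed
  qed (use xy in auto)
  then show ?thesis using that[of d K] d(1) by (simp add: K_def del: mem_ball)
qed

text \<open>Used to trade an arbitrary parametrisation, about which contact speaks, for the graph
  coordinate \<open>x\<close>, in which Taylor coefficients are read off.\<close>

lemma graph_param_inverse:
  assumes "open U" "smooth_on U f" "local_param (graph_over U f) (graph_map f z) \<phi>"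
  obtains \<tau> K where "\<forall>\<^sub>F x in nhds 0. \<phi> (\<tau> x) = graph_map f (z + x)"
    "\<forall>\<^sub>F x in nhds 0. norm (\<tau> x) \<le> K * norm x"
proof -
  obtain U0 V0 \<psi> where h: "\<phi> 0 = graph_map f z" "open U0" "0 \<in> U0" "open V0" "smooth_on U0 \<phi>"
    "homeomorphism U0 (graph_over U f \<inter> V0) \<phi> \<psi>" "inj (frechet_derivative \<phi> (at 0))"
    using assms(3) unfolding local_param_def by blast
  define a where "a t = proj (\<phi> t)" for t
  have z: "z \<in> U" using local_param_mem[OF assms(3)] by (simp add: graph_over_iff)
  have a0: "a 0 = z" by (simp add: a_def h(1))
  have sa: "smooth_on U0 a"
    unfolding a_def using smooth_on_linear_compose[OF h(2) linear_proj h(5)] .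
  have \<phi>_eq: "\<phi> t = graph_map f (a t)" if "t \<in> U0" for t
  proof -
    have "\<phi> t \<in> graph_over U f" using h(6) that unfolding homeomorphism_def by blast
    then show ?thesis unfolding a_def by (rule graph_over_eq_graph_map)
  qed
  have da: "(a has_derivative frechet_derivative a (at 0)) (at 0)"
    using smooth_on_has_derivative[OF sa h(3)] .
  have dg: "(graph_map f has_derivative frechet_derivative (graph_map f) (at z)) (at (a 0))"
    unfolding a0 using smooth_on_has_derivative[OF smooth_on_graph_map[OF assms(1,2)] z] .
  from diff_chain_at[OF da dg]
  have "(\<phi> has_derivative frechet_derivative (graph_map f) (at z) \<circ> frechet_derivative a (at 0)) (at 0)"
    by (rule has_derivative_transform_within_open[OF _ h(2,3)]) (simp add: \<phi>_eq)
  \<comment> \<open>The chart factors through its planar part \<open>a\<close>, so injectivity of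
    its derivative passes to the inner factor, the derivative of \<open>a\<close>.\<close>
  then have "inj (frechet_derivative (graph_map f) (at z) \<circ> frechet_derivative a (at 0))"
    using h(7) frechet_derivative_at by metis
  then have "inj (frechet_derivative a (at 0))" by (rule inj_on_imageI2)
  from smooth_inverse_function[OF h(2,3) sa this]
  obtain U' W \<sigma> where i: "open U'" "U' \<subseteq> U0" "0 \<in> U'" "open W" "homeomorphism U' W a \<sigma>" "smooth_on W \<sigma>" .
  have zW: "z \<in> W" and \<sigma>z: "\<sigma> z = 0"
    using i(3,5) a0 unfolding homeomorphism_def by blast+
  obtain d K where d: "d > 0" "K > 0"
    "\<forall>x\<in>ball z d. \<forall>y\<in>ball z d. norm (\<sigma> x - \<sigma> y) \<le> K * norm (x - y)"
    using smooth_lipschitz[OF i(4,6) zW] .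
  show ?thesis
  proof
    have "\<forall>\<^sub>F x in nhds 0. x \<in> {x. z + x \<in> W}"
      using open_shift[OF i(4), of z] zW by (intro eventually_nhds_in_open) auto
    then show "\<forall>\<^sub>F x in nhds 0. \<phi> (\<sigma> (z + x)) = graph_map f (z + x)"
    proof eventually_elim
      case (elim x)
      then have "\<sigma> (z + x) \<in> U0" "a (\<sigma> (z + x)) = z + x"
        using i(2,5) unfolding homeomorphism_def by auto
      then show ?case using \<phi>_eq by simp
    qed
    show "\<forall>\<^sub>F x in nhds 0. norm (\<sigma> (z + x)) \<le> K * norm x"
      using eventually_norm_lt[OF d(1)]
    proof eventually_elim
      case (elim x)
      then show ?case using bspec[OF bspec[OF d(3), of "z + x"], of z] d(1) \<sigma>z by (simp add: dist_norm)
    qed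
  qed
qed

lemma osmall_contact:
  fixes \<phi> \<psi> :: "plane \<Rightarrow> space"
  assumes "local_param S p \<phi>" "local_param T p \<psi>"
    and "\<And>vs. length vs \<le> l \<Longrightarrow> iter_deriv vs \<phi> 0 = iter_deriv vs \<psi> 0"
  shows "osmall l (\<lambda>t. \<phi> t - \<psi> t)"
proof -
  obtain U where U: "open U" "0 \<in> U" "smooth_on U \<phi>"
    using assms(1) unfolding local_param_def by blast
  obtain V where V: "open V" "0 \<in> V" "smooth_on V \<psi>"
    using assms(2) unfolding local_param_def by blast
  have o: "open (U \<inter> V)" "0 \<in> U \<inter> V" using U V by auto
  have s: "smooth_on (U \<inter> V) \<phi>" "smooth_on (U \<inter> V) \<psi>"
    using U V smooth_on_subset by blast+
  show ?thesis
    by (rule osmall_derivs_vanish[OF o smooth_on_diff[OF o(1) s]])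
      (simp add: iter_deriv_diff[OF o(1) s o(2)] assms(3))
qed

text \<open>Contact with a graph, up to reparametrisation of the second surface. Only a Lipschitz
  reparametrisation is needed, since vanishing to order \<open>l\<close> is phrased without derivatives.\<close>

lemma contact_graph_osmall:
  assumes "g \<in> Aff3" "open U" "smooth_on U f" "open W" "smooth_on W h"
    and "contact l (g (graph_map f z)) (graph_over W h) (g ` graph_over U f)"
  shows "osmall l (\<lambda>x. height (g (graph_map f (z + x))) - h (proj (g (graph_map f (z + x)))))"
proof -
  define p where "p = g (graph_map f z)"
  obtain \<phi> \<psi> where c: "local_param (graph_over W h) p \<phi>" "local_param (g ` graph_over U f) p \<psi>"
    "\<And>vs. length vs \<le> l \<Longrightarrow> iter_deriv vs \<phi> 0 = iter_deriv vs \<psi> 0"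
    using assms(6) unfolding contact_def p_def by blast
  have bij: "bij g" using Aff3_homeo(1)[OF assms(1)] .
  have ig: "inv g (g q) = q" "g (inv g q) = q" for q
    using bij by (simp_all add: bij_is_inj bij_is_surj surj_f_inv_f)
  \<comment> \<open>Pulled back by \<open>inv g\<close>, the chart \<psi> parametrises the original
    graph and can be converted to the graph coordinate.\<close>
  have "local_param (inv g ` g ` graph_over U f) (inv g p) (inv g \<circ> \<psi>)"
    using local_param_act[OF Aff3_homeo(3)[OF assms(1)] c(2)] .
  then have "local_param (graph_over U f) (graph_map f z) (inv g \<circ> \<psi>)"
    by (simp add: p_def image_image ig)
  from graph_param_inverse[OF assms(2,3) this] obtain \<tau> K where \<tau>:
    "\<forall>\<^sub>F x in nhds 0. (inv g \<circ> \<psi>) (\<tau> x) = graph_map f (z + x)"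
    "\<forall>\<^sub>F x in nhds 0. norm (\<tau> x) \<le> K * norm x" .
  have \<psi>\<tau>: "\<forall>\<^sub>F x in nhds 0. \<psi> (\<tau> x) = g (graph_map f (z + x))"
    using \<tau>(1) by eventually_elim (metis comp_apply ig(2))
  have os: "osmall l (\<lambda>x. \<phi> (\<tau> x) - \<psi> (\<tau> x))"
    using osmall_compose[OF osmall_contact[OF c] \<tau>(2)] .
  have \<tau>0: "filterlim \<tau> (nhds 0) (nhds 0)"
    using filterlim_nhds_0_linear_bound[OF \<tau>(2)] .
  obtain U1 V1 \<psi>1 where h: "\<phi> 0 = p" "open U1" "0 \<in> U1" "smooth_on U1 \<phi>"
    "homeomorphism U1 (graph_over W h \<inter> V1) \<phi> \<psi>1"
    using c(1) unfolding local_param_def by blast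
  obtain U2 where h2: "\<psi> 0 = p" "open U2" "0 \<in> U2" "smooth_on U2 \<psi>"
    using c(2) unfolding local_param_def by blast
  have pW: "proj p \<in> W" "height p = h (proj p)"
    using local_param_mem[OF c(1)] by (simp_all add: graph_over_iff)
  obtain d L where d: "d > 0" "L > 0"
    "\<forall>x\<in>ball (proj p) d. \<forall>y\<in>ball (proj p) d. norm (h x - h y) \<le> L * norm (x - y)"
    using smooth_lipschitz[OF assms(4,5) pW(1)] .
  have near: "\<forall>\<^sub>F x in nhds 0. proj (\<eta> (\<tau> x)) \<in> ball (proj p) d"
    if "\<eta> 0 = p" "open X" "0 \<in> X" "smooth_on X \<eta>" for \<eta> X
  proof -
    have "isCont \<eta> 0"
      using that smooth_on_differentiable differentiable_imp_continuous_within by blast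
    then have "filterlim \<eta> (nhds p) (nhds 0)"
      using that(1) tendsto_nhds_iff unfolding isCont_def by metis
    then have "filterlim (\<lambda>x. \<eta> (\<tau> x)) (nhds p) (nhds 0)"
      using \<tau>0 by (rule filterlim_compose)
    then have "\<forall>\<^sub>F x in nhds 0. dist (\<eta> (\<tau> x)) p < d"
      using d(1) by (rule tendstoD)
    then show ?thesis
    proof eventually_elim
      case (elim x)
      have "norm (proj (\<eta> (\<tau> x)) - proj p) \<le> norm (\<eta> (\<tau> x) - p)"
        using norm_proj_le[of "\<eta> (\<tau> x) - p"] by (simp add: linear_diff[OF linear_proj])
      then show ?case using elim by (simp add: dist_norm norm_minus_commute)
    qed
  qed
  have "\<forall>\<^sub>F x in nhds 0. \<tau> x \<in> U1"
    using eventually_compose_filterlim[OF eventually_nhds_in_open[OF h(2,3)] \<tau>0] .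
  with near[OF h(1-4)] near[OF h2] \<psi>\<tau>
  have "\<forall>\<^sub>F x in nhds 0. norm (height (g (graph_map f (z + x))) - h (proj (g (graph_map f (z + x)))))
    \<le> (1 + L) * norm (\<phi> (\<tau> x) - \<psi> (\<tau> x))"
  proof eventually_elim
    case (elim x)
    let ?e = "\<phi> (\<tau> x) - \<psi> (\<tau> x)"
    \<comment> \<open>The defect of height minus \<open>h\<close> vanishes at the \<phi>-point,
      which lies on the graph. At the \<psi>-point it is bounded by the displacement
      \<open>?e\<close>, once through the height and \<open>L\<close> times through
      \<open>h\<close>.\<close>
    have "\<phi> (\<tau> x) \<in> graph_over W h" using elim(4) h(5) unfolding homeomorphism_def by blast
    then have "height (\<psi> (\<tau> x)) - h (proj (\<psi> (\<tau> x))) =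
        (h (proj (\<phi> (\<tau> x))) - h (proj (\<psi> (\<tau> x)))) - height ?e"
      by (simp add: graph_over_iff linear_diff[OF linear_height])
    then have "\<bar>height (\<psi> (\<tau> x)) - h (proj (\<psi> (\<tau> x)))\<bar> \<le>
        \<bar>h (proj (\<phi> (\<tau> x))) - h (proj (\<psi> (\<tau> x)))\<bar> + \<bar>height ?e\<bar>" by linarith
    also have "\<dots> \<le> L * norm (proj ?e) + norm ?e"
      using bspec[OF bspec[OF d(3) elim(1)] elim(2)] norm_height_le[of ?e] by (simp add: linear_diff[OF linear_proj])
    also have "\<dots> \<le> L * norm ?e + norm ?e"
      using d(2) norm_proj_le[of ?e] by simp
    finally show ?case using elim(3) by (simp add: algebra_simps)
  qed
  then show ?thesis by (rule osmall_mono[OF os])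
qed

section \<open>Comparing Taylor coefficients\<close>

text \<open>The direction may vary with \<open>r\<close>, because a ray in the source is carried to
  a curve that is only tangent to a ray.\<close>

lemma osmall_ray:
  assumes "osmall l F" "(u \<longlongrightarrow> u0) (at_right 0)"
  shows "((\<lambda>r. F (r *\<^sub>R u r) / r ^ l) \<longlongrightarrow> (0::real)) (at_right 0)"
proof -
  define C where "C = norm u0 + 1"
  have C: "C > 0" by (simp add: C_def add_nonneg_pos)
  have "((\<lambda>r. norm (u r)) \<longlongrightarrow> norm u0) (at_right 0)"
    using assms(2) by (rule tendsto_norm)
  then have uC: "\<forall>\<^sub>F r in at_right 0. norm (u r) < C"
    by (rule order_tendstoD(2)) (simp add: C_def)
  have pos: "\<forall>\<^sub>F r in at_right (0::real). 0 < r"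
    by (simp add: eventually_at_right_less)
  have "((\<lambda>r::real. r *\<^sub>R u r) \<longlongrightarrow> 0 *\<^sub>R u0) (at_right 0)"
    by (intro tendsto_scaleR assms(2) tendsto_ident_at)
  then have lim: "filterlim (\<lambda>r::real. r *\<^sub>R u r) (nhds 0) (at_right 0)" by simp
  show ?thesis
    unfolding tendsto_iff
  proof (intro allI impI)
    fix e :: real assume e: "e > 0"
    define e' where "e' = e / (2 * C ^ l)"
    have e': "e' > 0" using e C by (simp add: e'_def)
    have "\<forall>\<^sub>F r in at_right 0. norm (F (r *\<^sub>R u r)) \<le> e' * norm (r *\<^sub>R u r) ^ l"
      using eventually_compose_filterlim[OF osmallD[OF assms(1) e'] lim] .
    with uC pos show "\<forall>\<^sub>F r in at_right 0. dist (F (r *\<^sub>R u r) / r ^ l) 0 < e"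
    proof eventually_elim
      case (elim r)
      have "norm (r *\<^sub>R u r) ^ l \<le> (C * r) ^ l"
        using elim by (intro power_mono) (auto simp: mult.commute)
      then have "e' * norm (r *\<^sub>R u r) ^ l \<le> e' * (C * r) ^ l"
        using e' by (intro mult_left_mono) auto
      also have "\<dots> = e / 2 * r ^ l"
        using C by (simp add: e'_def power_mult_distrib)
      also have "\<dots> < e * r ^ l"
        using e elim by simp
      finally have "\<bar>F (r *\<^sub>R u r)\<bar> < e * r ^ l"
        using elim by simp
      then show ?case using elim by (simp add: abs_divide power_abs pos_divide_less_eq)
    qed
  qed
qed

text \<open>Division by \<open>r\<close> and passage to the limit, repeated for each power of
  \<open>r\<close>.\<close>

lemma cubic_expansion_zero:
  fixes \<gamma> \<epsilon> :: "real \<Rightarrow> real"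
  assumes eq: "\<forall>\<^sub>F r in at_right 0. r * \<alpha> + r\<^sup>2 * \<beta> + r^3 * \<gamma> r = r^3 * \<epsilon> r"
    and lim: "(\<gamma> \<longlongrightarrow> \<gamma>0) (at_right 0)" "(\<epsilon> \<longlongrightarrow> 0) (at_right 0)"
  shows "\<alpha> = 0" "\<beta> = 0" "\<gamma>0 = 0"
proof -
  have pos: "\<forall>\<^sub>F r in at_right (0::real). 0 < r"
    by (simp add: eventually_at_right_less)
  have id: "((\<lambda>r::real. r) \<longlongrightarrow> 0) (at_right 0)" by (rule tendsto_ident_at)
  have dl: "((\<lambda>r. \<gamma> r - \<epsilon> r) \<longlongrightarrow> \<gamma>0 - 0) (at_right 0)"
    using lim by (rule tendsto_diff)
  have eq1: "\<forall>\<^sub>F r in at_right 0. \<alpha> + r * \<beta> + r\<^sup>2 * (\<gamma> r - \<epsilon> r) = 0"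
    using eq pos
  proof eventually_elim
    case (elim r)
    have "r * (\<alpha> + r * \<beta> + r\<^sup>2 * (\<gamma> r - \<epsilon> r)) = 0"
      using elim(1) by (simp add: power2_eq_square power3_eq_cube algebra_simps)
    then show ?case using elim(2) by simp
  qed
  have "((\<lambda>r. \<alpha> + r * \<beta> + r\<^sup>2 * (\<gamma> r - \<epsilon> r)) \<longlongrightarrow> \<alpha> + 0 * \<beta> + 0\<^sup>2 * (\<gamma>0 - 0)) (at_right 0)"
    by (intro tendsto_intros id dl)
  from tendsto_unique[OF _ this tendsto_eventually[OF eq1]]
  show \<alpha>: "\<alpha> = 0" by simp
  have eq2: "\<forall>\<^sub>F r in at_right 0. \<beta> + r * (\<gamma> r - \<epsilon> r) = 0"
    using eq1 pos
  proof eventually_elim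
    case (elim r)
    have "r * (\<beta> + r * (\<gamma> r - \<epsilon> r)) = 0"
      using elim(1) \<alpha> by (simp add: power2_eq_square algebra_simps)
    then show ?case using elim(2) by simp
  qed
  have "((\<lambda>r. \<beta> + r * (\<gamma> r - \<epsilon> r)) \<longlongrightarrow> \<beta> + 0 * (\<gamma>0 - 0)) (at_right 0)"
    by (intro tendsto_intros id dl)
  from tendsto_unique[OF _ this tendsto_eventually[OF eq2]]
  show \<beta>: "\<beta> = 0" by simp
  have eq3: "\<forall>\<^sub>F r in at_right 0. \<gamma> r - \<epsilon> r = 0"
    using eq2 pos by eventually_elim (simp add: \<beta>)
  from tendsto_unique[OF _ dl tendsto_eventually[OF eq3]]
  show "\<gamma>0 = 0" by simp
qed

definition quadform :: "real \<Rightarrow> real \<Rightarrow> real \<Rightarrow> plane \<Rightarrow> real" where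
  "quadform a b c = (\<lambda>(x, y). (a * x\<^sup>2 + 2 * b * x * y + c * y\<^sup>2) / 2)"

text \<open>The polar form in the normalisation in which \<open>polar a b c v v\<close> is twice
  \<open>quadform a b c v\<close>.\<close>

definition polar :: "real \<Rightarrow> real \<Rightarrow> real \<Rightarrow> plane \<Rightarrow> plane \<Rightarrow> real" where
  "polar a b c v w = a * fst v * fst w + b * (fst v * snd w + snd v * fst w) + c * snd v * snd w"

lemma quadform_scale: "quadform a b c (r *\<^sub>R v) = r\<^sup>2 * quadform a b c v"
  by (simp add: quadform_def case_prod_unfold power_mult_distrib field_simps power2_eq_square)

lemma quadform_add: "quadform a b c (v + t *\<^sub>R w) =
    quadform a b c v + t * polar a b c v w + t\<^sup>2 * quadform a b c w"
  by (simp add: quadform_def polar_def case_prod_unfold field_simps power2_eq_square)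

lemma cubic_scale: "cubic a b c d (r *\<^sub>R v) = r^3 * cubic a b c d v"
  by (simp add: cubic_def case_prod_unfold power_mult_distrib field_simps power2_eq_square power3_eq_cube)

lemma isCont_cubic: "isCont (cubic a b c d) v"
  unfolding cubic_def case_prod_unfold by (intro continuous_intros)

lemma Q_eq_quadform: "Q s = quadform 1 0 s"
  by (simp add: Q_def quadform_def)

text \<open>Restrict to x = r v. The argument of \<open>h\<close> becomes r u(r) with u(r) = M v + r
  q(r) w, and the three claims are the coefficients of r, r^2 and r^3. The polar term is the cross
  term of the quadratic part of \<open>h\<close> between M v and the displacement along w; the 6
  clears the Taylor denominator of the cubics.\<close>

lemma transformed_graph_coefficients:
  fixes f h :: "plane \<Rightarrow> real" and M :: "plane \<Rightarrow> plane" and m L :: "plane \<Rightarrow> real"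
  assumes lin: "linear M" "linear m" "linear L"
    and f: "osmall 3 (\<lambda>x. f x - (quadform a b c x + cubic d0 d1 d2 d3 x / 6))"
    and h: "osmall 3 (\<lambda>y. h y - (L y + quadform a' b' c' y + cubic d0' d1' d2' d3' y / 6))"
    and fh: "osmall 3 (\<lambda>x. m x + \<kappa> * f x - h (M x + f x *\<^sub>R w))"
  shows "m v = L (M v)"
    and "(\<kappa> - L w) * quadform a b c v = quadform a' b' c' (M v)"
    and "(\<kappa> - L w) * cubic d0 d1 d2 d3 v =
      6 * quadform a b c v * polar a' b' c' (M v) w + cubic d0' d1' d2' d3' (M v)"
proof -
  let ?Qf = "quadform a b c" and ?Qh = "quadform a' b' c'"
  let ?Cf = "\<lambda>x. cubic d0 d1 d2 d3 x / 6" and ?Ch = "\<lambda>x. cubic d0' d1' d2' d3' x / 6"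
  define \<epsilon>1 where "\<epsilon>1 r = (f (r *\<^sub>R v) - (?Qf (r *\<^sub>R v) + ?Cf (r *\<^sub>R v))) / r ^ 3" for r
  \<comment> \<open>For r > 0 this is f(r v) / r^2, written so that its limit at 0 is
    visible.\<close>
  define q where "q r = ?Qf v + r * (?Cf v + \<epsilon>1 r)" for r
  define u where "u r = M v + (r * q r) *\<^sub>R w" for r
  define \<epsilon>2 where "\<epsilon>2 r = (h (r *\<^sub>R u r) - (L (r *\<^sub>R u r) + ?Qh (r *\<^sub>R u r) + ?Ch (r *\<^sub>R u r))) / r ^ 3" for r
  define \<epsilon>3 where "\<epsilon>3 r = (m (r *\<^sub>R v) + \<kappa> * f (r *\<^sub>R v) - h (M (r *\<^sub>R v) + f (r *\<^sub>R v) *\<^sub>R w)) / r ^ 3" for r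
  have id: "((\<lambda>r::real. r) \<longlongrightarrow> 0) (at_right 0)" by (rule tendsto_ident_at)
  have \<epsilon>1: "(\<epsilon>1 \<longlongrightarrow> 0) (at_right 0)"
    unfolding \<epsilon>1_def by (rule osmall_ray[OF f tendsto_const])
  have \<epsilon>3: "(\<epsilon>3 \<longlongrightarrow> 0) (at_right 0)"
    unfolding \<epsilon>3_def by (rule osmall_ray[OF fh tendsto_const])
  have "(q \<longlongrightarrow> ?Qf v + 0 * (?Cf v + 0)) (at_right 0)"
    unfolding q_def by (intro tendsto_intros id \<epsilon>1)
  then have q: "(q \<longlongrightarrow> ?Qf v) (at_right 0)" by simp
  have "(u \<longlongrightarrow> M v + (0 * ?Qf v) *\<^sub>R w) (at_right 0)"
    unfolding u_def by (intro tendsto_intros id q)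
  then have u: "(u \<longlongrightarrow> M v) (at_right 0)" by simp
  have \<epsilon>2: "(\<epsilon>2 \<longlongrightarrow> 0) (at_right 0)"
    unfolding \<epsilon>2_def by (rule osmall_ray[OF h u])
  \<comment> \<open>Everything of order at least three except the remainders of \<open>h\<close> and
    of the contact condition, divided by r^3.\<close>
  define \<gamma> where "\<gamma> r = (\<kappa> - L w) * (?Cf v + \<epsilon>1 r) - q r * polar a' b' c' (M v) w
      - r * (q r)\<^sup>2 * ?Qh w - ?Ch (u r)" for r
  have Chu: "((\<lambda>r. cubic d0' d1' d2' d3' (u r)) \<longlongrightarrow> cubic d0' d1' d2' d3' (M v)) (at_right 0)"
    using isCont_tendsto_compose[OF isCont_cubic u] .
  have "(\<gamma> \<longlongrightarrow> (\<kappa> - L w) * (?Cf v + 0) - ?Qf v * polar a' b' c' (M v) w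
      - 0 * (?Qf v)\<^sup>2 * ?Qh w - ?Ch (M v)) (at_right 0)"
    unfolding \<gamma>_def by (intro tendsto_intros id q \<epsilon>1 Chu) simp
  then have \<gamma>: "(\<gamma> \<longlongrightarrow> (\<kappa> - L w) * ?Cf v - ?Qf v * polar a' b' c' (M v) w - ?Ch (M v)) (at_right 0)"
    by simp
  have \<epsilon>: "((\<lambda>r. \<epsilon>2 r + \<epsilon>3 r) \<longlongrightarrow> 0) (at_right 0)"
    using tendsto_add[OF \<epsilon>2 \<epsilon>3] by simp
  have "\<forall>\<^sub>F r in at_right (0::real). 0 < r"
    by (simp add: eventually_at_right_less)
  then have "\<forall>\<^sub>F r in at_right 0. r * (m v - L (M v)) +
      r\<^sup>2 * ((\<kappa> - L w) * ?Qf v - ?Qh (M v)) + r^3 * \<gamma> r = r^3 * (\<epsilon>2 r + \<epsilon>3 r)"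
  proof eventually_elim
    case (elim r)
    have fr: "f (r *\<^sub>R v) = r\<^sup>2 * q r"
      using elim by (simp add: \<epsilon>1_def q_def quadform_scale cubic_scale field_simps
          power2_eq_square power3_eq_cube)
    have y: "M (r *\<^sub>R v) + f (r *\<^sub>R v) *\<^sub>R w = r *\<^sub>R u r"
      by (simp add: fr u_def linear_scale[OF lin(1)] algebra_simps power2_eq_square)
    have L: "L (r *\<^sub>R u r) = r * L (M v) + r\<^sup>2 * q r * L w"
      by (simp add: u_def linear_scale[OF lin(3)] linear_add[OF lin(3)] algebra_simps power2_eq_square)
    have Qh: "?Qh (r *\<^sub>R u r) = r\<^sup>2 * (?Qh (M v) + r * q r * polar a' b' c' (M v) w + (r * q r)\<^sup>2 * ?Qh w)"
      by (simp add: quadform_scale u_def quadform_add)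
    have h': "h (r *\<^sub>R u r) = L (r *\<^sub>R u r) + ?Qh (r *\<^sub>R u r) + r^3 * ?Ch (u r) + r^3 * \<epsilon>2 r"
      using elim by (simp add: \<epsilon>2_def cubic_scale)
    have "r^3 * \<epsilon>3 r = r * m v + \<kappa> * (r\<^sup>2 * q r) - h (r *\<^sub>R u r)"
      using elim unfolding \<epsilon>3_def y by (simp add: fr linear_scale[OF lin(2)])
    then have e3: "r^3 * \<epsilon>3 r = r * m v + \<kappa> * (r\<^sup>2 * q r) -
        (r * L (M v) + r\<^sup>2 * q r * L w
        + r\<^sup>2 * (?Qh (M v) + r * q r * polar a' b' c' (M v) w + (r * q r)\<^sup>2 * ?Qh w)
        + r^3 * ?Ch (u r) + r^3 * \<epsilon>2 r)"
      unfolding h' L Qh .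
    have rq: "r\<^sup>2 * ((\<kappa> - L w) * q r) = r\<^sup>2 * ((\<kappa> - L w) * ?Qf v) + r^3 * ((\<kappa> - L w) * (?Cf v + \<epsilon>1 r))"
      by (simp add: q_def algebra_simps power2_eq_square power3_eq_cube)
    have "r^3 * \<gamma> r = r^3 * ((\<kappa> - L w) * (?Cf v + \<epsilon>1 r)) - r^3 * (q r * polar a' b' c' (M v) w
      + r * (q r)\<^sup>2 * ?Qh w + ?Ch (u r))"
      by (simp add: \<gamma>_def algebra_simps)
    with e3 rq show ?case
      by (simp add: algebra_simps power2_eq_square power3_eq_cube)
  qed
  from cubic_expansion_zero[OF this \<gamma> \<epsilon>]
  show "m v = L (M v)"
    and "(\<kappa> - L w) * quadform a b c v = quadform a' b' c' (M v)"
    and "(\<kappa> - L w) * cubic d0 d1 d2 d3 v =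
      6 * quadform a b c v * polar a' b' c' (M v) w + cubic d0' d1' d2' d3' (M v)"
    by (simp_all add: field_simps)
qed

section \<open>Affine maps acting on graphs\<close>

definition lift :: "plane \<Rightarrow> space" where
  "lift x = (fst x, snd x, 0)"

abbreviation e3 :: space where
  "e3 \<equiv> (0, 0, 1)"

lemma linear_lift: "linear lift"
  by (auto intro!: linearI simp: lift_def)

lemma graph_map_lift: "graph_map f x = lift x + f x *\<^sub>R e3"
  by (simp add: graph_map_def lift_def)

lemma space_decomp: "q = lift (proj q) + height q *\<^sub>R e3"
  by (simp add: lift_def proj_def height_def)

text \<open>Otherwise the whole image of \<open>A\<close> would lie in the plane where the height
  equals \<open>L\<close> of the projection, and this plane misses \<open>e3\<close>.\<close>

lemma surj_not_in_linear_graph: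
  assumes "linear A" "surj A" "linear (L :: plane \<Rightarrow> real)"
    and "\<And>v. height (A (lift v)) = L (proj (A (lift v)))"
  shows "height (A e3) - L (proj (A e3)) \<noteq> 0"
proof
  assume *: "height (A e3) - L (proj (A e3)) = 0"
  obtain q where q: "A q = e3" using assms(2) by (metis surjD)
  have "A q = A (lift (proj q)) + height q *\<^sub>R A e3"
    by (subst space_decomp[of q]) (simp only: linear_add[OF assms(1)] linear_scale[OF assms(1)])
  then have "height (A q) = L (proj (A q))"
    using * assms(4)[of "proj q"]
    by (simp add: linear_add[OF linear_height] linear_add[OF linear_proj] linear_add[OF assms(3)]
        linear_scale[OF linear_height] linear_scale[OF linear_proj] linear_scale[OF assms(3)])
  then show False
    by (simp add: q height_def proj_def linear_0[OF assms(3), unfolded zero_prod_def])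
qed

text \<open>The base point is moved to the origin by using y \<mapsto> h(proj p + y) - h(proj p) as
  the target function, for which \<open>g\<close> acts through its linear part
  \<open>A\<close>.\<close>

lemma affine_graph_coefficients:
  assumes g: "g = (\<lambda>v. A v + p)" "linear A" "bij A"
    and f: "open U" "smooth_on U f" "f 0 = 0"
      "osmall 3 (\<lambda>x. f x - (quadform a b c x + cubic d0 d1 d2 d3 x / 6))"
    and h: "open W" "smooth_on W h"
    and contact: "contact 3 p (graph_over W h) (g ` graph_over U f)"
    and taylor: "osmall 3 (\<lambda>y. h (proj p + y) - h (proj p) -
      (L y + quadform a' b' c' y + cubic d0' d1' d2' d3' y / 6))" "linear L"
  shows "height (A (lift v)) = L (proj (A (lift v)))"
    and "(height (A e3) - L (proj (A e3))) * quadform a b c v = quadform a' b' c' (proj (A (lift v)))"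
    and "(height (A e3) - L (proj (A e3))) * cubic d0 d1 d2 d3 v =
      6 * quadform a b c v * polar a' b' c' (proj (A (lift v))) (proj (A e3))
      + cubic d0' d1' d2' d3' (proj (A (lift v)))"
    and "height (A e3) - L (proj (A e3)) \<noteq> 0"
proof -
  have gA: "g \<in> Aff3" unfolding Aff3_def using g by blast
  have g0: "g (graph_map f 0) = p"
  proof -
    have "graph_map f 0 = 0" using f(3) by (simp add: graph_map_def zero_prod_def)
    then show ?thesis by (simp add: g(1) linear_0[OF g(2)])
  qed
  obtain \<phi> where "local_param (graph_over W h) p \<phi>"
    using contact unfolding contact_def by blast
  from local_param_mem[OF this] have hp: "height p = h (proj p)"
    by (simp add: graph_over_iff)
  have gq: "g (graph_map f x) = A (lift x) + f x *\<^sub>R A e3 + p" for x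
    unfolding g(1) graph_map_lift by (simp only: linear_add[OF g(2)] linear_scale[OF g(2)])
  have "osmall 3 (\<lambda>x. height (g (graph_map f (0 + x))) - h (proj (g (graph_map f (0 + x)))))"
    by (rule contact_graph_osmall[OF gA f(1,2) h]) (use contact g0 in simp)
  moreover have "height (g (graph_map f (0 + x))) - h (proj (g (graph_map f (0 + x)))) =
      height (A (lift x)) + height (A e3) * f x
      - (h (proj p + (proj (A (lift x)) + f x *\<^sub>R proj (A e3))) - h (proj p))" for x
    by (simp add: gq linear_add[OF linear_height] linear_add[OF linear_proj]
        linear_scale[OF linear_height] linear_scale[OF linear_proj] hp add.commute)
  ultimately have fh: "osmall 3 (\<lambda>x. height (A (lift x)) + height (A e3) * f x
      - (h (proj p + (proj (A (lift x)) + f x *\<^sub>R proj (A e3))) - h (proj p)))"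
    by simp
  have lin: "linear (\<lambda>x. proj (A (lift x)))" "linear (\<lambda>x. height (A (lift x)))"
    using linear_compose[OF linear_compose[OF linear_lift g(2)] linear_proj]
      linear_compose[OF linear_compose[OF linear_lift g(2)] linear_height]
    by (simp_all add: comp_def)
  note * = transformed_graph_coefficients[OF lin taylor(2) f(4) taylor(1) fh]
  show "height (A (lift v)) = L (proj (A (lift v)))"
    and "(height (A e3) - L (proj (A e3))) * quadform a b c v = quadform a' b' c' (proj (A (lift v)))"
    and "(height (A e3) - L (proj (A e3))) * cubic d0 d1 d2 d3 v =
      6 * quadform a b c v * polar a' b' c' (proj (A (lift v))) (proj (A e3))
      + cubic d0' d1' d2' d3' (proj (A (lift v)))"
    using *[of v] by simp_all
  show "height (A e3) - L (proj (A e3)) \<noteq> 0"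
    using surj_not_in_linear_graph[OF g(2) bij_is_surj[OF g(3)] taylor(2)] *(1) by simp
qed

section \<open>Coordinates of graph jets\<close>

lemma Aff3_id: "(\<lambda>v. v) \<in> Aff3"
proof -
  have "linear (\<lambda>v::space. v)" "bij (\<lambda>v::space. v)"
    by (simp_all add: linear_ident bij_id[unfolded id_def])
  moreover have "(\<lambda>v::space. v) = (\<lambda>v. v + 0)" by simp
  ultimately show ?thesis unfolding Aff3_def by blast
qed

lemma Aff3_comp:
  assumes "g \<in> Aff3" "h \<in> Aff3"
  shows "g \<circ> h \<in> Aff3"
proof -
  obtain A b where A: "linear A" "bij A" "g = (\<lambda>v. A v + b)"
    using assms(1) unfolding Aff3_def by blast
  obtain C d where C: "linear C" "bij C" "h = (\<lambda>v. C v + d)"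
    using assms(2) unfolding Aff3_def by blast
  have "g \<circ> h = (\<lambda>v. (A \<circ> C) v + (A d + b))"
    by (auto simp: A(3) C(3) linear_add[OF A(1)])
  then show ?thesis
    unfolding Aff3_def using linear_compose[OF C(1) A(1)] bij_comp[OF C(2) A(2)] by blast
qed

lemma Aff3_linear:
  assumes "linear g" "bij g"
  shows "g \<in> Aff3"
  unfolding Aff3_def using assms by (intro CollectI exI[of _ g] exI[of _ 0]) simp

lemma act_id: "act (\<lambda>v. v) \<theta> = \<theta>"
  by (simp add: act_def)

lemma act_comp: "act g (act h \<theta>) = act (g \<circ> h) \<theta>"
  by (simp add: act_def image_comp comp_def)

lemma jet_in_jets: "surface S \<Longrightarrow> p \<in> S \<Longrightarrow> jet l p S \<in> jets l"
  unfolding jets_def by blast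

text \<open>The case of the identity map: contact makes the difference of the two functions vanish
  to order \<open>l\<close>, and vanishing is converted back to derivatives.\<close>

lemma graph_contact_iter_deriv:
  assumes "open U" "smooth_on U f" "open W" "smooth_on W h" "z \<in> U"
    and "contact l (graph_map f z) (graph_over W h) (graph_over U f)" "length vs \<le> l"
  shows "iter_deriv vs f z = iter_deriv vs h z"
proof -
  have "z \<in> W"
  proof -
    obtain \<phi> where "local_param (graph_over W h) (graph_map f z) \<phi>"
      using assms(6) unfolding contact_def by blast
    from local_param_mem[OF this] show ?thesis by (simp add: graph_over_iff)
  qed
  have o: "open ({x. z + x \<in> U} \<inter> {x. z + x \<in> W})"
    using open_shift[OF assms(1)] open_shift[OF assms(3)] by (rule open_Int)
  have 0: "0 \<in> {x. z + x \<in> U} \<inter> {x. z + x \<in> W}" using \<open>z \<in> U\<close> \<open>z \<in> W\<close> by simp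
  have s: "smooth_on ({x. z + x \<in> U} \<inter> {x. z + x \<in> W}) (\<lambda>x. f (z + x))"
    "smooth_on ({x. z + x \<in> U} \<inter> {x. z + x \<in> W}) (\<lambda>x. h (z + x))"
    using smooth_on_shift[OF assms(2), of z] smooth_on_shift[OF assms(4), of z]
    by (auto elim!: smooth_on_subset)
  have "contact l (graph_map f z) (graph_over W h) ((\<lambda>v. v) ` graph_over U f)"
    using assms(6) by simp
  from contact_graph_osmall[OF Aff3_id assms(1-4) this]
  have os: "osmall l (\<lambda>x. f (z + x) - h (z + x))" by simp
  from iter_deriv_eq_0_if_osmall[OF o 0 smooth_on_diff[OF o s] os assms(7)]
  show ?thesis
    unfolding iter_deriv_diff[OF o s 0] by (simp add: iter_deriv_shift)
qed

text \<open>Justifies the definite description in \<open>u_coord\<close>. A jet determines its base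
  point, and two graphs representing it have contact of order three, hence equal derivatives up to
  that order.\<close>

lemma u_coord_graph:
  assumes "graph_rep \<theta> f z" "length vs \<le> 3"
  shows "u_coord vs \<theta> = iter_deriv vs f z"
  unfolding u_coord_def
proof (rule the_equality)
  show "\<exists>f' z'. graph_rep \<theta> f' z' \<and> iter_deriv vs f z = iter_deriv vs f' z'"
    using assms(1) by (intro exI[of _ f] exI[of _ z]) simp
  fix c assume "\<exists>h z'. graph_rep \<theta> h z' \<and> c = iter_deriv vs h z'"
  then obtain h z' where h: "graph_rep \<theta> h z'" and c: "c = iter_deriv vs h z'"
    by (elim exE conjE)
  obtain U where U: "open U" "z \<in> U" "smooth_on U f" "\<theta> = jet 3 (graph_map f z) (graph_over U f)"
    using assms(1) unfolding graph_rep_def graph_map_def by blast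
  obtain W where W: "open W" "z' \<in> W" "smooth_on W h" "\<theta> = jet 3 (graph_map h z') (graph_over W h)"
    using h unfolding graph_rep_def graph_map_def by blast
  have "graph_map f z = graph_map h z'"
    using U(4) W(4) by (simp add: jet_def)
  then have zz: "z' = z" and eq: "graph_map h z = graph_map f z"
    by (metis proj_graph_map)+
  have "contact 3 (graph_map f z) (graph_over W h) (graph_over U f)"
  proof (rule contact_if_jet_eq)
    show "jet 3 (graph_map f z) (graph_over W h) = jet 3 (graph_map f z) (graph_over U f)"
      using U(4) W(4) unfolding zz eq by simp
    show "surface (graph_over U f)" using surface_graph_over U(1,3) .
    show "graph_map f z \<in> graph_over U f" using U(2) by (simp add: graph_over_iff)
  qed
  from graph_contact_iter_deriv[OF U(1,3) W(1,3) U(2) this assms(2)]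
  show "c = iter_deriv vs f z" by (simp add: c zz)
qed

section \<open>The Hessian sign\<close>

lemma rot_linear: "linear rot" "bij rot"
proof -
  show "linear rot" by (auto intro!: linearI simp: rot_def)
  show "bij rot"
    by (rule bijI'[of rot]) (auto simp: rot_def)
qed

lemma rot_power_Aff3: "(rot ^^ k) \<in> Aff3"
proof (induction k)
  case 0
  then show ?case using Aff3_id by (simp add: id_def)
next
  case (Suc k)
  then show ?case using Aff3_comp[OF Aff3_linear[OF rot_linear] Suc] by (simp only: funpow.simps)
qed

text \<open>The three projections have the 2x2 minors of \<open>T\<close> as determinants, up to
  sign. If all minors vanish, each vector \<open>(b_i, - a_i)\<close> is in the kernel, which forces
  \<open>T\<close> to be zero.\<close>

lemma chart_exists:
  fixes T :: "plane \<Rightarrow> space"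
  assumes "linear T" "inj T"
  shows "\<exists>k<3. inj (\<lambda>v. proj ((rot ^^ k) (T v)))"
proof (rule ccontr)
  assume no: "\<not> ?thesis"
  obtain a1 a2 a3 where a: "T ex = (a1, a2, a3)" by (cases "T ex") auto
  obtain b1 b2 b3 where b: "T ey = (b1, b2, b3)" by (cases "T ey") auto
  have T: "T v = (fst v * a1 + snd v * b1, fst v * a2 + snd v * b2, fst v * a3 + snd v * b3)" for v
    using linear_plane[OF assms(1), of v] by (simp add: a b)
  have inj: "inj (\<lambda>v::plane. (fst v * x1 + snd v * y1, fst v * x2 + snd v * y2))"
    if "x1 * y2 - x2 * y1 \<noteq> 0" for x1 x2 y1 y2 :: real
  proof (rule injI)
    fix v w :: plane
    assume *: "(fst v * x1 + snd v * y1, fst v * x2 + snd v * y2) =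
      (fst w * x1 + snd w * y1, fst w * x2 + snd w * y2)"
    then have 1: "(fst v - fst w) * x1 + (snd v - snd w) * y1 = 0"
      and 2: "(fst v - fst w) * x2 + (snd v - snd w) * y2 = 0"
      by (simp_all add: algebra_simps)
    have "(fst v - fst w) * (x1 * y2 - x2 * y1) = 0" "(snd v - snd w) * (x1 * y2 - x2 * y1) = 0"
      using 1 2 by algebra+
    then show "v = w" using that by (simp add: prod_eq_iff)
  qed
  have k: "\<not> inj (\<lambda>v. proj ((rot ^^ k) (T v)))" if "k < 3" for k
    using no that by blast
  have "a1 * b2 - a2 * b1 = 0"
    using k[of 0] inj[of a1 b2 a2 b1] by (auto simp: T proj_def)
  moreover have "a2 * b3 - a3 * b2 = 0"
    using k[of 1] inj[of a2 b3 a3 b2] by (auto simp: T proj_def rot_def)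
  moreover have "a3 * b1 - a1 * b3 = 0"
    using k[of 2] inj[of a3 b1 a1 b3] by (auto simp: T proj_def rot_def numeral_2_eq_2)
  ultimately have "T (b1, - a1) = 0" "T (b2, - a2) = 0" "T (b3, - a3) = 0"
    by (simp_all add: T zero_prod_def algebra_simps)
  then have "(b1, - a1) = 0" "(b2, - a2) = 0" "(b3, - a3) = 0"
    using assms linear_injective_0 by blast+
  then have "T ex = 0" by (simp add: a zero_prod_def)
  then have "ex = 0" using assms linear_injective_0 by blast
  then show False by (simp add: ex_def zero_prod_def)
qed

text \<open>Determinants of Gram matrices: a pullback by \<open>M\<close> multiplies the determinant
  by the square of that of \<open>M\<close>, and the matrix of the left form is k times diag(1,
  s).\<close>

lemma quadform_pullback_det:
  assumes "linear M" "\<And>v. k * quadform 1 0 s v = quadform a b c (M v)"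
  shows "(a * c - b\<^sup>2) * (plane_det M)\<^sup>2 = k\<^sup>2 * s"
proof -
  obtain p q where M1: "M ex = (p, q)" by (cases "M ex")
  obtain r t where M2: "M ey = (r, t)" by (cases "M ey")
  have M3: "M (ex + ey) = (p + r, q + t)" by (simp add: linear_add[OF assms(1)] M1 M2)
  have 1: "a * p\<^sup>2 + 2 * b * p * q + c * q\<^sup>2 = k"
    using assms(2)[of ex] unfolding M1 by (simp add: quadform_def ex_def)
  have 2: "a * r\<^sup>2 + 2 * b * r * t + c * t\<^sup>2 = k * s"
    using assms(2)[of ey] unfolding M2 by (simp add: quadform_def ey_def)
  \<comment> \<open>Evaluation at the sum of the basis vectors isolates the off-diagonal
    entry.\<close>
  have "a * (p + r)\<^sup>2 + 2 * b * (p + r) * (q + t) + c * (q + t)\<^sup>2 = k * (1 + s)"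
    using assms(2)[of "ex + ey"] unfolding M3 by (simp add: quadform_def ex_def ey_def)
  then have 3: "a * p * r + b * (p * t + q * r) + c * q * t = 0"
    using 1 2 by (simp add: power2_eq_square algebra_simps)
  have "(a * c - b\<^sup>2) * (p * t - q * r)\<^sup>2 =
    (a * p\<^sup>2 + 2 * b * p * q + c * q\<^sup>2) * (a * r\<^sup>2 + 2 * b * r * t + c * t\<^sup>2)
    - (a * p * r + b * (p * t + q * r) + c * q * t)\<^sup>2"
    by (simp add: power2_eq_square algebra_simps)
  also have "\<dots> = k\<^sup>2 * s" unfolding 1 2 3 by (simp add: power2_eq_square)
  finally show ?thesis by (simp add: plane_det_def M1 M2)
qed

lemma tpoly_split: "tpoly c c1 c2 c11 c12 c22 c111 c112 c122 c222 y =
  c + (c1 * fst y + c2 * snd y + quadform c11 c12 c22 y + cubic c111 c112 c122 c222 y / 6)"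
  by (simp add: tpoly_def quadform_def cubic_def case_prod_unfold field_simps)

text \<open>A rotation turns the image surface into a graph near the image point; the rotated map is
  again affine, so the comparison of second-order terms applies to it and determines the sign of the
  Hessian in that chart.\<close>

lemma act_jet_in_J3:
  assumes s: "s = 1 \<or> s = -1" and g: "g \<in> Aff3"
    and f: "open U" "0 \<in> U" "smooth_on U f" "f 0 = 0"
      "osmall 3 (\<lambda>x. f x - (quadform 1 0 s x + cubic d0 d1 d2 d3 x / 6))"
  shows "act g (jet 3 0 (graph_over U f)) \<in> J3 s"
proof -
  let ?S = "graph_over U f"
  let ?\<eta> = "g \<circ> graph_map f"
  have gm0: "graph_map f 0 = 0" using f(4) by (simp add: graph_map_def zero_prod_def)
  have lp: "local_param ?S 0 (graph_map f)"
    using local_param_graph[OF f(1,3,2)] by (simp add: gm0)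
  have lpg: "local_param (g ` ?S) (g 0) ?\<eta>" using local_param_act[OF g lp] .
  then obtain X where X: "open X" "0 \<in> X" "smooth_on X ?\<eta>" "inj (frechet_derivative ?\<eta> (at 0))"
    unfolding local_param_def by blast
  define T where "T = frechet_derivative ?\<eta> (at 0)"
  have T: "linear T" "inj T"
    using X linear_frechet_derivative[OF smooth_on_differentiable[OF X(3,2)]] by (simp_all add: T_def)
  from chart_exists[OF this] obtain k where k: "k < 3" "inj (\<lambda>v. proj ((rot ^^ k) (T v)))" by blast
  define G where "G = (rot ^^ k) \<circ> g"
  have GA: "G \<in> Aff3" unfolding G_def using Aff3_comp[OF rot_power_Aff3 g] .
  have lin_rot: "linear (rot ^^ k)"
  proof (induction k)
    case (Suc k)
    then show ?case using linear_compose[OF Suc rot_linear(1)] by (simp only: funpow.simps)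
  qed (simp add: linear_ident id_def)
  have lpG: "local_param (G ` ?S) (G 0) (\<lambda>t. (rot ^^ k) (?\<eta> t))"
    using local_param_act[OF rot_power_Aff3 lpg, of k] by (simp add: G_def image_comp comp_def)
  have "((\<lambda>t. (rot ^^ k) (?\<eta> t)) has_derivative (\<lambda>v. (rot ^^ k) (T v))) (at 0)"
    using affine_has_derivative[OF X(1,2) lin_rot smooth_on_differentiable[OF X(3,2)],
        where h = "\<lambda>t. (rot ^^ k) (?\<eta> t)" and b = 0] by (simp add: T_def)
  from frechet_derivative_at[OF this]
  have "frechet_derivative (\<lambda>t. (rot ^^ k) (?\<eta> t)) (at 0) = (\<lambda>v. (rot ^^ k) (T v))" ..
  then have "inj (\<lambda>v. proj (frechet_derivative (\<lambda>t. (rot ^^ k) (?\<eta> t)) (at 0) v))"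
    using k(2) by simp
  from local_graph[OF lpG this] obtain W V h where h: "open W" "proj (G 0) \<in> W" "smooth_on W h"
    "open V" "G 0 \<in> V" "G ` ?S \<inter> V = graph_over W h" "G 0 = graph_map h (proj (G 0))" .
  define z where "z = proj (G 0)"
  have jet_eq: "act G (jet 3 0 ?S) = jet 3 (G 0) (graph_over W h)"
    unfolding act_jet[OF GA]
  proof (rule jet_local[OF h(4,5)])
    show "G ` ?S \<inter> V = graph_over W h \<inter> V" using h(6) by blast
  qed
  have rep: "graph_rep (act G (jet 3 0 ?S)) h z"
    unfolding graph_rep_def jet_eq
    using h(1,2,3,7) by (intro exI[of _ W]) (simp add: z_def graph_map_def)
  have contact: "contact 3 (G 0) (graph_over W h) (G ` ?S)"
  proof (rule contact_if_jet_eq)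
    show "jet 3 (G 0) (graph_over W h) = jet 3 (G 0) (G ` ?S)"
      using jet_eq act_jet[OF GA] by simp
    show "surface (G ` ?S)" using surface_act[OF GA surface_graph_over[OF f(1,3)]] .
    show "G 0 \<in> G ` ?S" using local_param_mem[OF lp] by blast
  qed
  obtain A p where A: "linear A" "bij A" "G = (\<lambda>v. A v + p)"
    using GA unfolding Aff3_def by blast
  have G0: "G 0 = p" by (simp add: A(3) linear_0[OF A(1)])
  define L where "L y = iter_deriv [ex] h z * fst y + iter_deriv [ey] h z * snd y" for y :: plane
  have lL: "linear L" unfolding L_def by (auto intro!: linearI simp: algebra_simps)
  have "z \<in> W" using h(2) by (simp add: z_def)
  have "osmall 3 (\<lambda>y. h (proj p + y) - h (proj p) - (L y +
      quadform (iter_deriv [ex, ex] h z) (iter_deriv [ex, ey] h z) (iter_deriv [ey, ey] h z) y +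
      cubic (iter_deriv [ex, ex, ex] h z) (iter_deriv [ex, ex, ey] h z)
        (iter_deriv [ex, ey, ey] h z) (iter_deriv [ey, ey, ey] h z) y / 6))"
    using osmall_taylor3[OF h(1) \<open>z \<in> W\<close> h(3)] z_def G0
    unfolding taylor3_def tpoly_split L_def by (simp only: diff_diff_eq)
  note * = affine_graph_coefficients[OF A(3,1,2) f(1,3,4,5) h(1,3) contact[unfolded G0] this lL]
  let ?k = "height (A e3) - L (proj (A e3))" and ?M = "\<lambda>v. proj (A (lift v))"
  have linM: "linear ?M"
    using linear_compose[OF linear_compose[OF linear_lift A(1)] linear_proj] by (simp add: comp_def)
  have "(iter_deriv [ex, ex] h z * iter_deriv [ey, ey] h z - (iter_deriv [ex, ey] h z)\<^sup>2)
      * (plane_det ?M)\<^sup>2 = ?k\<^sup>2 * s"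
    by (rule quadform_pullback_det[OF linM *(2)])
  moreover have "det_hess (act G (jet 3 0 ?S)) =
      iter_deriv [ex, ex] h z * iter_deriv [ey, ey] h z - (iter_deriv [ex, ey] h z)\<^sup>2"
    unfolding det_hess_def by (simp add: u_coord_graph[OF rep] del: iter_deriv.simps)
  ultimately have det: "det_hess (act G (jet 3 0 ?S)) * (plane_det ?M)\<^sup>2 = ?k\<^sup>2 * s" by simp
  \<comment> \<open>As s is its own inverse, multiplication by it leaves the square of a nonzero
    number on the right.\<close>
  have "(s * det_hess (act G (jet 3 0 ?S))) * (plane_det ?M)\<^sup>2 = ?k\<^sup>2"
    using det s by auto
  moreover have "?k\<^sup>2 > 0" using *(4) by simp
  ultimately have "(s * det_hess (act G (jet 3 0 ?S))) * (plane_det ?M)\<^sup>2 > 0" by simp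
  then have pos: "s * det_hess (act G (jet 3 0 ?S)) > 0"
    by (auto simp: zero_less_mult_iff)
  have "act g (jet 3 0 ?S) \<in> jets 3"
    unfolding act_jet[OF g] using surface_act[OF g surface_graph_over[OF f(1,3)]] local_param_mem[OF lpg]
    by (rule jet_in_jets)
  moreover have "is_graph_jet (act (rot ^^ k) (act g (jet 3 0 ?S)))"
    unfolding is_graph_jet_def act_comp G_def[symmetric] using rep by blast
  moreover have "s * det_hess (act (rot ^^ k) (act g (jet 3 0 ?S))) > 0"
    using pos by (simp only: act_comp G_def)
  ultimately show ?thesis
    unfolding J3_def using k(1) by blast
qed

section \<open>The fibre over the 2-jet of the quadric\<close>

lemma Q_eq_tpoly: "Q s = tpoly 0 0 0 1 0 s 0 0 0 0"
  by (auto simp: fun_eq_iff Q_def tpoly_def)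

lemma smooth_on_Q: "smooth_on U (Q s)"
  unfolding Q_eq_tpoly by (rule smooth_on_tpoly)

lemma surface_quadric: "surface (quadric s)" "0 \<in> quadric s"
  unfolding quadric_def
  using surface_graph_over[OF open_UNIV smooth_on_Q]
  by (auto simp: graph_over_iff proj_def height_def Q_def)

lemma graph_rep_at_0:
  assumes "open U" "0 \<in> U" "smooth_on U f" "f 0 = 0"
  shows "graph_rep (jet 3 0 (graph_over U f)) f 0"
proof -
  have "(fst (0::plane), snd (0::plane), f 0) = 0"
    by (simp add: prod_eq_iff assms(4))
  then show ?thesis
    unfolding graph_rep_def using assms(1-3) by (intro exI[of _ U]) simp
qed

lemma Q_0: "Q s 0 = 0"
  by (simp add: Q_def case_prod_unfold)

lemma graph_rep_quadric: "graph_rep (jet 3 0 (quadric s)) (Q s) 0"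
  unfolding quadric_def by (rule graph_rep_at_0[OF open_UNIV UNIV_I smooth_on_Q Q_0])

lemma iter_deriv_Q:
  "iter_deriv [] (Q s) 0 = 0" "iter_deriv [ex] (Q s) 0 = 0" "iter_deriv [ey] (Q s) 0 = 0"
  "iter_deriv [ex, ex] (Q s) 0 = 1" "iter_deriv [ex, ey] (Q s) 0 = 0" "iter_deriv [ey, ey] (Q s) 0 = s"
  "iter_deriv [ex, ex, ex] (Q s) 0 = 0" "iter_deriv [ex, ex, ey] (Q s) 0 = 0"
  "iter_deriv [ex, ey, ey] (Q s) 0 = 0" "iter_deriv [ey, ey, ey] (Q s) 0 = 0"
  unfolding Q_eq_tpoly by (simp_all add: frechet_derivative_tpoly tpoly_0 ex_def ey_def)

text \<open>First-order contact copies the tangent plane of the quadric. It is horizontal at the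
  origin since the differential of Q vanishes there, so it projects injectively.\<close>

lemma contact_quadric_transverse:
  assumes "contact 1 0 S (quadric s)"
  obtains \<phi> where "local_param S 0 \<phi>" "inj (\<lambda>v. proj (frechet_derivative \<phi> (at 0) v))"
proof -
  obtain \<phi> \<psi> where c: "local_param S 0 \<phi>" "local_param (quadric s) 0 \<psi>"
    "\<And>vs. length vs \<le> 1 \<Longrightarrow> iter_deriv vs \<phi> 0 = iter_deriv vs \<psi> 0"
    using assms unfolding contact_def by blast
  have eq: "frechet_derivative \<phi> (at 0) v = frechet_derivative \<psi> (at 0) v" for v
    using c(3)[of "[v]"] by simp
  obtain U V \<eta> where U: "\<psi> 0 = 0" "open U" "0 \<in> U" "smooth_on U \<psi>"
    "inj (frechet_derivative \<psi> (at 0))" "homeomorphism U (quadric s \<inter> V) \<psi> \<eta>"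
    using c(2) unfolding local_param_def by blast
  let ?D = "frechet_derivative \<psi> (at 0)"
  note d = smooth_on_differentiable[OF U(4,3)]
  have dp: "((\<lambda>t. proj (\<psi> t)) has_derivative (\<lambda>v. proj (?D v))) (at 0)"
    using affine_has_derivative[OF U(2,3) linear_proj d, where h = "\<lambda>t. proj (\<psi> t)" and b = 0] by simp
  have dh: "((\<lambda>t. height (\<psi> t)) has_derivative (\<lambda>v. height (?D v))) (at 0)"
    using affine_has_derivative[OF U(2,3) linear_height d, where h = "\<lambda>t. height (\<psi> t)" and b = 0] by simp
  have "proj (\<psi> 0) = 0" by (simp add: U(1) linear_0[OF linear_proj])
  moreover have "frechet_derivative (Q s) (at 0) = (\<lambda>v. 0)"
    unfolding Q_eq_tpoly by (rule ext) (simp add: frechet_derivative_tpoly tpoly_0)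
  ultimately have "(Q s has_derivative (\<lambda>v. 0)) (at (proj (\<psi> 0)))"
    using smooth_on_has_derivative[OF smooth_on_Q, of 0 UNIV s] by simp
  from diff_chain_at[OF dp this]
  have "((\<lambda>t. Q s (proj (\<psi> t))) has_derivative (\<lambda>v. 0)) (at 0)"
    by (simp add: comp_def)
  moreover have "Q s (proj (\<psi> t)) = height (\<psi> t)" if "t \<in> U" for t
  proof -
    have "\<psi> t \<in> quadric s" using U(6) that unfolding homeomorphism_def by blast
    then show ?thesis by (simp add: quadric_def graph_over_iff)
  qed
  ultimately have "((\<lambda>t. height (\<psi> t)) has_derivative (\<lambda>v. 0)) (at 0)"
    by (rule has_derivative_transform_within_open[OF _ U(2,3)])
  from has_derivative_unique[OF dh this] have h0: "height (?D v) = 0" for v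
    by (rule fun_cong)
  have "inj (\<lambda>v. proj (?D v))"
  proof (rule injI)
    fix v w assume "proj (?D v) = proj (?D w)"
    then have "?D v = ?D w" by (simp add: space_eq_iff h0)
    then show "v = w" using U(5) by (simp add: inj_eq)
  qed
  then show ?thesis using that[OF c(1)] by (simp add: eq)
qed

text \<open>Contact of order two transfers the derivatives up to second order from Q. As the third
  derivatives of Q are zero, the jet difference consists of the third derivatives of
  \<open>f\<close>.\<close>

lemma fibre_graph:
  assumes "\<theta> \<in> fibre s"
  obtains U f d0 d1 d2 d3 where "open U" "0 \<in> U" "smooth_on U f" "f 0 = 0"
    "\<theta> = jet 3 0 (graph_over U f)" "jet_diff \<theta> (jet 3 0 (quadric s)) = cubic d0 d1 d2 d3"
    "osmall 3 (\<lambda>x. f x - (quadform 1 0 s x + cubic d0 d1 d2 d3 x / 6))"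
proof -
  obtain S where S: "surface S" "0 \<in> S" "jet 2 0 S = jet 2 0 (quadric s)" "\<theta> = jet 3 0 S"
    using assms unfolding fibre_def by blast
  have c2: "contact 2 0 S (quadric s)"
    using contact_if_jet_eq[OF S(3) surface_quadric] .
  then have "contact 1 0 S (quadric s)"
    unfolding contact_def by (metis one_le_numeral order_trans)
  from contact_quadric_transverse[OF this] obtain \<phi> where
    \<phi>: "local_param S 0 \<phi>" "inj (\<lambda>v. proj (frechet_derivative \<phi> (at 0) v))" .
  obtain U V f where f: "open U" "proj 0 \<in> U" "smooth_on U f" "open V" "0 \<in> V"
    "S \<inter> V = graph_over U f" "0 = graph_map f (proj 0)"
    using local_graph[OF \<phi>] .
  have p0: "proj 0 = 0" by (rule linear_0[OF linear_proj])
  have U0: "0 \<in> U" using f(2) p0 by simp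
  have gm0: "graph_map f 0 = 0" using f(7) p0 by simp
  have f0: "f 0 = 0" using arg_cong[OF gm0, of height] by (simp add: linear_0[OF linear_height])
  have gQ0: "graph_map (Q s) 0 = 0" by (simp add: graph_map_def Q_def zero_prod_def)
  have SV: "S \<inter> V = graph_over U f \<inter> V" using f(6) by blast
  have jet: "\<theta> = jet 3 0 (graph_over U f)"
    unfolding S(4) by (rule jet_local[OF f(4,5) SV])
  have rep: "graph_rep \<theta> f 0"
    unfolding jet by (rule graph_rep_at_0[OF f(1) U0 f(3) f0])
  have "contact 2 0 (graph_over U f) (quadric s)"
    by (rule contact_local[OF c2 f(4,5) SV])
  then have "contact 2 (graph_map (Q s) 0) (graph_over U f) (graph_over UNIV (Q s))"
    by (simp add: gQ0 quadric_def)
  from graph_contact_iter_deriv[OF open_UNIV smooth_on_Q f(1,3) UNIV_I this]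
  have low: "iter_deriv vs f 0 = iter_deriv vs (Q s) 0" if "length vs \<le> 2" for vs
    using that by simp
  let ?c = "cubic (iter_deriv [ex, ex, ex] f 0) (iter_deriv [ex, ex, ey] f 0)
        (iter_deriv [ex, ey, ey] f 0) (iter_deriv [ey, ey, ey] f 0)"
  have "jet_diff \<theta> (jet 3 0 (quadric s)) = ?c"
    unfolding jet_diff_def
    by (simp add: u_coord_graph[OF rep] u_coord_graph[OF graph_rep_quadric] iter_deriv_Q
        del: iter_deriv.simps)
  moreover have "taylor3 f 0 x = quadform 1 0 s x + ?c x / 6" for x
    unfolding taylor3_def tpoly_split
    by (simp add: low iter_deriv_Q f0 del: iter_deriv.simps)
  then have "osmall 3 (\<lambda>x. f x - (quadform 1 0 s x + ?c x / 6))"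
    using osmall_taylor3[OF f(1) U0 f(3)] by simp
  ultimately show ?thesis using that f(1,3) U0 f0 jet by blast
qed

section \<open>Cubic forms modulo the quadratic form\<close>

lemma linear_times_Q_add:
  assumes "f \<in> linear_times_Q s" "g \<in> linear_times_Q s"
  shows "(\<lambda>v. f v + g v) \<in> linear_times_Q s"
proof -
  obtain m n where "linear m" "f = (\<lambda>v. m v * Q s v)" "linear n" "g = (\<lambda>v. n v * Q s v)"
    using assms unfolding linear_times_Q_def by blast
  then show ?thesis
    unfolding linear_times_Q_def
    by (intro CollectI exI[of _ "\<lambda>v. m v + n v"]) (auto simp: algebra_simps linear_compose_add)
qed

lemma linear_times_Q_uminus:
  assumes "f \<in> linear_times_Q s"
  shows "(\<lambda>v. - f v) \<in> linear_times_Q s"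
proof -
  obtain m where "linear m" "f = (\<lambda>v. m v * Q s v)"
    using assms unfolding linear_times_Q_def by blast
  then show ?thesis
    unfolding linear_times_Q_def
    by (intro CollectI exI[of _ "\<lambda>v. - m v"]) (auto simp: linear_compose_neg)
qed

lemma equiv_cubic_mod: "equiv cubic_forms (cubic_mod s)"
proof (rule equivI)
  have "(\<lambda>v. 0) \<in> linear_times_Q s"
    unfolding linear_times_Q_def by (intro CollectI exI[of _ "\<lambda>v. 0"]) (simp add: linear_zero)
  then show "refl_on cubic_forms (cubic_mod s)"
    by (auto simp: refl_on_def cubic_mod_def)
  show "sym (cubic_mod s)"
  proof (rule symI)
    fix f h assume *: "(f, h) \<in> cubic_mod s"
    then have "(\<lambda>v. - (f v - h v)) \<in> linear_times_Q s"
      by (intro linear_times_Q_uminus) (simp add: cubic_mod_def)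
    with * show "(h, f) \<in> cubic_mod s" by (simp add: cubic_mod_def)
  qed
  show "trans (cubic_mod s)"
  proof (rule transI)
    fix f h k assume *: "(f, h) \<in> cubic_mod s" "(h, k) \<in> cubic_mod s"
    then have "(\<lambda>v. (f v - h v) + (h v - k v)) \<in> linear_times_Q s"
      by (intro linear_times_Q_add) (simp_all add: cubic_mod_def)
    with * show "(f, k) \<in> cubic_mod s" by (simp add: cubic_mod_def)
  qed
qed (auto simp: cubic_mod_def)

lemma cubic_forms_compose:
  assumes "f \<in> cubic_forms" "linear P"
  shows "f \<circ> P \<in> cubic_forms"
proof -
  obtain a b c d where f: "f = cubic a b c d" using assms(1) unfolding cubic_forms_def by blast
  obtain p q where p: "P ex = (p, q)" by (cases "P ex")
  obtain r t where r: "P ey = (r, t)" by (cases "P ey")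
  have "P v = (fst v * p + snd v * r, fst v * q + snd v * t)" for v
    using linear_plane[OF assms(2), of v] by (simp add: p r)
  then have "f \<circ> P = cubic
    (a * p^3 + 3 * b * p\<^sup>2 * q + 3 * c * p * q\<^sup>2 + d * q^3)
    (a * p\<^sup>2 * r + b * (p\<^sup>2 * t + 2 * p * q * r) + c * (2 * p * q * t + q\<^sup>2 * r) + d * q\<^sup>2 * t)
    (a * p * r\<^sup>2 + b * (2 * p * r * t + q * r\<^sup>2) + c * (p * t\<^sup>2 + 2 * q * r * t) + d * q * t\<^sup>2)
    (a * r^3 + 3 * b * r\<^sup>2 * t + 3 * c * r * t\<^sup>2 + d * t^3)"
    by (auto simp: fun_eq_iff f cubic_def algebra_simps power2_eq_square power3_eq_cube)
  then show ?thesis unfolding cubic_forms_def by blast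
qed

text \<open>Substituting a similarity of Q into a multiple of Q gives a multiple of Q.\<close>

lemma cubic_mod_compose:
  assumes "(f, h) \<in> cubic_mod s" "linear P" "\<And>v. Q s (P v) = \<rho> * Q s v"
  shows "(f \<circ> P, h \<circ> P) \<in> cubic_mod s"
proof -
  obtain m where m: "linear m" "(\<lambda>v. f v - h v) = (\<lambda>v. m v * Q s v)"
    using assms(1) unfolding cubic_mod_def linear_times_Q_def by blast
  have "f (P v) - h (P v) = (\<rho> * m (P v)) * Q s v" for v
    using fun_cong[OF m(2), of "P v"] by (simp add: assms(3))
  moreover have "linear (\<lambda>v. \<rho> * m (P v))"
    using linear_compose_scale_right[OF linear_compose[OF assms(2) m(1)], of \<rho>] by (simp add: comp_def)
  ultimately have "(\<lambda>v. (f \<circ> P) v - (h \<circ> P) v) \<in> linear_times_Q s"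
    unfolding linear_times_Q_def by (intro CollectI exI[of _ "\<lambda>v. \<rho> * m (P v)"]) auto
  then show ?thesis
    using assms(1,2) cubic_forms_compose unfolding cubic_mod_def by simp
qed

lemma image_cubic_class:
  assumes "linear N" "bij N" "\<And>v. Q s (N v) = \<rho> * Q s v" "\<rho> \<noteq> 0"
  shows "(\<lambda>f. f \<circ> inv N) ` (cubic_mod s `` {c}) = cubic_mod s `` {c \<circ> inv N}"
proof -
  have inv: "N (inv N v) = v" "inv N (N v) = v" for v
    using assms(2) by (simp_all add: bij_is_surj bij_is_inj surj_f_inv_f)
  have lin: "linear (inv N)"
    using assms(1,2) by (simp add: inj_linear_imp_inv_linear bij_is_inj)
  have Qi: "Q s (inv N v) = inverse \<rho> * Q s v" for v
    using assms(3)[of "inv N v"] assms(4) by (simp add: inv)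
  have cc: "f \<circ> inv N \<circ> N = f" "f \<circ> N \<circ> inv N = f" for f :: "plane \<Rightarrow> real"
    by (simp_all add: fun_eq_iff inv)
  show ?thesis
  proof (intro equalityI subsetI)
    fix x assume "x \<in> (\<lambda>f. f \<circ> inv N) ` (cubic_mod s `` {c})"
    then obtain f where "(c, f) \<in> cubic_mod s" "x = f \<circ> inv N" by blast
    then show "x \<in> cubic_mod s `` {c \<circ> inv N}"
      using cubic_mod_compose[OF _ lin Qi] by simp
  next
    fix x assume "x \<in> cubic_mod s `` {c \<circ> inv N}"
    then have "(c \<circ> inv N \<circ> N, x \<circ> N) \<in> cubic_mod s"
      using cubic_mod_compose[OF _ assms(1,3)] by simp
    then have "x \<circ> N \<in> cubic_mod s `` {c}" by (simp add: cc)
    then have "x \<circ> N \<circ> inv N \<in> (\<lambda>f. f \<circ> inv N) ` (cubic_mod s `` {c})" by (rule imageI)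
    then show "x \<in> (\<lambda>f. f \<circ> inv N) ` (cubic_mod s `` {c})" by (simp only: cc)
  qed
qed

text \<open>If \<open>M\<close> scales \<open>Q\<close> by \<open>\<kappa> > 0\<close>, then \<open>\<kappa> * c \<circ> M\<inverse> = c \<circ> N\<inverse>\<close> where \<open>N\<close> is \<open>M\<close> divided by
  the cube root of \<open>\<kappa>\<close>, and \<open>N\<close> lies in \<open>CO\<close>.\<close>

lemma CO_invariant_transfer:
  assumes inv: "CO_invariant s B"
    and M: "linear M" "bij M" "\<And>v. \<kappa> * Q s v = Q s (M v)" and \<kappa>: "\<kappa> > 0" and l: "linear l"
    and c: "c = cubic a0 a1 a2 a3" "c' = cubic a0' a1' a2' a3'"
    and rel: "\<And>v. \<kappa> * c v = l (M v) * Q s v + c' (M v)"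
    and mem: "cubic_mod s `` {c} \<in> B"
  shows "cubic_mod s `` {c'} \<in> B"
proof -
  define \<mu> where "\<mu> = root 3 \<kappa>"
  have \<mu>: "\<mu> > 0" "\<mu>^3 = \<kappa>" using \<kappa> by (simp_all add: \<mu>_def)
  define N where "N v = (1 / \<mu>) *\<^sub>R M v" for v
  \<comment> \<open>Q is quadratic, so the square root is the right divisor for an isometry;
    \<open>N\<close> is then a dilate of \<open>R\<close>.\<close>
  define R where "R v = (1 / sqrt \<kappa>) *\<^sub>R M v" for v
  have QR: "Q s (t *\<^sub>R v) = t\<^sup>2 * Q s v" for t v
    unfolding Q_eq_quadform by (rule quadform_scale)
  have "linear R" unfolding R_def using linear_compose_scale_right[OF M(1)] .
  moreover have "Q s (R v) = Q s v" for v
    using \<kappa> by (simp add: R_def QR M(3)[symmetric] power_divide)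
  ultimately have "R \<in> OQ s" by (simp add: OQ_def)
  moreover have "N = (\<lambda>v. (sqrt \<kappa> / \<mu>) *\<^sub>R R v)"
    using \<kappa> by (simp add: fun_eq_iff N_def R_def)
  moreover have "sqrt \<kappa> / \<mu> \<noteq> 0" using \<kappa> \<mu> by simp
  ultimately have N_CO: "N \<in> CO s" unfolding CO_def by blast
  have linN: "linear N" unfolding N_def using linear_compose_scale_right[OF M(1)] .
  have "inj N"
  proof (rule injI)
    fix v w assume "N v = N w"
    then have "M v = M w" using \<mu>(1) by (simp add: N_def)
    then show "v = w" using M(2) by (simp add: bij_is_inj inj_eq)
  qed
  then have bijN: "bij N"
    using linear_injective_imp_surjective[OF linN] by (simp add: bij_def)
  define \<rho> where "\<rho> = \<kappa> / \<mu>\<^sup>2"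
  have \<rho>: "\<rho> \<noteq> 0" using \<kappa> \<mu> by (simp add: \<rho>_def)
  have QN: "Q s (N v) = \<rho> * Q s v" for v
    by (simp add: N_def QR M(3)[symmetric] \<rho>_def power_divide)
  have NI: "N (inv N v) = v" for v using bijN by (simp add: bij_is_surj surj_f_inv_f)
  have MN: "M v = \<mu> *\<^sub>R N v" for v using \<mu>(1) by (simp add: N_def)
  have QI: "Q s (inv N x) = Q s x / \<rho>" for x
    using QN[of "inv N x"] \<rho> by (simp add: NI)
  have "(c \<circ> inv N) x - c' x = (\<mu> / (\<kappa> * \<rho>) * l x) * Q s x" for x
  proof -
    have "\<kappa> * c (inv N x) = l (\<mu> *\<^sub>R x) * Q s (inv N x) + c' (\<mu> *\<^sub>R x)"
      using rel[of "inv N x"] by (simp add: MN NI)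
    \<comment> \<open>Here the cube root pays off: c'(\<mu> x) = \<mu>^3 c'(x) = \<kappa> c'(x), so
      \<kappa> cancels from the comparison of the cubics.\<close>
    also have "\<dots> = \<mu> * l x * (Q s x / \<rho>) + \<kappa> * c' x"
      by (simp add: linear_scale[OF l] QI c cubic_scale \<mu>(2))
    finally have "\<kappa> * (c (inv N x) - c' x) = \<mu> * l x * (Q s x / \<rho>)"
      by (simp add: algebra_simps)
    then show ?thesis using \<kappa> \<rho> by (simp add: field_simps)
  qed
  moreover have "linear (\<lambda>x. \<mu> / (\<kappa> * \<rho>) * l x)"
    using linear_compose_scale_right[OF l, of "\<mu> / (\<kappa> * \<rho>)"] by simp
  ultimately have "(\<lambda>x. (c \<circ> inv N) x - c' x) \<in> linear_times_Q s"
    unfolding linear_times_Q_def by (intro CollectI exI[of _ "\<lambda>x. \<mu> / (\<kappa> * \<rho>) * l x"]) auto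
  moreover have "c \<circ> inv N \<in> cubic_forms"
  proof (rule cubic_forms_compose)
    show "c \<in> cubic_forms" using c(1) unfolding cubic_forms_def by blast
    show "linear (inv N)" using linN bijN by (simp add: inj_linear_imp_inv_linear bij_is_inj)
  qed
  moreover have "c' \<in> cubic_forms" using c(2) unfolding cubic_forms_def by blast
  ultimately have "(c \<circ> inv N, c') \<in> cubic_mod s" by (simp add: cubic_mod_def)
  from equiv_class_eq[OF equiv_cubic_mod this]
  have "(\<lambda>f. f \<circ> inv N) ` (cubic_mod s `` {c}) = cubic_mod s `` {c'}"
    using image_cubic_class[OF linN bijN QN \<rho>] by simp
  then show ?thesis
    using inv N_CO mem unfolding CO_invariant_def by (metis (no_types, lifting))
qed

section \<open>The invariant equation\<close>

text \<open>Both graphs are horizontal at the origin, so the linear part \<open>L\<close> is zero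
  and the scaling factor \<kappa> reduces to \<open>height (g e3)\<close>. The second claim serves
  to exclude \<kappa> < 0 for the definite form.\<close>

lemma fibre_transformation:
  assumes \<theta>: "\<theta> \<in> Sigma_set s B" and g: "g \<in> Aff3" and fib: "act g \<theta> \<in> fibre s"
  shows "height (g e3) \<noteq> 0"
    and "\<exists>y. height (g e3) * Q s ex = Q s y"
    and "CO_invariant s B \<Longrightarrow> height (g e3) > 0 \<Longrightarrow> act g \<theta> \<in> Sigma_set s B"
proof -
  have \<theta>f: "\<theta> \<in> fibre s" and mem: "cubic_mod s `` {jet_diff \<theta> (jet 3 0 (quadric s))} \<in> B"
    using \<theta> unfolding Sigma_set_def by simp_all
  obtain U f d0 d1 d2 d3 where f: "open U" "0 \<in> U" "smooth_on U f" "f 0 = 0"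
    "\<theta> = jet 3 0 (graph_over U f)" "jet_diff \<theta> (jet 3 0 (quadric s)) = cubic d0 d1 d2 d3"
    "osmall 3 (\<lambda>x. f x - (quadform 1 0 s x + cubic d0 d1 d2 d3 x / 6))"
    using fibre_graph[OF \<theta>f] .
  obtain W h d0' d1' d2' d3' where h: "open W" "0 \<in> W" "smooth_on W h" "h 0 = 0"
    "act g \<theta> = jet 3 0 (graph_over W h)" "jet_diff (act g \<theta>) (jet 3 0 (quadric s)) = cubic d0' d1' d2' d3'"
    "osmall 3 (\<lambda>x. h x - (quadform 1 0 s x + cubic d0' d1' d2' d3' x / 6))"
    using fibre_graph[OF fib] .
  have gj: "act g \<theta> = jet 3 (g 0) (g ` graph_over U f)"
    unfolding f(5) by (rule act_jet[OF g])
  have g0: "g 0 = 0" using gj h(5) by (simp add: jet_def)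
  obtain A p where A: "linear A" "bij A" "g = (\<lambda>v. A v + p)"
    using g unfolding Aff3_def by blast
  have p: "p = 0" using g0 by (simp add: A(3) linear_0[OF A(1)])
  have gA: "g = A" using A(3) p by simp
  have mem0: "0 \<in> graph_over U f"
    using f(2,4) by (simp add: graph_over_iff linear_0[OF linear_proj] linear_0[OF linear_height])
  have contact: "contact 3 p (graph_over W h) (g ` graph_over U f)"
  proof (rule contact_if_jet_eq)
    show "jet 3 p (graph_over W h) = jet 3 p (g ` graph_over U f)"
      using gj h(5) by (simp add: g0 p)
    show "surface (g ` graph_over U f)" using surface_act[OF g surface_graph_over[OF f(1,3)]] .
    show "p \<in> g ` graph_over U f" using mem0 g0 p by (metis imageI)
  qed
  have pp: "proj p = 0" by (simp add: p linear_0[OF linear_proj])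
  have "osmall 3 (\<lambda>y. h (proj p + y) - h (proj p) -
      ((\<lambda>y. 0) y + quadform 1 0 s y + cubic d0' d1' d2' d3' y / 6))"
    using h(7) by (simp add: pp h(4))
  note * = affine_graph_coefficients[OF A(3,1,2) f(1,3,4,7) h(1,3) contact this linear_zero]
  define M where "M v = proj (A (lift v))" for v
  define \<kappa> where "\<kappa> = height (g e3)"
  have m0: "height (A (lift v)) = 0" for v using *(1) .
  have QM: "\<kappa> * Q s v = Q s (M v)" for v
    using *(2)[of v] by (simp add: Q_eq_quadform M_def \<kappa>_def gA)
  show "height (g e3) \<noteq> 0" using *(4) by (simp add: gA)
  show "\<exists>y. height (g e3) * Q s ex = Q s y"
    using QM[of ex] unfolding \<kappa>_def by blast
  assume inv: "CO_invariant s B" and pos: "height (g e3) > 0"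
  have linM: "linear M"
    unfolding M_def using linear_compose[OF linear_compose[OF linear_lift A(1)] linear_proj]
    by (simp add: comp_def)
  have "inj M"
  proof (rule injI)
    fix v w assume "M v = M w"
    then have "A (lift v) = A (lift w)" by (simp add: space_eq_iff M_def m0)
    then have "lift v = lift w" using A(2) by (simp add: bij_is_inj inj_eq)
    then show "v = w" by (simp add: lift_def prod_eq_iff)
  qed
  then have bijM: "bij M"
    using linear_injective_imp_surjective[OF linM] by (simp add: bij_def)
  \<comment> \<open>The contribution of the horizontal part of \<open>g e3\<close>: after
    multiplication by Q it is the ambiguity that the quotient removes.\<close>
  define l where "l y = 6 * polar 1 0 s y (proj (A e3))" for y
  have linl: "linear l"
    unfolding l_def polar_def by (auto intro!: linearI simp: algebra_simps)
  have rel: "\<kappa> * cubic d0 d1 d2 d3 v = l (M v) * Q s v + cubic d0' d1' d2' d3' (M v)" for v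
    using *(3)[of v] by (simp add: Q_eq_quadform M_def \<kappa>_def gA l_def mult_ac)
  have "cubic_mod s `` {cubic d0' d1' d2' d3'} \<in> B"
    using CO_invariant_transfer[OF inv linM bijM QM pos[folded \<kappa>_def] linl refl refl rel] mem f(6)
    by simp
  then show "act g \<theta> \<in> Sigma_set s B"
    using fib h(6) by (simp add: Sigma_set_def)
qed

lemma swap_swap: "swap (swap v) = v"
  by (simp add: swap_def case_prod_unfold)

lemma swap_Aff3: "swap \<in> Aff3"
proof (rule Aff3_linear)
  show "linear swap" by (auto intro!: linearI simp: swap_def)
  show "bij swap" by (rule involuntory_imp_bij) (rule swap_swap)
qed

lemma act_swap_swap: "act swap (act swap \<theta>) = \<theta>"
proof -
  have "swap \<circ> swap = (\<lambda>v. v)" by (simp add: fun_eq_iff swap_swap)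
  then show ?thesis by (simp add: act_comp act_id)
qed

text \<open>Exchanging x and y negates the form of the saddle, and negating the height compensates
  for it.\<close>

lemma act_swap_fibre:
  assumes "\<theta> \<in> fibre (-1)"
  shows "act swap \<theta> \<in> fibre (-1)"
proof -
  obtain S where S: "surface S" "0 \<in> S" "jet 2 0 S = jet 2 0 (quadric (-1))" "\<theta> = jet 3 0 S"
    using assms unfolding fibre_def by blast
  have s0: "swap 0 = 0" by (simp add: swap_def zero_prod_def)
  have "swap q \<in> quadric (-1)" if "q \<in> quadric (-1)" for q
    using that unfolding quadric_def graph_over_iff
    by (auto simp: swap_def proj_def height_def Q_def case_prod_unfold field_simps)
  then have "swap ` quadric (-1) \<subseteq> quadric (-1)" "quadric (-1) \<subseteq> swap ` quadric (-1)"
    by (auto simp: image_iff) (metis swap_swap)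
  then have sq: "swap ` quadric (-1) = quadric (-1)" by (rule equalityI)
  have "jet 2 0 (swap ` S) = act swap (jet 2 0 S)"
    using act_jet[OF swap_Aff3, of 2 0 S] s0 by simp
  also have "\<dots> = jet 2 0 (quadric (-1))"
    using act_jet[OF swap_Aff3, of 2 0 "quadric (-1)"] s0 sq S(3) by simp
  finally have "jet 2 0 (swap ` S) = jet 2 0 (quadric (-1))" .
  moreover have "act swap \<theta> = jet 3 0 (swap ` S)"
    using act_jet[OF swap_Aff3, of 3 0 S] s0 S(4) by simp
  moreover have "0 \<in> swap ` S" using S(2) s0 by (metis imageI)
  ultimately show ?thesis
    unfolding fibre_def using surface_act[OF swap_Aff3 S(1)] by blast
qed

lemma PDE_iff: "\<theta> \<in> PDE s B \<longleftrightarrow> (\<exists>g\<in>Aff3. \<exists>\<theta>'\<in>Sigma_set s B. \<theta> = act g \<theta>')"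
  unfolding PDE_def aff_orbit_def by blast

theorem theorem4p1:
  fixes s :: real and B :: "(plane \<Rightarrow> real) set set"
  assumes "s = 1 \<or> s = -1"
    and "B \<subseteq> S30 s"
    and "CO_invariant s B"
  shows "aff_invariant (PDE s B) \<and> PDE s B \<subseteq> J3 s \<and>
    (s = 1 \<longrightarrow> PDE s B \<inter> fibre s = Sigma_set s B) \<and>
    (s = -1 \<longrightarrow> PDE s B \<inter> fibre s = Sigma_set s B \<union> act swap ` Sigma_set s B)"
proof (intro conjI impI)
  show "aff_invariant (PDE s B)"
    unfolding aff_invariant_def
  proof (intro ballI)
    fix g \<theta> assume g: "g \<in> Aff3" and "\<theta> \<in> PDE s B"
    then obtain h \<theta>' where h: "h \<in> Aff3" "\<theta>' \<in> Sigma_set s B" "\<theta> = act h \<theta>'"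
      unfolding PDE_iff by blast
    have "act g \<theta> = act (g \<circ> h) \<theta>'" by (simp only: h(3) act_comp)
    then show "act g \<theta> \<in> PDE s B"
      unfolding PDE_iff using Aff3_comp[OF g h(1)] h(2) by blast
  qed
  show "PDE s B \<subseteq> J3 s"
  proof
    fix \<theta> assume "\<theta> \<in> PDE s B"
    then obtain g \<theta>' where g: "g \<in> Aff3" "\<theta>' \<in> Sigma_set s B" "\<theta> = act g \<theta>'"
      unfolding PDE_iff by blast
    have "\<theta>' \<in> fibre s" using g(2) by (simp add: Sigma_set_def)
    then obtain U f d0 d1 d2 d3 where f: "open U" "0 \<in> U" "smooth_on U f" "f 0 = 0"
      "\<theta>' = jet 3 0 (graph_over U f)"
      "osmall 3 (\<lambda>x. f x - (quadform 1 0 s x + cubic d0 d1 d2 d3 x / 6))"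
      by (rule fibre_graph)
    show "\<theta> \<in> J3 s"
      using act_jet_in_J3[OF assms(1) g(1) f(1-4,6)] by (simp only: g(3) f(5))
  qed
  have Sigma_sub: "Sigma_set s B \<subseteq> PDE s B \<inter> fibre s"
  proof
    fix \<theta> assume *: "\<theta> \<in> Sigma_set s B"
    have "\<theta> \<in> PDE s B"
      unfolding PDE_iff using Aff3_id * act_id[of \<theta>, symmetric] by blast
    then show "\<theta> \<in> PDE s B \<inter> fibre s"
      using * by (simp add: Sigma_set_def)
  qed
  {
    assume s: "s = 1"
    show "PDE s B \<inter> fibre s = Sigma_set s B"
    proof (rule equalityI[OF subsetI Sigma_sub])
      fix \<theta> assume \<theta>: "\<theta> \<in> PDE s B \<inter> fibre s"
      then have "\<theta> \<in> PDE s B" by simp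
      then obtain g \<theta>' where g: "g \<in> Aff3" "\<theta>' \<in> Sigma_set s B" "\<theta> = act g \<theta>'"
        unfolding PDE_iff by blast
      have fib: "act g \<theta>' \<in> fibre s" using \<theta> g(3) by simp
      obtain y where "height (g e3) * Q s ex = Q s y"
        using fibre_transformation(2)[OF g(2,1) fib] by blast
      \<comment> \<open>Q takes the value 1/2 at \<open>ex\<close>, so the factors 1/2 cancel and
        \<kappa> is a sum of two squares.\<close>
      then have "height (g e3) = (fst y)\<^sup>2 + (snd y)\<^sup>2"
        by (simp add: s Q_def ex_def case_prod_unfold)
      then have "height (g e3) \<ge> 0" by simp
      then have "height (g e3) > 0"
        using fibre_transformation(1)[OF g(2,1) fib] by simp
      from fibre_transformation(3)[OF g(2,1) fib assms(3) this]
      show "\<theta> \<in> Sigma_set s B" by (simp add: g(3))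
    qed
  next
    assume s: "s = -1"
    show "PDE s B \<inter> fibre s = Sigma_set s B \<union> act swap ` Sigma_set s B"
    proof (intro equalityI subsetI)
      fix \<theta> assume \<theta>: "\<theta> \<in> PDE s B \<inter> fibre s"
      then have "\<theta> \<in> PDE s B" by simp
      then obtain g \<theta>' where g: "g \<in> Aff3" "\<theta>' \<in> Sigma_set s B" "\<theta> = act g \<theta>'"
        unfolding PDE_iff by blast
      have fib: "act g \<theta>' \<in> fibre s" using \<theta> g(3) by simp
      consider "height (g e3) > 0" | "height (g e3) < 0"
        using fibre_transformation(1)[OF g(2,1) fib] by linarith
      then show "\<theta> \<in> Sigma_set s B \<union> act swap ` Sigma_set s B"
      proof cases
        case 1
        from fibre_transformation(3)[OF g(2,1) fib assms(3) this] show ?thesis by (simp add: g(3))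
      next
        case 2
        \<comment> \<open>Composition with \<open>swap\<close> stays in the fibre and changes the
          sign of \<kappa>, which leads to the positive case; applying \<open>swap\<close> once more
          recovers \<theta>.\<close>
        have "act (swap \<circ> g) \<theta>' \<in> fibre s"
          using act_swap_fibre fib s by (simp add: act_comp[symmetric])
        moreover have "height ((swap \<circ> g) e3) > 0"
          using 2 by (simp add: swap_def height_def case_prod_unfold)
        ultimately have "act (swap \<circ> g) \<theta>' \<in> Sigma_set s B"
          using fibre_transformation(3)[OF g(2) Aff3_comp[OF swap_Aff3 g(1)] _ assms(3)] by blast
        then have "act swap \<theta> \<in> Sigma_set s B" by (simp add: g(3) act_comp)
        then have "act swap (act swap \<theta>) \<in> act swap ` Sigma_set s B" by (rule imageI)
        then show ?thesis by (simp add: act_swap_swap)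
      qed
    next
      fix \<theta> assume "\<theta> \<in> Sigma_set s B \<union> act swap ` Sigma_set s B"
      then show "\<theta> \<in> PDE s B \<inter> fibre s"
      proof
        assume "\<theta> \<in> Sigma_set s B" then show ?thesis using Sigma_sub by blast
      next
        assume "\<theta> \<in> act swap ` Sigma_set s B"
        then obtain \<theta>' where *: "\<theta>' \<in> Sigma_set s B" "\<theta> = act swap \<theta>'" by blast
        then have "\<theta> \<in> fibre s" using act_swap_fibre s by (simp add: Sigma_set_def)
        moreover have "\<theta> \<in> PDE s B" unfolding PDE_iff using * swap_Aff3 by blast
        ultimately show ?thesis by simp
      qed
    qed
  }
qed

end
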